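(* Let $G$ be a finite simple graph that contains no triangle, no ISK4 and no $K_{3,3}$. Then $G$ is series-parallel or $G$ has a wheel decomposition.
   Context: $G$ contains $H$ if $H$ is isomorphic to an induced subgraph of $G$. A subdivision of a graph is obtained by repeatedly replacing an edge $vw$ by a path $vuw$ through a new vertex $u$. An ISK4 is an induced subgraph that is a subdivision of $K_4$. A graph is series-parallel if no subgraph of it is a subdivision of $K_4$. A cutset is a set $C$ of vertices with $G\setminus C$ disconnected. A hole is a chordless cycle of length at least 4. A wheel $(H,x)$ of $G$ is an induced subgraph consisting of a hole $H$ and a vertex $x\notin V(H)$ having at least three neighbors on $H$; let $x_1,\dots,x_n$ be the neighbors of $x$ on $H$ in the order along $H$, and for $i=1,\dots,n$ (indices mod $n$) let the sector $S_i$ be the subpath of $H$ with ends $x_i,x_{i+1}$ whose interior vertices are not adjacent to $x$. With $N[x]=N(x)\cup\{x\}$, $G$ has a wheel decomposition if for some wheel $(H,x)$ of $G$, for every $i\in\{1,\dots,n\}$, the set $(N[x]\setminus V(H))\cup\{x_i,x_{i+1}\}$ is a cutset separating $S_i$ from $H\setminus S_i$. *)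

theory Defs
  imports "Graph_Theory.Graph_Theory"
begin

text \<open>
  A finite simple graph is a \<^const>\<open>pair_graph\<close>: an undirected edge \<open>uv\<close> is the pair of
  opposite arcs \<open>(u,v)\<close>, \<open>(v,u)\<close>.
\<close>

definition contains :: "'a pair_pre_digraph \<Rightarrow> 'b pair_pre_digraph \<Rightarrow> bool" where
  "contains G H \<longleftrightarrow>
     (\<exists>I :: 'a pair_pre_digraph. induced_subgraph (with_proj I) (with_proj G)
        \<and> digraph_iso (with_proj H) (with_proj I))"

text \<open>
  Subdividing only adds vertices, so the subdivided copy \<open>K\<close> of \<open>K\<^sub>4\<close> can be taken on
  vertices of \<open>H\<close>; no further isomorphism is needed.
\<close>

definition K4_subdivision :: "'a pair_pre_digraph \<Rightarrow> bool" where
  "K4_subdivision H \<longleftrightarrow>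
     (\<exists>K :: 'a pair_pre_digraph. complete_digraph 4 (with_proj K) \<and> subdivision_pair K H)"

definition ISK4 :: "'a pair_pre_digraph \<Rightarrow> 'a pair_pre_digraph \<Rightarrow> bool" where
  "ISK4 H G \<longleftrightarrow> induced_subgraph (with_proj H) (with_proj G) \<and> K4_subdivision H"

definition series_parallel :: "'a pair_pre_digraph \<Rightarrow> bool" where
  "series_parallel G \<longleftrightarrow>
     \<not> (\<exists>H. subgraph (with_proj H) (with_proj G) \<and> K4_subdivision H)"

definition delete_verts :: "'a pair_pre_digraph \<Rightarrow> 'a set \<Rightarrow> ('a, 'a \<times> 'a) pre_digraph" where
  "delete_verts G C = with_proj G \<restriction> (pverts G - C)"

text \<open>
  The graph without vertices is not \<open>connected\<close> in the sense of the library; it should not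
  count as disconnected either.
\<close>

definition cutset :: "'a pair_pre_digraph \<Rightarrow> 'a set \<Rightarrow> bool" where
  "cutset G C \<longleftrightarrow> C \<subseteq> pverts G \<and> pverts G - C \<noteq> {}
     \<and> \<not> Digraph_Component.connected (delete_verts G C)"

text \<open>
  The sets \<open>A\<close> and \<open>B\<close> may meet \<open>C\<close> (a sector has its two ends in the cutset); separation
  concerns what remains of them in \<open>G \<setminus> C\<close>, and something must remain on both sides.
\<close>

definition cutset_separating ::
    "'a pair_pre_digraph \<Rightarrow> 'a set \<Rightarrow> 'a set \<Rightarrow> 'a set \<Rightarrow> bool" where
  "cutset_separating G C A B \<longleftrightarrow> cutset G C \<and> A - C \<noteq> {} \<and> B - C \<noteq> {}
     \<and> (\<forall>a\<in>A - C. \<forall>b\<in>B - C. \<not> a \<rightarrow>\<^sup>*\<^bsub>delete_verts G C\<^esub> b)"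

definition nbrs :: "'a pair_pre_digraph \<Rightarrow> 'a \<Rightarrow> 'a set" where
  "nbrs G x = {v. (x, v) \<in> parcs G}"

text \<open>
  A hole is given by the list of its vertices in cyclic order, from an arbitrary starting
  vertex and in one of the two directions.
\<close>

definition cycle_arcs :: "'a list \<Rightarrow> ('a \<times> 'a) list" where
  "cycle_arcs vs = vwalk_arcs (vs @ [hd vs])"

definition hole :: "'a pair_pre_digraph \<Rightarrow> 'a list \<Rightarrow> bool" where
  "hole G vs \<longleftrightarrow> 4 \<le> length vs \<and> pre_digraph.cycle (with_proj G) (cycle_arcs vs)
     \<and> (\<forall>u\<in>set vs. \<forall>v\<in>set vs. (u, v) \<in> parcs G \<longrightarrow>
          (u, v) \<in> set (cycle_arcs vs) \<or> (v, u) \<in> set (cycle_arcs vs))"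

definition wheel :: "'a pair_pre_digraph \<Rightarrow> 'a list \<Rightarrow> 'a \<Rightarrow> bool" where
  "wheel G vs x \<longleftrightarrow> hole G vs \<and> x \<in> pverts G - set vs \<and> 3 \<le> card (nbrs G x \<inter> set vs)"

definition spoke_ends :: "'a pair_pre_digraph \<Rightarrow> 'a list \<Rightarrow> 'a \<Rightarrow> 'a list" where
  "spoke_ends G vs x = filter (\<lambda>v. v \<in> nbrs G x) vs"

text \<open>
  A subpath of a cycle is a nonempty initial segment of a rotation of its vertex list. As the
  path runs in the direction of \<open>vs\<close>, there is exactly one sector from each spoke end to the
  cyclically next one.
\<close>

definition sector :: "'a pair_pre_digraph \<Rightarrow> 'a list \<Rightarrow> 'a \<Rightarrow> 'a \<Rightarrow> 'a \<Rightarrow> 'a list \<Rightarrow> bool" where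
  "sector G vs x a b S \<longleftrightarrow> S \<noteq> [] \<and> (\<exists>k m. S = take m (rotate k vs))
     \<and> hd S = a \<and> last S = b \<and> (\<forall>v\<in>set S - {a, b}. v \<notin> nbrs G x)"

definition wheel_decomposition :: "'a pair_pre_digraph \<Rightarrow> bool" where
  "wheel_decomposition G \<longleftrightarrow>
     (\<exists>vs x. wheel G vs x \<and>
        (let xs = spoke_ends G vs x; n = length xs in
         \<forall>i<n. \<exists>S. sector G vs x (xs ! i) (xs ! (Suc i mod n)) S \<and>
           cutset_separating G
             ((insert x (nbrs G x) - set vs) \<union> {xs ! i, xs ! (Suc i mod n)})
             (set S) (set vs - set S)))"

end

theory Submission
  imports Defs
begin

text \<open>
  The recurring obstruction: if \<open>C\<close> is a hole, \<open>x\<close> a vertex off \<open>C\<close>, and three pairwise anticomplete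
  connected sets (or edges) join \<open>x\<close> to three distinct vertices of \<open>C\<close>, then shortest paths through
  them together with \<open>C\<close> form an ISK4. In particular no vertex has exactly three neighbours on a hole.

  If \<open>G\<close> is not series-parallel, a subdivision of \<open>K\<^sub>4\<close> gives a cycle and a connected set \<open>D\<close> off it with at
  least three attachments on it; a shortest such cycle is a hole. Were there no wheel, a smallest
  such \<open>D\<close> would be a path or a claw, and each position of its attachments yields an ISK4 or \<open>K\<^bsub>3,3\<^esub>\<close>.
  So \<open>G\<close> has a wheel.

  In a wheel with shortest rim and then fewest spokes, every vertex outside the rim and outside
  \<open>N[x]\<close> has all its rim neighbours in one sector; call such a wheel proper. Choose a
  proper wheel with fewest spokes. If a connected set avoiding \<open>N[x]\<close> joins the interior of a sector to
  the rest of the rim, then a subpath of the rim closed up through this set is the rim of a wheel with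
  the same hub and fewer spokes; taking one with the fewest makes it proper again, a
  contradiction. Hence every sector is separated as a wheel decomposition demands.
\<close>

section \<open>Induced paths, holes and connected sets\<close>

text \<open>Most cases are decided by counting. A vertex \<open>x\<close> off a hole cannot have
  exactly 3 neighbours on it; if it has 2, no connected set may link it to a third vertex of the
  hole; if it has 4 or more, there is a wheel. So when a detour closes part of a rim to a hole, its
  spokes are compared with those of a minimal wheel, and a count of 2 is refuted by finding a third
  link in the discarded part of the rim.

  Triangle-freeness keeps the constructions induced: neighbours of one vertex are never adjacent, so
  sectors have interior vertices and a hub closes a sector to a hole.

  Two minimisations are needed because a rim rerouted through a connected set may become longer. A
  shortest rim yields some proper wheel; afterwards only spokes are compared, among proper wheels of
  any length. A rerouted wheel with fewer spokes is therefore not proper, and a vertex violating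
  properness is used to reroute a smaller part of the rim: a descent that cannot go on.

  K_{3,3} arises in a single configuration: a hole of length 4 and two adjacent vertices off it,
  each adjacent to one pair of opposite vertices.\<close>

locale sgraph =
  fixes E :: "'a \<Rightarrow> 'a \<Rightarrow> bool"
  assumes sym: "E u v \<Longrightarrow> E v u"
    and irrefl: "\<not> E u u"
begin

lemma sym_iff: "E u v \<longleftrightarrow> E v u" using sym by blast

text \<open>An induced path as a vertex list: a single equivalence per vertex demands the edge to
  its successor and forbids chords.\<close>

fun ipath :: "'a list \<Rightarrow> bool" where
  "ipath [] = True"
| "ipath (a # p) = (a \<notin> set p \<and> (\<forall>v\<in>set p. E a v \<longleftrightarrow> v = hd p) \<and> ipath p)"

text \<open>The first vertex is singled out: it sees exactly the two ends of the chordless path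
  \<open>tl c\<close>. \<open>ihole_append\<close> removes this asymmetry.\<close>

definition ihole :: "'a list \<Rightarrow> bool" where
  "ihole c \<longleftrightarrow> 4 \<le> length c \<and> hd c \<notin> set (tl c) \<and> ipath (tl c)
     \<and> (\<forall>v\<in>set (tl c). E (hd c) v \<longleftrightarrow> v = hd (tl c) \<or> v = last c)"

lemma ipath_append:
  "ipath (p @ q) \<longleftrightarrow> ipath p \<and> ipath q \<and> set p \<inter> set q = {}
     \<and> (\<forall>u\<in>set p. \<forall>v\<in>set q. E u v \<longleftrightarrow> u = last p \<and> v = hd q)"
proof (induction p)
  case (Cons a p)
  show ?case
  proof (cases "p = []")
    case False
    then have "hd p \<in> set q \<Longrightarrow> set p \<inter> set q \<noteq> {}" using hd_in_set by blast
    with False Cons show ?thesis by auto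
  qed auto
qed simp

lemma ipath_distinct: "ipath p \<Longrightarrow> distinct p" by (induction p) auto

lemma ipath_rev [simp]: "ipath (rev p) = ipath p"
proof (induction p)
  case (Cons a p)
  have "ipath (rev (a # p)) \<longleftrightarrow> ipath p \<and> a \<notin> set p \<and> (\<forall>u\<in>set p. E u a \<longleftrightarrow> u = hd p)"
    using Cons by (auto simp: ipath_append last_rev)
  then show ?case by (auto simp: sym_iff)
qed simp

lemma ipath_adj:
  assumes "ipath (p @ a # b # q)" shows "E a b"
  using assms by (simp add: ipath_append)

lemma ipath_successively: "ipath p \<Longrightarrow> successively E p"
  by (induction p rule: induct_list012) auto

text \<open>The cut may be made anywhere: both arcs are chordless and only the two cut edges run
  between them. This form is symmetric in \<open>p\<close> and \<open>q\<close>, so rotation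
  invariance follows at once.\<close>

lemma ihole_append:
  assumes "p \<noteq> []" "q \<noteq> []"
  shows "ihole (p @ q) \<longleftrightarrow> 4 \<le> length (p @ q) \<and> ipath p \<and> ipath q \<and> set p \<inter> set q = {}
     \<and> (\<forall>u\<in>set p. \<forall>v\<in>set q. E u v \<longleftrightarrow> (u = last p \<and> v = hd q) \<or> (u = hd p \<and> v = last q))"
proof -
  obtain a p' where p: "p = a # p'" using assms by (cases p) auto
  show ?thesis
  proof (cases "p' = []")
    case True
    then show ?thesis using assms by (auto simp: p ihole_def)
  next
    case False
    then have "hd p' \<in> set q \<Longrightarrow> set p' \<inter> set q \<noteq> {}" "last q \<in> set p' \<Longrightarrow> set p' \<inter> set q \<noteq> {}"
      using assms hd_in_set last_in_set by blast+
    with False assms show ?thesis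
      by (auto simp: p ihole_def ipath_append)
  qed
qed

lemma ihole_rotate: "ihole (p @ q) \<Longrightarrow> ihole (q @ p)"
proof (cases "p = [] \<or> q = []")
  case False
  then have ne: "p \<noteq> []" "q \<noteq> []" by auto
  assume h: "ihole (p @ q)"
  show "ihole (q @ p)"
    using h unfolding ihole_append[OF ne] ihole_append[OF ne(2,1)] by (simp add: sym_iff[of _ _]) (metis Int_commute add.commute sym_iff)
qed auto

lemma ihole_rev: "ihole c \<Longrightarrow> ihole (rev c)"
proof -
  assume h: "ihole c"
  then have "4 \<le> length c" by (simp add: ihole_def)
  then obtain a p where c: "c = a # p" and p: "p \<noteq> []" by (cases c) fastforce+
  have "ihole ([a] @ rev p)"
    using h p by (subst ihole_append) (auto simp: c ihole_def hd_rev last_rev)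
  from ihole_rotate[OF this] show ?thesis by (simp add: c)
qed

lemma ihole_length: "ihole c \<Longrightarrow> 4 \<le> length c" by (simp add: ihole_def)

lemma ihole_distinct: "ihole c \<Longrightarrow> distinct c"
  by (cases c) (auto simp: ihole_def ipath_distinct)

lemma ihole_card: "ihole c \<Longrightarrow> card (set c) = length c"
  by (simp add: distinct_card ihole_distinct)

text \<open>The start of an induced path has only one neighbour on it, so an induced path
  \<open>q\<close> inside \<open>p\<close> with the same start has no choice at any vertex.\<close>

lemma ipath_prefix:
  assumes "ipath p" "ipath q" "set q \<subseteq> set p" "q \<noteq> []" "hd q = hd p"
  shows "\<exists>r. p = q @ r"
  using assms
proof (induction p arbitrary: q)
  case (Cons a p)
  obtain q' where q: "q = a # q'" using Cons.prems by (cases q) auto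
  show ?case
  proof (cases "q' = []")
    case True then show ?thesis by (simp add: q)
  next
    case False
    have sub: "set q' \<subseteq> set p" using Cons.prems q by auto
    have "hd q' \<in> set q'" using False by simp
    then have "E a (hd q')" "hd q' \<in> set p" using Cons.prems q sub by auto
    then have "hd q' = hd p" using Cons.prems by auto
    then show ?thesis using Cons.IH[of q'] Cons.prems q sub False by auto
  qed
qed simp

lemma ihole_start:
  assumes "ihole c" "a \<in> set c"
  shows "\<exists>p. ihole (a # p) \<and> set (a # p) = set c"
proof -
  obtain \<alpha> \<beta> where "c = \<alpha> @ a # \<beta>" using assms(2) by (meson split_list)
  then have "ihole ((a # \<beta>) @ \<alpha>)" "set ((a # \<beta>) @ \<alpha>) = set c" using ihole_rotate[of \<alpha> "a # \<beta>"] assms by auto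
  then show ?thesis by (metis append_Cons)
qed

text \<open>A vertex of a hole has two neighbours on it, the first vertex of an induced path at most
  one on the path.\<close>

lemma ihole_not_ipath:
  assumes "ihole c" "ipath q" shows "set q \<noteq> set c"
proof
  assume eq: "set q = set c"
  have q: "q \<noteq> []" using eq assms ihole_length by force
  then obtain p where p: "ihole (hd q # p)" "set (hd q # p) = set c"
    using ihole_start[OF assms(1), of "hd q"] eq by (metis hd_in_set)
  have l: "3 \<le> length p" using ihole_length[OF p(1)] by simp
  then have ne: "p \<noteq> []" "hd p \<noteq> last p"
    using p(1) by (auto simp: ihole_def dest!: ipath_distinct) (cases p; auto split: if_splits)
  have "E (hd q) (hd p)" "E (hd q) (last p)" "hd p \<in> set p" "last p \<in> set p" using p(1) ne by (auto simp: ihole_def)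
  moreover obtain b q' where q': "q = b # q'" using q by (cases q) auto
  moreover have "set q' = set p" using q' p eq assms by (auto simp: ihole_def)
  ultimately show False using ne assms(2) by auto
qed

text \<open>Rotate the hole to the first vertex of \<open>Y\<close>, reverse it if the second vertex
  of \<open>Y\<close> comes last, and continue as in \<open>ipath_prefix\<close>. This puts any
  subpath of a rim in front, the normal form used throughout.\<close>

lemma ihole_extend:
  assumes "ihole c" "ipath Y" "Y \<noteq> []" "set Y \<subseteq> set c"
  shows "\<exists>r. r \<noteq> [] \<and> ihole (Y @ r) \<and> set (Y @ r) = set c"
proof -
  obtain a Y' where Y: "Y = a # Y'" using assms by (cases Y) auto
  obtain p where p: "ihole (a # p)" "set (a # p) = set c" using ihole_start[OF assms(1), of a] assms Y by auto
  have "\<exists>p. ihole (a # p) \<and> set (a # p) = set c \<and> (\<exists>r. a # p = Y @ r)"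
  proof (cases "Y' = []")
    case True then show ?thesis using p Y by auto
  next
    case False
    have sub: "set Y' \<subseteq> set p" using assms Y p by auto
    have h: "hd Y' \<in> set Y'" using False by simp
    then have e: "E a (hd Y')" "hd Y' \<in> set p" using assms Y sub by auto
    then consider "hd Y' = hd p" | "hd Y' = last p" using p(1) by (cases p) (auto simp: ihole_def split: if_splits)
    then show ?thesis
    proof cases
      case 1
      then show ?thesis using ipath_prefix[of p Y'] p sub assms Y False by (auto simp: ihole_def)
    next
      case 2
      have "ihole (rev p @ [a])" using ihole_rev[OF p(1)] by simp
      then have h2: "ihole (a # rev p)" using ihole_rotate[of "rev p" "[a]"] by simp
      then have "\<exists>r. rev p = Y' @ r" using ipath_prefix[of "rev p" Y'] sub assms Y False 2
        by (auto simp: ihole_def hd_rev)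
      then show ?thesis using h2 p Y by (intro exI[of _ "rev p"]) auto
    qed
  qed
  then obtain r where r: "ihole (Y @ r)" "set (Y @ r) = set c" by metis
  moreover have "r \<noteq> []" using r ihole_not_ipath[OF r(1), of Y] assms by auto
  ultimately show ?thesis by blast
qed

text \<open>Both defects, a repeated vertex and a chord, are returned in one shape, so that
  \<open>conn_path\<close> can cut either out of a shortest walk.\<close>

lemma not_ipath_chord:
  assumes "successively E w" "\<not> ipath w"
  shows "\<exists>\<alpha> u \<beta> v \<gamma>. w = \<alpha> @ u # \<beta> @ v # \<gamma> \<and> (u = v \<or> (\<beta> \<noteq> [] \<and> E u v))"
  using assms
proof (induction w)
  case (Cons a w)
  show ?case
  proof (cases "ipath w")
    case False
    then have "\<exists>\<alpha> u \<beta> v \<gamma>. w = \<alpha> @ u # \<beta> @ v # \<gamma> \<and> (u = v \<or> (\<beta> \<noteq> [] \<and> E u v))"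
      using Cons by (cases w) auto
    then show ?thesis by (metis append_Cons)
  next
    case True
    then have wne: "w \<noteq> []" using Cons.prems by auto
    then have hd: "E a (hd w)" using Cons.prems by (cases w) auto
    consider "a \<in> set w" | v where "v \<in> set w" "E a v" "v \<noteq> hd w" using True Cons.prems hd by auto
    then show ?thesis
    proof cases
      case 1
      then obtain \<beta> \<gamma> where "w = \<beta> @ a # \<gamma>" by (meson split_list)
      then have "a # w = [] @ a # \<beta> @ a # \<gamma>" by simp
      then show ?thesis by blast
    next
      case 2
      then obtain \<beta> \<gamma> where "w = \<beta> @ v # \<gamma>" by (meson split_list)
      moreover from this 2 have "\<beta> \<noteq> []" by auto
      ultimately have "a # w = [] @ a # \<beta> @ v # \<gamma> \<and> \<beta> \<noteq> [] \<and> E a v" using 2 by simp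
      then show ?thesis by blast
    qed
  qed
qed simp

definition conn :: "'a set \<Rightarrow> bool" where
  "conn D \<longleftrightarrow> D \<noteq> {} \<and> (\<forall>a\<in>D. \<forall>b\<in>D. (\<lambda>u v. u \<in> D \<and> v \<in> D \<and> E u v)\<^sup>*\<^sup>* a b)"

definition touches :: "'a set \<Rightarrow> 'a \<Rightarrow> bool" where
  "touches D v \<longleftrightarrow> (\<exists>d\<in>D. E d v)"

lemma conn_sing [simp]: "conn {a}" by (simp add: conn_def)

lemma rel_mono:
  assumes "(\<lambda>u v. u \<in> A \<and> v \<in> A \<and> E u v)\<^sup>*\<^sup>* a b" "A \<subseteq> B"
  shows "(\<lambda>u v. u \<in> B \<and> v \<in> B \<and> E u v)\<^sup>*\<^sup>* a b"
  using assms(1) by (rule rtranclp_mono[THEN predicate2D, rotated]) (use assms(2) in auto)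

lemma conn_UnI:
  assumes "conn A" "conn B" "a \<in> A" "b \<in> B" "a = b \<or> E a b"
  shows "conn (A \<union> B)"
proof -
  let ?R = "\<lambda>u v. u \<in> A \<union> B \<and> v \<in> A \<union> B \<and> E u v"
  have A: "?R\<^sup>*\<^sup>* u v" if "u \<in> A" "v \<in> A" for u v using that assms rel_mono[of A u v "A \<union> B"] by (auto simp: conn_def)
  have B: "?R\<^sup>*\<^sup>* u v" if "u \<in> B" "v \<in> B" for u v using that assms rel_mono[of B u v "A \<union> B"] by (auto simp: conn_def)
  have ab: "?R\<^sup>*\<^sup>* a b" "?R\<^sup>*\<^sup>* b a" using assms sym by auto
  have "?R\<^sup>*\<^sup>* u v" if "u \<in> A \<union> B" "v \<in> A \<union> B" for u v
    using that A B ab assms(3,4) by (meson UnE rtranclp_trans)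
  then show ?thesis using assms by (auto simp: conn_def)
qed

lemma conn_insert:
  assumes "conn A" "touches A b" shows "conn (insert b A)"
  using conn_UnI[OF assms(1) conn_sing, of _ b b] assms by (auto simp: touches_def)

lemma conn_ipath: "ipath p \<Longrightarrow> p \<noteq> [] \<Longrightarrow> conn (set p)"
proof (induction p)
  case (Cons a p)
  then have "p \<noteq> [] \<Longrightarrow> E (hd p) a" using sym by simp
  with Cons show ?case by (cases "p = []") (auto intro!: conn_insert bexI[of _ "hd p"] simp: touches_def)
qed simp

lemma conn_walk:
  assumes "conn D" "a \<in> D" "b \<in> D"
  shows "\<exists>w. w \<noteq> [] \<and> successively E w \<and> set w \<subseteq> D \<and> hd w = a \<and> last w = b"
proof -
  have "(\<lambda>u v. u \<in> D \<and> v \<in> D \<and> E u v)\<^sup>*\<^sup>* a b" using assms by (auto simp: conn_def)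
  then show ?thesis
  proof (induction rule: rtranclp_induct)
    case base
    show ?case by (rule exI[of _ "[a]"]) (use assms in auto)
  next
    case (step y z)
    then obtain w where "w \<noteq> []" "successively E w" "set w \<subseteq> D" "hd w = a" "last w = y" by blast
    then show ?case using step by (intro exI[of _ "w @ [z]"]) (auto simp: successively_append_iff)
  qed
qed

text \<open>Take a walk in \<open>D\<close> that is shortest among all walks from a
  \<open>P\<close>-vertex to a \<open>Q\<close>-vertex, not just among those between
  \<open>a\<close> and \<open>b\<close>: a chord or a repetition would shorten it, and so would a
  later \<open>P\<close>-vertex or an earlier \<open>Q\<close>-vertex.\<close>

lemma conn_path:
  assumes "conn D" "a \<in> D" "P a" "b \<in> D" "Q b"
  obtains p where "p \<noteq> []" "ipath p" "set p \<subseteq> D" "P (hd p)" "Q (last p)"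
    "\<And>u. u \<in> set p \<Longrightarrow> P u \<Longrightarrow> u = hd p" "\<And>u. u \<in> set p \<Longrightarrow> Q u \<Longrightarrow> u = last p"
proof -
  let ?G = "\<lambda>w. w \<noteq> [] \<and> successively E w \<and> set w \<subseteq> D \<and> P (hd w) \<and> Q (last w)"
  have "\<exists>w. ?G w" using conn_walk[OF assms(1,2,4)] assms by blast
  then obtain w where w: "?G w" and min: "\<And>w'. ?G w' \<Longrightarrow> length w \<le> length w'"
    using ex_has_least_nat[of ?G _ length] by blast
  have "ipath w"
  proof (rule ccontr)
    assume "\<not> ipath w"
    then obtain \<alpha> u \<beta> v \<gamma> where d: "w = \<alpha> @ u # \<beta> @ v # \<gamma>" "u = v \<or> (\<beta> \<noteq> [] \<and> E u v)"
      using not_ipath_chord w by blast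
    show False
    proof (cases "u = v")
      case True
      have "?G (\<alpha> @ v # \<gamma>)" using w d True by (auto simp: successively_append_iff hd_append successively_Cons split: if_splits)
      from min[OF this] d show False by simp
    next
      case False
      have "?G (\<alpha> @ u # v # \<gamma>)" using w d False by (auto simp: successively_append_iff hd_append successively_Cons split: if_splits)
      from min[OF this] d False show False by (cases \<beta>) auto
    qed
  qed
  moreover have "u = hd w" if u: "u \<in> set w" "P u" for u
  proof -
    obtain \<alpha> \<beta> where d: "w = \<alpha> @ u # \<beta>" using u by (meson split_list)
    have "?G (u # \<beta>)" using w d u by (auto simp: successively_append_iff)
    from min[OF this] d show ?thesis by (cases \<alpha>) auto
  qed
  moreover have "u = last w" if u: "u \<in> set w" "Q u" for u
  proof -
    obtain \<alpha> \<beta> where d: "w = \<alpha> @ u # \<beta>" using u by (meson split_list)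
    have "?G (\<alpha> @ [u])" using w d u by (auto simp: successively_append_iff hd_append split: if_splits)
    from min[OF this] d show ?thesis by (cases \<beta>) auto
  qed
  ultimately show ?thesis using that w by blast
qed

text \<open>A largest connected proper subset of \<open>D\<close> containing \<open>P\<close> misses
  a single vertex: some missing vertex is adjacent to it, and adding that one keeps it connected.
  This supplies non-cut vertices away from a prescribed part.\<close>

lemma conn_remove_outside:
  assumes "finite D" "conn D" "conn P" "P \<subset> D"
  shows "\<exists>d\<in>D - P. conn (D - {d})"
proof -
  let ?G = "\<lambda>M. conn M \<and> P \<subseteq> M \<and> M \<subset> D"
  have "\<exists>M. ?G M \<and> (\<forall>M'. ?G M' \<longrightarrow> card M' \<le> card M)"
    using ex_has_greatest_nat[of ?G P card "card D"] assms psubset_card_mono by blast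
  then obtain M where M: "?G M" and max: "\<And>M'. ?G M' \<Longrightarrow> card M' \<le> card M" by blast
  obtain a b where ab: "a \<in> M" "b \<in> D - M" using M by (auto simp: conn_def)
  have "(\<lambda>u v. u \<in> D \<and> v \<in> D \<and> E u v)\<^sup>*\<^sup>* a b" using assms(2) ab M by (auto simp: conn_def)
  then have "b \<in> M \<or> (\<exists>u\<in>M. \<exists>d\<in>D - M. E u d)"
    by (induction rule: rtranclp_induct) (use ab in auto)
  then obtain u d where ud: "u \<in> M" "d \<in> D - M" "E u d" using ab by auto
  have c: "conn (insert d M)" using ud M by (auto intro!: conn_insert simp: touches_def)
  have "finite M" using M assms(1) finite_subset by blast
  then have "insert d M = D" using max[of "insert d M"] c M ud by auto
  then have "D - {d} = M" using ud by auto
  then show ?thesis using M ud by auto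
qed

end

section \<open>Subdivisions from path systems\<close>

fun walk_arcs :: "'a list \<Rightarrow> ('a \<times> 'a) set" where
  "walk_arcs (a # b # w) = {(a, b), (b, a)} \<union> walk_arcs (b # w)"
| "walk_arcs _ = {}"

definition walks_graph :: "'a list set \<Rightarrow> 'a pair_pre_digraph" where
  "walks_graph W = \<lparr>pverts = \<Union> (set ` W), parcs = \<Union> (walk_arcs ` W)\<rparr>"

text \<open>The condition on the pairs of ends keeps two paths from collapsing to the same edge when
  each path is shortened to a single edge.\<close>

definition path_system :: "'a list set \<Rightarrow> bool" where
  "path_system W \<longleftrightarrow> finite W \<and> (\<forall>w\<in>W. 2 \<le> length w \<and> distinct w)
     \<and> (\<forall>w\<in>W. \<forall>w'\<in>W. w \<noteq> w' \<longrightarrow>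
          set (butlast (tl w)) \<inter> set w' = {} \<and> {hd w, last w} \<noteq> {hd w', last w'})"

lemma walk_arcs_verts: "(u, v) \<in> walk_arcs w \<Longrightarrow> u \<in> set w \<and> v \<in> set w"
  by (induction w rule: walk_arcs.induct) auto

lemma walk_arcs_sym: "(u, v) \<in> walk_arcs w \<Longrightarrow> (v, u) \<in> walk_arcs w"
  by (induction w rule: walk_arcs.induct) auto

lemma walk_arcs_irrefl: "distinct w \<Longrightarrow> (u, u) \<notin> walk_arcs w"
  by (induction w rule: walk_arcs.induct) auto

lemma path_system_length: "path_system W \<Longrightarrow> w \<in> W \<Longrightarrow> 2 \<le> length w"
  by (simp add: path_system_def)

lemma path_systemD:
  "path_system W \<Longrightarrow> w \<in> W \<Longrightarrow> w' \<in> W \<Longrightarrow> w \<noteq> w' \<Longrightarrow>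
     set (butlast (tl w)) \<inter> set w' = {} \<and> {hd w, last w} \<noteq> {hd w', last w'}"
  unfolding path_system_def by blast

lemma pair_bidirected_walks_graph:
  assumes "path_system W" shows "pair_bidirected_digraph (walks_graph W)"
proof
  fix e assume e: "e \<in> parcs (walks_graph W)"
  show "fst e \<in> pverts (walks_graph W)" "snd e \<in> pverts (walks_graph W)"
    using e walk_arcs_verts by (cases e; fastforce simp: walks_graph_def)+
  show "fst e \<noteq> snd e"
    using e assms by (cases e) (auto simp: walks_graph_def path_system_def walk_arcs_irrefl)
next
  show "symmetric (with_proj (walks_graph W))"
    using walk_arcs_sym by (fastforce simp: symmetric_def walks_graph_def intro!: symI)
qed

lemma walk_middle: "set w = {hd w, last w} \<union> set (butlast (tl w))" if "w \<noteq> []"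
  using that by (cases w; cases "tl w" rule: rev_cases) auto

text \<open>One subdivision step read backwards: \<open>r\<close> is an inner vertex of its path, so
  no other path contains it, and the edge \<open>u s\<close> replaces the two edges at
  \<open>r\<close>.\<close>

lemma path_system_shorten:
  assumes W: "path_system (insert (u # r # s # w) W)" and new: "u # r # s # w \<notin> W"
  shows "path_system (insert (u # s # w) W)" "u # s # w \<notin> W"
    and "walks_graph (insert (u # r # s # w) W) = subdivide (walks_graph (insert (u # s # w) W)) (u, s) r"
    and "(u, s) \<in> parcs (walks_graph (insert (u # s # w) W))"
    and "r \<notin> pverts (walks_graph (insert (u # s # w) W))"
proof -
  let ?w = "u # r # s # w"
  have d: "distinct ?w" using W by (auto simp: path_system_def)
  have inner: "r \<notin> set w'" "set (butlast (s # w)) \<inter> set w' = {}" "set (butlast (tl w')) \<inter> set ?w = {}"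
    "{u, last (s # w)} \<noteq> {hd w', last w'}" "2 \<le> length w'" "distinct w'" if "w' \<in> W" for w'
  proof -
    have "?w \<noteq> w'" using that new by auto
    then have "set (butlast (tl ?w)) \<inter> set w' = {}" "set (butlast (tl w')) \<inter> set ?w = {}"
      "{hd ?w, last ?w} \<noteq> {hd w', last w'}"
      using path_systemD[OF W, of ?w w'] path_systemD[OF W, of w' ?w] that by blast+
    then show "r \<notin> set w'" "set (butlast (s # w)) \<inter> set w' = {}" "set (butlast (tl w')) \<inter> set ?w = {}"
      "{u, last (s # w)} \<noteq> {hd w', last w'}" by auto
    show "2 \<le> length w'" "distinct w'" using W that by (auto simp: path_system_def)
  qed
  show notin: "u # s # w \<notin> W" using inner(4)[of "u # s # w"] by auto
  have pairs: "w' \<noteq> w'' \<Longrightarrow> set (butlast (tl w')) \<inter> set w'' = {} \<and> {hd w', last w'} \<noteq> {hd w'', last w''}"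
    if "w' \<in> W" "w'' \<in> W" for w' w'' using path_systemD[OF W, of w' w''] that by blast
  have W': "finite W" using W by (simp add: path_system_def)
  have A: "set (butlast (tl (u # s # w))) \<inter> set w' = {} \<and> set (butlast (tl w')) \<inter> set (u # s # w) = {}
      \<and> {u, last (s # w)} \<noteq> {hd w', last w'}" if "w' \<in> W" for w'
    using inner[OF that] by auto
  show "path_system (insert (u # s # w) W)"
    unfolding path_system_def
  proof (intro conjI ballI impI)
    fix w' w'' assume *: "w' \<in> insert (u # s # w) W" "w'' \<in> insert (u # s # w) W" "w' \<noteq> w''"
    show "set (butlast (tl w')) \<inter> set w'' = {}"
      using * A pairs by (metis insert_iff)
    show "{hd w', last w'} \<noteq> {hd w'', last w''}"
      using * A[of w'] A[of w''] pairs by (auto simp: doubleton_eq_iff)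
  next
    fix w' assume "w' \<in> insert (u # s # w) W"
    then show "2 \<le> length w'" "distinct w'" using inner(5,6) d by auto
  qed (use W' in simp)
  \<comment> \<open>Otherwise \<open>s\<close> lies on \<open>w'\<close> and is no inner vertex of
    the long path, so \<open>w = []\<close>; then \<open>u\<close> and \<open>s\<close> are the ends
    of both paths, which a path system forbids.\<close>
  have us: "(u, s) \<notin> walk_arcs w'" if w': "w' \<in> W" for w'
  proof
    assume "(u, s) \<in> walk_arcs w'"
    then have mem: "u \<in> set w'" "s \<in> set w'" by (auto dest: walk_arcs_verts)
    have ne: "w' \<noteq> []" using mem by auto
    have "w = []" using inner(2)[OF w'] mem by (cases w) auto
    moreover have "u \<in> {hd w', last w'}" "s \<in> {hd w', last w'}"
      using mem inner(3)[OF w'] walk_middle[OF ne] by auto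
    moreover have "u \<noteq> s" using d by auto
    ultimately show False using inner(4)[OF w'] by auto
  qed
  have us': "(s, u) \<notin> walk_arcs w'" if "w' \<in> W" for w' using us[OF that] walk_arcs_sym[of s u w'] by blast
  have us2: "(u, s) \<notin> walk_arcs (s # w)" "(s, u) \<notin> walk_arcs (s # w)"
    using d walk_arcs_verts[of u s "s # w"] walk_arcs_verts[of s u "s # w"] by auto
  show "walks_graph (insert ?w W) = subdivide (walks_graph (insert (u # s # w) W)) (u, s) r"
    using us us' us2 by (auto simp: walks_graph_def subdivide.simps)
  show "(u, s) \<in> parcs (walks_graph (insert (u # s # w) W))" by (simp add: walks_graph_def)
  show "r \<notin> pverts (walks_graph (insert (u # s # w) W))" using d inner(1) by (auto simp: walks_graph_def)
qed

text \<open>Inner vertices are removed one at a time, by induction on the total length; when every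
  path is a single edge, the two graphs coincide.\<close>

lemma subdivision_path_system:
  assumes "path_system W"
  shows "subdivision_pair (walks_graph ((\<lambda>w. [hd w, last w]) ` W)) (walks_graph W)"
  using assms
proof (induction "\<Sum>w\<in>W. length w" arbitrary: W rule: less_induct)
  case less
  show ?case
  proof (cases "\<forall>w\<in>W. length w = 2")
    case True
    then have "[hd w, last w] = w" if "w \<in> W" for w
      using that by (cases w; cases "tl w") auto
    then have "(\<lambda>w. [hd w, last w]) ` W = W" by (auto simp: image_iff)
    then show ?thesis using pair_bidirected_walks_graph[OF less.prems] by (simp add: subdivision_pair_base)
  next
    case False
    then obtain w0 where w0: "w0 \<in> W" "length w0 \<noteq> 2" by auto
    moreover have "2 \<le> length w0" using w0 less.prems by (auto simp: path_system_def)
    ultimately obtain u r s w where w: "w0 = u # r # s # w"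
      by (cases w0; cases "tl w0"; cases "tl (tl w0)") auto
    define W' where "W' = W - {w0}"
    have W: "W = insert (u # r # s # w) W'" "u # r # s # w \<notin> W'" using w0 w by (auto simp: W'_def)
    note sh = path_system_shorten[OF less.prems[unfolded W(1)] W(2)]
    have fin: "finite W'" using less.prems W(1) by (auto simp: path_system_def)
    have "(\<Sum>w\<in>insert (u # s # w) W'. length w) < (\<Sum>w\<in>W. length w)"
      using fin sh(2) W by simp
    from less.hyps[OF this sh(1)]
    have "subdivision_pair (walks_graph ((\<lambda>w. [hd w, last w]) ` W)) (walks_graph (insert (u # s # w) W'))"
      by (simp add: W(1))
    from subdivision_pair_divide[OF sh(4,5) this] sh(3) W(1) show ?thesis by simp
  qed
qed

lemma K4_subdivision_walks:
  assumes ps: "path_system {wa, wb, wc, w1, w2, w3}"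
    and ends: "hd wa = x" "last wa = a" "hd wb = x" "last wb = b" "hd wc = x" "last wc = c"
      "hd w1 = a" "last w1 = b" "hd w2 = b" "last w2 = c" "hd w3 = c" "last w3 = a"
    and d: "distinct [x, a, b, c]"
  shows "K4_subdivision (walks_graph {wa, wb, wc, w1, w2, w3})"
proof -
  let ?K = "walks_graph {[x,a],[x,b],[x,c],[a,b],[b,c],[c,a]}"
  have pv: "pverts ?K = {x, a, b, c}" by (auto simp: walks_graph_def)
  have pa: "parcs ?K = {(x,a),(a,x),(x,b),(b,x),(x,c),(c,x),(a,b),(b,a),(b,c),(c,b),(c,a),(a,c)}"
    by (simp add: walks_graph_def insert_commute)
  have "complete_digraph 4 (with_proj ?K)"
    unfolding complete_digraph_pair_def pv pa using d by auto
  moreover have "(\<lambda>w. [hd w, last w]) ` {wa, wb, wc, w1, w2, w3} = {[x,a],[x,b],[x,c],[a,b],[b,c],[c,a]}"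
    using ends by simp
  with subdivision_path_system[OF ps]
  have "subdivision_pair ?K (walks_graph {wa, wb, wc, w1, w2, w3})" by (simp only:)
  ultimately show ?thesis unfolding K4_subdivision_def by (intro exI conjI)
qed

context sgraph
begin

lemma ihole_cross:
  assumes "ihole (p @ q)" "p \<noteq> []" "q \<noteq> []" "u \<in> set p" "v \<in> set q" "E u v"
  shows "(u = last p \<and> v = hd q) \<or> (u = hd p \<and> v = last q)"
  using assms(1,4-6) unfolding ihole_append[OF assms(2,3)] by blast

lemma ihole_ipath: "ihole (p @ q) \<Longrightarrow> p \<noteq> [] \<Longrightarrow> q \<noteq> [] \<Longrightarrow> ipath p \<and> ipath q"
  using ihole_append by blast

end

lemma (in sgraph) ipath_walk_arcs:
  "ipath w \<Longrightarrow> u \<in> set w \<Longrightarrow> v \<in> set w \<Longrightarrow> E u v \<longleftrightarrow> (u, v) \<in> walk_arcs w"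
proof (induction w rule: walk_arcs.induct)
  case (1 a b w)
  have "(a, z) \<notin> walk_arcs (b # w)" "(z, a) \<notin> walk_arcs (b # w)" for z
    using 1(2) walk_arcs_verts by fastforce+
  then show ?case using 1 irrefl by (auto simp: sym_iff)
qed (auto simp: irrefl)

section \<open>The forbidden claw: three links from a vertex to a hole\<close>

locale ISK4_triangle_free =
  fixes G :: "'a pair_pre_digraph"
  assumes pair_graph_G: "pair_graph G"
    and no_ISK4: "\<not> ISK4 H G"
    and no_triangle': "(u, v) \<in> parcs G \<Longrightarrow> (v, w) \<in> parcs G \<Longrightarrow> (u, w) \<notin> parcs G"
begin

abbreviation E :: "'a \<Rightarrow> 'a \<Rightarrow> bool" where "E u v \<equiv> (u, v) \<in> parcs G"

sublocale pair_graph G by (rule pair_graph_G)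

sublocale sgraph E
  by unfold_locales (auto intro: arcs_symmetric dest: pair_no_loops)

abbreviation V :: "'a set" where "V \<equiv> pverts G"

lemma finV: "finite V" by (rule pair_finite_verts)

lemma no_triangle: "E u v \<Longrightarrow> E v w \<Longrightarrow> E u w \<Longrightarrow> False"
  using no_triangle' by blast

lemma E_V: "E u v \<Longrightarrow> u \<in> V" "E u v \<Longrightarrow> v \<in> V" by (auto dest: wellformed')

lemma induced_on:
  assumes "X \<subseteq> V"
  shows "induced_subgraph (with_proj \<lparr>pverts = X, parcs = {(u, v). u \<in> X \<and> v \<in> X \<and> E u v}\<rparr>) (with_proj G)"
proof -
  have "wf_digraph (with_proj \<lparr>pverts = X, parcs = {(u, v). u \<in> X \<and> v \<in> X \<and> E u v}\<rparr>)"
    unfolding wf_digraph_wp_iff by unfold_locales auto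
  moreover have "wf_digraph (with_proj G)" unfolding wf_digraph_wp_iff by (rule pair_wf_digraph)
  ultimately show ?thesis
    unfolding induced_subgraph_def subgraph_def using assms by (auto simp: compatible_def)
qed

text \<open>The three arcs of the hole between \<open>a\<close>, \<open>b\<close>, \<open>c\<close>
  and the three legs from \<open>x\<close> form a path system with branch vertices \<open>x\<close>,
  \<open>a\<close>, \<open>b\<close>, \<open>c\<close>. The hypotheses exclude all further edges, so
  this subdivision of K_4 is induced.\<close>

lemma no_claw_list:
  assumes C: "ihole (a # A @ b # B @ c # D)" and x: "x \<notin> set (a # A @ b # B @ c # D)"
    and ip: "ipath (x # Ra @ [a])" "ipath (x # Rb @ [b])" "ipath (x # Rc @ [c])"
    and dis: "(set Ra \<union> set Rb \<union> set Rc) \<inter> set (a # A @ b # B @ c # D) = {}"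
      "set Ra \<inter> set Rb = {}" "set Ra \<inter> set Rc = {}" "set Rb \<inter> set Rc = {}"
    and nR: "\<And>u v. u \<in> set Ra \<Longrightarrow> v \<in> set Rb \<union> set Rc \<Longrightarrow> \<not> E u v" "\<And>u v. u \<in> set Rb \<Longrightarrow> v \<in> set Rc \<Longrightarrow> \<not> E u v"
    and nC: "\<And>u v. u \<in> set Ra \<Longrightarrow> v \<in> set (a # A @ b # B @ c # D) \<Longrightarrow> E u v \<Longrightarrow> v = a"
      "\<And>u v. u \<in> set Rb \<Longrightarrow> v \<in> set (a # A @ b # B @ c # D) \<Longrightarrow> E u v \<Longrightarrow> v = b"
      "\<And>u v. u \<in> set Rc \<Longrightarrow> v \<in> set (a # A @ b # B @ c # D) \<Longrightarrow> E u v \<Longrightarrow> v = c"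
    and nx: "\<And>v. v \<in> set (A @ B @ D) \<Longrightarrow> \<not> E x v"
  shows False
proof -
  let ?C = "set (a # A @ b # B @ c # D)"
  let ?W = "{x # Ra @ [a], x # Rb @ [b], x # Rc @ [c], a # A @ [b], b # B @ [c], c # D @ [a]}"
  have dC: "distinct (a # A @ b # B @ c # D)" using ihole_distinct[OF C] .
  have h1: "ihole ((a # A @ [b]) @ (B @ c # D))" "ihole ((b # B @ [c]) @ (D @ a # A))" "ihole ((c # D @ [a]) @ (A @ b # B))"
    using C ihole_rotate[of "a # A" "b # B @ c # D"] ihole_rotate[of "a # A @ b # B" "c # D"] by auto
  have ipC: "ipath (a # A @ [b])" "ipath (b # B @ [c])" "ipath (c # D @ [a])"
    using ihole_ipath[OF h1(1)] ihole_ipath[OF h1(2)] ihole_ipath[OF h1(3)] by simp_all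
  \<comment> \<open>An edge of the hole stays within one arc: when the hole is cut at the ends of an
    arc, \<open>ihole_cross\<close> allows only the two cut edges, and these belong to the
    neighbouring arcs.\<close>
  have inC: "(u \<in> set (a # A @ [b]) \<and> v \<in> set (a # A @ [b])) \<or> (u \<in> set (b # B @ [c]) \<and> v \<in> set (b # B @ [c]))
     \<or> (u \<in> set (c # D @ [a]) \<and> v \<in> set (c # D @ [a]))" if uv: "u \<in> ?C" "v \<in> ?C" "E u v" for u v
  proof -
    have X1: "E u v \<Longrightarrow> (u = b \<and> v = hd (B @ [c])) \<or> (u = a \<and> v = last (c # D))"
      if "u \<in> set (a # A @ [b])" "v \<in> set (B @ c # D)" for u v
      using ihole_cross[OF h1(1) _ _ that] by (auto simp: hd_append split: if_splits)
    have X2: "E u v \<Longrightarrow> (u = c \<and> v = hd (D @ [a])) \<or> (u = b \<and> v = last (a # A))"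
      if "u \<in> set (b # B @ [c])" "v \<in> set (D @ a # A)" for u v
      using ihole_cross[OF h1(2) _ _ that] by (auto simp: hd_append split: if_splits)
    have H: "hd (B @ [c]) \<in> set (b # B @ [c])" "hd (D @ [a]) \<in> set (c # D @ [a])"
      "last (c # D) \<in> set (c # D @ [a])" "last (a # A) \<in> set (a # A @ [b])"
      by (auto simp: hd_append)
    have M: "a \<in> set (a # A @ [b])" "b \<in> set (a # A @ [b])" "b \<in> set (b # B @ [c])" "c \<in> set (b # B @ [c])"
      "c \<in> set (c # D @ [a])" "a \<in> set (c # D @ [a])" by auto
    have K: "(u \<in> set (a # A @ [b]) \<and> v \<in> set (a # A @ [b])) \<or> (u \<in> set (b # B @ [c]) \<and> v \<in> set (b # B @ [c]))
     \<or> (u \<in> set (c # D @ [a]) \<and> v \<in> set (c # D @ [a]))"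
      if "E u v" "(u \<in> set (a # A @ [b]) \<and> v \<in> set (B @ c # D)) \<or> (u \<in> set (b # B @ [c]) \<and> v \<in> set (D @ a # A))" for u v
      using that(2)
    proof (elim disjE conjE)
      assume "u \<in> set (a # A @ [b])" "v \<in> set (B @ c # D)"
      from X1[OF this that(1)] show ?thesis using H M by (elim disjE conjE) simp_all
    next
      assume "u \<in> set (b # B @ [c])" "v \<in> set (D @ a # A)"
      from X2[OF this that(1)] show ?thesis using H M by (elim disjE conjE) simp_all
    qed
    show ?thesis
    proof (rule ccontr)
      assume neg: "\<not> ?thesis"
      have "(u \<in> set (a # A @ [b]) \<and> v \<in> set (B @ c # D)) \<or> (u \<in> set (b # B @ [c]) \<and> v \<in> set (D @ a # A))
        \<or> (v \<in> set (a # A @ [b]) \<and> u \<in> set (B @ c # D)) \<or> (v \<in> set (b # B @ [c]) \<and> u \<in> set (D @ a # A))"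
        using neg uv(1,2) by auto
      then show False using K[OF uv(3)] K[OF sym[OF uv(3)]] neg by blast
    qed
  qed
  let ?X = "\<Union> (set ` ?W)"
  let ?H = "\<lparr>pverts = ?X, parcs = {(u, v). u \<in> ?X \<and> v \<in> ?X \<and> E u v}\<rparr>"
  have ipW: "ipath w" if "w \<in> ?W" for w using that ip ipC by blast
  \<comment> \<open>As each of the six paths is induced, an edge with both ends on one of them is an
    edge of that path. So this claim makes the induced subgraph equal to the union of the
    paths.\<close>
  have common: "\<exists>w\<in>?W. u \<in> set w \<and> v \<in> set w" if uv: "u \<in> ?X" "v \<in> ?X" "E u v" for u v
  proof -
    have K: "\<exists>w\<in>?W. u \<in> set w \<and> v \<in> set w"
      if "(u \<in> ?C \<and> v \<in> ?C) \<or> (u = x \<and> v \<in> ?C) \<or> (u \<in> set Ra \<union> set Rb \<union> set Rc \<and> v \<in> ?C)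
        \<or> (u = x \<and> v \<in> set Ra \<union> set Rb \<union> set Rc) \<or> (u \<in> set Ra \<union> set Rb \<union> set Rc \<and> v \<in> set Ra \<union> set Rb \<union> set Rc)" "E u v" for u v
    proof -
      consider (1) "u \<in> ?C" "v \<in> ?C" | (2) "u = x" "v \<in> ?C" | (3) "u \<in> set Ra" "v \<in> ?C" | (4) "u \<in> set Rb" "v \<in> ?C" | (5) "u \<in> set Rc" "v \<in> ?C"
        | (6) "u = x" "v \<in> set Ra \<union> set Rb \<union> set Rc" | (7) "u \<in> set Ra \<union> set Rb \<union> set Rc" "v \<in> set Ra \<union> set Rb \<union> set Rc" using \<open>_ \<or> _\<close> by blast
      then show ?thesis
      proof cases
        case 1 from inC[OF 1 \<open>E u v\<close>] show ?thesis by auto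
      next
        case 2 then have "v \<in> {a, b, c}" using nx \<open>E u v\<close> by auto
        then show ?thesis using 2 by auto
      next
        case 3 then show ?thesis using nC(1) \<open>E u v\<close> by auto
      next
        case 4 then show ?thesis using nC(2) \<open>E u v\<close> by auto
      next
        case 5 then show ?thesis using nC(3) \<open>E u v\<close> by auto
      next
        case 6 then show ?thesis by auto
      next
        case 7
        then have "(u \<in> set Ra \<and> v \<in> set Ra) \<or> (u \<in> set Rb \<and> v \<in> set Rb) \<or> (u \<in> set Rc \<and> v \<in> set Rc)"
          using nR \<open>E u v\<close> sym[OF \<open>E u v\<close>] by blast
        then show ?thesis by auto
      qed
    qed
    have X: "?X = ?C \<union> {x} \<union> (set Ra \<union> set Rb \<union> set Rc)" by auto
    have "\<not> E x x" by (rule irrefl)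
    then show ?thesis using K[of u v] K[of v u] uv sym[OF uv(3)] unfolding X by blast
  qed
  have HW: "?H = walks_graph ?W"
  proof -
    have "{(u, v). u \<in> ?X \<and> v \<in> ?X \<and> E u v} = \<Union> (walk_arcs ` ?W)"
    proof (intro equalityI subrelI)
      fix u v assume "(u, v) \<in> {(u, v). u \<in> ?X \<and> v \<in> ?X \<and> E u v}"
      then have "u \<in> ?X" "v \<in> ?X" "E u v" by blast+
      then obtain w where "w \<in> ?W" "u \<in> set w" "v \<in> set w" using common by blast
      then show "(u, v) \<in> \<Union> (walk_arcs ` ?W)" using ipath_walk_arcs[of w u v] ipW \<open>E u v\<close> by blast
    next
      fix u v assume "(u, v) \<in> \<Union> (walk_arcs ` ?W)"
      then obtain w where w: "w \<in> ?W" "(u, v) \<in> walk_arcs w" by blast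
      then have "u \<in> set w" "v \<in> set w" using walk_arcs_verts by fast+
      then have "u \<in> ?X" "v \<in> ?X" "E u v" using ipath_walk_arcs[of w u v] ipW w by blast+
      then show "(u, v) \<in> {(u, v). u \<in> ?X \<and> v \<in> ?X \<and> E u v}" by blast
    qed
    then show ?thesis by (simp add: walks_graph_def)
  qed
  have ps: "path_system ?W"
    unfolding path_system_def
  proof (intro conjI)
    show "\<forall>w\<in>?W. 2 \<le> length w \<and> distinct w" using ipath_distinct[OF ipW] by auto
    have dip: "distinct (x # Ra @ [a])" "distinct (x # Rb @ [b])" "distinct (x # Rc @ [c])" using ip ipath_distinct by blast+
    have disC: "u \<notin> ?C" if "u \<in> set Ra \<or> u \<in> set Rb \<or> u \<in> set Rc" for u using dis(1) that by blast
    have disR: "u \<in> set Ra \<Longrightarrow> u \<notin> set Rb \<and> u \<notin> set Rc" "u \<in> set Rb \<Longrightarrow> u \<notin> set Rc" for u using dis(2-4) by blast+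
    have disA: "u \<in> set A \<Longrightarrow> u \<notin> set B \<and> u \<notin> set D \<and> u \<noteq> a \<and> u \<noteq> b \<and> u \<noteq> c" "u \<in> set B \<Longrightarrow> u \<notin> set D \<and> u \<noteq> a \<and> u \<noteq> b \<and> u \<noteq> c"
      "u \<in> set D \<Longrightarrow> u \<noteq> a \<and> u \<noteq> b \<and> u \<noteq> c" for u using dC by auto
    have Ra_out: "u \<noteq> x \<and> u \<noteq> a \<and> u \<noteq> b \<and> u \<noteq> c \<and> u \<notin> set Rb \<and> u \<notin> set Rc \<and> u \<notin> set A \<and> u \<notin> set B \<and> u \<notin> set D" if "u \<in> set Ra" for u
      using that disC[of u] disR[of u] disA[of u] x dip by auto
    have Rb_out: "u \<noteq> x \<and> u \<noteq> a \<and> u \<noteq> b \<and> u \<noteq> c \<and> u \<notin> set Ra \<and> u \<notin> set Rc \<and> u \<notin> set A \<and> u \<notin> set B \<and> u \<notin> set D" if "u \<in> set Rb" for u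
      using that disC[of u] disR[of u] disA[of u] x dip by auto
    have Rc_out: "u \<noteq> x \<and> u \<noteq> a \<and> u \<noteq> b \<and> u \<noteq> c \<and> u \<notin> set Ra \<and> u \<notin> set Rb \<and> u \<notin> set A \<and> u \<notin> set B \<and> u \<notin> set D" if "u \<in> set Rc" for u
      using that disC[of u] disR[of u] disA[of u] x dip by auto
    have A_out: "u \<noteq> x \<and> u \<noteq> a \<and> u \<noteq> b \<and> u \<noteq> c \<and> u \<notin> set Ra \<and> u \<notin> set Rb \<and> u \<notin> set Rc \<and> u \<notin> set B \<and> u \<notin> set D" if "u \<in> set A" for u
      using that disC[of u] disR[of u] disA[of u] x dip by auto
    have B_out: "u \<noteq> x \<and> u \<noteq> a \<and> u \<noteq> b \<and> u \<noteq> c \<and> u \<notin> set Ra \<and> u \<notin> set Rb \<and> u \<notin> set Rc \<and> u \<notin> set A \<and> u \<notin> set D" if "u \<in> set B" for u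
      using that disC[of u] disR[of u] disA[of u] x dip by auto
    have D_out: "u \<noteq> x \<and> u \<noteq> a \<and> u \<noteq> b \<and> u \<noteq> c \<and> u \<notin> set Ra \<and> u \<notin> set Rb \<and> u \<notin> set Rc \<and> u \<notin> set A \<and> u \<notin> set B" if "u \<in> set D" for u
      using that disC[of u] disR[of u] disA[of u] x dip by auto
    have ne: "x \<noteq> a" "x \<noteq> b" "x \<noteq> c" "a \<noteq> b" "a \<noteq> c" "b \<noteq> c" using dC x by auto
    have inner: "set (butlast (tl w)) \<inter> set w' = {}" if "w \<in> ?W" "w' \<in> ?W" "w \<noteq> w'" for w w'
      using that(1)
    proof (elim insertE emptyE)
      assume w: "w = x # Ra @ [a]"
      have "set w' \<subseteq> {x, a, b, c} \<union> set Rb \<union> set Rc \<union> set A \<union> set B \<union> set D" using that(2,3) unfolding w by (elim insertE emptyE) auto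
      moreover have "set Ra \<inter> ({x, a, b, c} \<union> set Rb \<union> set Rc \<union> set A \<union> set B \<union> set D) = {}" using Ra_out by fast
      ultimately show ?thesis unfolding w by (simp add: butlast_append) blast
    next
      assume w: "w = x # Rb @ [b]"
      have "set w' \<subseteq> {x, a, b, c} \<union> set Ra \<union> set Rc \<union> set A \<union> set B \<union> set D" using that(2,3) unfolding w by (elim insertE emptyE) auto
      moreover have "set Rb \<inter> ({x, a, b, c} \<union> set Ra \<union> set Rc \<union> set A \<union> set B \<union> set D) = {}" using Rb_out by fast
      ultimately show ?thesis unfolding w by (simp add: butlast_append) blast
    next
      assume w: "w = x # Rc @ [c]"
      have "set w' \<subseteq> {x, a, b, c} \<union> set Ra \<union> set Rb \<union> set A \<union> set B \<union> set D" using that(2,3) unfolding w by (elim insertE emptyE) auto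
      moreover have "set Rc \<inter> ({x, a, b, c} \<union> set Ra \<union> set Rb \<union> set A \<union> set B \<union> set D) = {}" using Rc_out by fast
      ultimately show ?thesis unfolding w by (simp add: butlast_append) blast
    next
      assume w: "w = a # A @ [b]"
      have "set w' \<subseteq> {x, a, b, c} \<union> set Ra \<union> set Rb \<union> set Rc \<union> set B \<union> set D" using that(2,3) unfolding w by (elim insertE emptyE) auto
      moreover have "set A \<inter> ({x, a, b, c} \<union> set Ra \<union> set Rb \<union> set Rc \<union> set B \<union> set D) = {}" using A_out by fast
      ultimately show ?thesis unfolding w by (simp add: butlast_append) blast
    next
      assume w: "w = b # B @ [c]"
      have "set w' \<subseteq> {x, a, b, c} \<union> set Ra \<union> set Rb \<union> set Rc \<union> set A \<union> set D" using that(2,3) unfolding w by (elim insertE emptyE) auto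
      moreover have "set B \<inter> ({x, a, b, c} \<union> set Ra \<union> set Rb \<union> set Rc \<union> set A \<union> set D) = {}" using B_out by fast
      ultimately show ?thesis unfolding w by (simp add: butlast_append) blast
    next
      assume w: "w = c # D @ [a]"
      have "set w' \<subseteq> {x, a, b, c} \<union> set Ra \<union> set Rb \<union> set Rc \<union> set A \<union> set B" using that(2,3) unfolding w by (elim insertE emptyE) auto
      moreover have "set D \<inter> ({x, a, b, c} \<union> set Ra \<union> set Rb \<union> set Rc \<union> set A \<union> set B) = {}" using D_out by fast
      ultimately show ?thesis unfolding w by (simp add: butlast_append) blast
    qed
    have ends: "{hd w, last w} \<noteq> {hd w', last w'}" if "w \<in> ?W" "w' \<in> ?W" "w \<noteq> w'" for w w'
      using that(1)
    proof (elim insertE emptyE)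
      assume w: "w = x # Ra @ [a]"
      show ?thesis using that(2,3) ne unfolding w by (elim insertE emptyE) (simp_all add: doubleton_eq_iff)
    next
      assume w: "w = x # Rb @ [b]"
      show ?thesis using that(2,3) ne unfolding w by (elim insertE emptyE) (simp_all add: doubleton_eq_iff)
    next
      assume w: "w = x # Rc @ [c]"
      show ?thesis using that(2,3) ne unfolding w by (elim insertE emptyE) (simp_all add: doubleton_eq_iff)
    next
      assume w: "w = a # A @ [b]"
      show ?thesis using that(2,3) ne unfolding w by (elim insertE emptyE) (simp_all add: doubleton_eq_iff)
    next
      assume w: "w = b # B @ [c]"
      show ?thesis using that(2,3) ne unfolding w by (elim insertE emptyE) (simp_all add: doubleton_eq_iff)
    next
      assume w: "w = c # D @ [a]"
      show ?thesis using that(2,3) ne unfolding w by (elim insertE emptyE) (simp_all add: doubleton_eq_iff)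
    qed
    show "\<forall>w\<in>?W. \<forall>w'\<in>?W. w \<noteq> w' \<longrightarrow>
          set (butlast (tl w)) \<inter> set w' = {} \<and> {hd w, last w} \<noteq> {hd w', last w'}"
      by (intro ballI impI conjI; (rule inner | rule ends); assumption)
  qed simp
  have "K4_subdivision ?H" unfolding HW
    by (rule K4_subdivision_walks[OF ps, where x = x and a = a and b = b and c = c]) (use dC x in simp_all)
  moreover have "induced_subgraph (with_proj ?H) (with_proj G)"
  proof -
    have XV: "?X \<subseteq> V"
    proof
      fix u assume "u \<in> ?X"
      then obtain w where w: "w \<in> ?W" "u \<in> set w" by blast
      have "ipath w" using ipW[OF w(1)] .
      have "2 \<le> length w" by (rule path_system_length[OF ps w(1)])
      have "\<exists>v. E u v"
      proof -
        obtain \<alpha> \<beta> where s: "w = \<alpha> @ u # \<beta>" using w by (meson split_list)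
        show ?thesis
        proof (cases \<beta>)
          case (Cons v \<beta>') then show ?thesis using ipath_adj[of \<alpha> u v \<beta>'] s \<open>ipath w\<close> by auto
        next
          case Nil
          then have "\<alpha> \<noteq> []" using s \<open>2 \<le> length w\<close> by auto
          then obtain \<alpha>' v where "\<alpha> = \<alpha>' @ [v]" by (cases \<alpha> rule: rev_cases) auto
          then show ?thesis using ipath_adj[of \<alpha>' v u "[]"] s Nil \<open>ipath w\<close> sym by auto
        qed
      qed
      then show "u \<in> V" using E_V by blast
    qed
    then show ?thesis by (rule induced_on)
  qed
  ultimately have "ISK4 ?H G" unfolding ISK4_def by (intro conjI)
  then show False by (rule notE[OF no_ISK4])
qed

end

lemma distinct_last_notin: "distinct (p @ q) \<Longrightarrow> q \<noteq> [] \<Longrightarrow> last (p @ q) \<notin> set p"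
  using last_in_set by fastforce

lemma distinct_hd_notin: "distinct (p @ q) \<Longrightarrow> p \<noteq> [] \<Longrightarrow> hd (p @ q) \<notin> set q"
  using hd_in_set by fastforce

lemma distinct_split_unique:
  assumes "distinct (p @ a # q)" "p @ a # q = p' @ a # q'" shows "p = p'" "q = q'"
proof -
  have "a \<notin> set p" "a \<notin> set q" using assms(1) by auto
  then show "p = p'" "q = q'" using append_Cons_eq_iff[of a p q p' q'] assms(2) by blast+
qed

context ISK4_triangle_free
begin

lemma ipath_appendD: "ipath (p @ q) \<Longrightarrow> ipath p" "ipath (p @ q) \<Longrightarrow> ipath q"
  by (simp_all add: ipath_append)

lemma touches_sym: "touches D v \<longleftrightarrow> (\<exists>d\<in>D. E v d)"
  unfolding touches_def using sym_iff by simp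

text \<open>
  A link is a way to draw an induced path from \<open>x\<close> to \<open>c\<close> through \<open>D\<close> that meets the hole \<open>C\<close> only in \<open>c\<close>;
  \<open>D = {}\<close> stands for the edge itself.
\<close>

definition link :: "'a \<Rightarrow> 'a set \<Rightarrow> 'a set \<Rightarrow> 'a \<Rightarrow> bool" where
  "link x C D c \<longleftrightarrow> D = {} \<and> E x c \<or>
     conn D \<and> x \<notin> D \<and> D \<inter> C = {} \<and> touches D x \<and> (\<forall>v\<in>C. touches D v \<longleftrightarrow> v = c)"

text \<open>A shortest path in \<open>D\<close> from the neighbours of \<open>x\<close> to those of
  \<open>c\<close>. Assumption \<open>d\<close> excludes the edge \<open>x c\<close> as a
  chord.\<close>

lemma link_path:
  assumes l: "link x C D c" and c: "c \<in> C" and x: "x \<notin> C" and d: "E x c \<Longrightarrow> D = {}"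
  obtains R where "ipath (x # R @ [c])" "set R \<subseteq> D"
proof (cases "D = {}")
  case True
  then have "E x c" using l by (auto simp: link_def conn_def)
  then show ?thesis using that[of "[]"] c x by auto
next
  case False
  then have D: "conn D" "x \<notin> D" "D \<inter> C = {}" "touches D x" "\<forall>v\<in>C. touches D v \<longleftrightarrow> v = c"
    using l by (auto simp: link_def)
  obtain a where a: "a \<in> D" "E a x" using D(4) by (auto simp: touches_def)
  obtain b where b: "b \<in> D" "E b c" using D(5) c by (auto simp: touches_def)
  obtain p where p: "p \<noteq> []" "ipath p" "set p \<subseteq> D" "E (hd p) x" "E (last p) c"
    "\<And>u. u \<in> set p \<Longrightarrow> E u x \<Longrightarrow> u = hd p" "\<And>u. u \<in> set p \<Longrightarrow> E u c \<Longrightarrow> u = last p"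
    using conn_path[OF D(1) a(1), of "\<lambda>u. E u x" b "\<lambda>u. E u c"] a b by blast
  have "ipath (p @ [c])" using p D c by (auto simp: ipath_append)
  moreover have "\<not> E x c" using d False by blast
  moreover have "E x u \<longleftrightarrow> u = hd p" if "u \<in> set p" for u using p(1,4,6) that sym_iff[of x u] by auto
  ultimately have "ipath (x # p @ [c])" using p(1,3) D(2) c x by (auto simp: hd_append)
  then show ?thesis using that p by blast
qed

lemma link_disjoint: "link x C D c \<Longrightarrow> D \<inter> C = {} \<and> x \<notin> D"
  by (auto simp: link_def)

lemma link_touch: "link x C D c \<Longrightarrow> u \<in> D \<Longrightarrow> v \<in> C \<Longrightarrow> E u v \<Longrightarrow> v = c"
  by (auto simp: link_def touches_def)

text \<open>Links yield the legs of \<open>no_claw_list\<close>; rotating the hole to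
  \<open>a\<close> leaves two possible orders of \<open>b\<close> and \<open>c\<close>. By
  \<open>nx\<close>, the only edges from \<open>x\<close> to the hole are those serving as links
  themselves.\<close>

lemma no_claw:
  assumes C: "ihole C" "x \<notin> set C" and abc: "distinct [a, b, c]" "{a, b, c} \<subseteq> set C"
    and l: "link x (set C) Da a" "link x (set C) Db b" "link x (set C) Dc c"
    and dis: "Da \<inter> Db = {}" "Da \<inter> Dc = {}" "Db \<inter> Dc = {}"
    and anti: "\<And>u v. u \<in> Da \<Longrightarrow> v \<in> Db \<union> Dc \<Longrightarrow> \<not> E u v" "\<And>u v. u \<in> Db \<Longrightarrow> v \<in> Dc \<Longrightarrow> \<not> E u v"
    and nx: "\<And>v. v \<in> set C \<Longrightarrow> E x v \<Longrightarrow> (v = a \<and> Da = {}) \<or> (v = b \<and> Db = {}) \<or> (v = c \<and> Dc = {})"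
  shows False
proof -
  obtain Ra where Ra: "ipath (x # Ra @ [a])" "set Ra \<subseteq> Da" using link_path[OF l(1)] abc C nx by auto
  obtain Rb where Rb: "ipath (x # Rb @ [b])" "set Rb \<subseteq> Db" using link_path[OF l(2)] abc C nx by auto
  obtain Rc where Rc: "ipath (x # Rc @ [c])" "set Rc \<subseteq> Dc" using link_path[OF l(3)] abc C nx by auto
  note ld = link_disjoint[OF l(1)] link_disjoint[OF l(2)] link_disjoint[OF l(3)]
  note lt = link_touch[OF l(1)] link_touch[OF l(2)] link_touch[OF l(3)]
  obtain p where p: "ihole (a # p)" "set (a # p) = set C" using ihole_start[OF C(1), of a] abc by auto
  have bc: "b \<in> set p" "c \<in> set p" using abc p by auto
  then obtain A B' where A: "p = A @ b # B'" by (meson split_list)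
  have dp: "distinct (a # p)" using ihole_distinct p by blast
  show False
  proof (cases "c \<in> set B'")
    case True
    then obtain B D where B: "B' = B @ c # D" by (meson split_list)
    have eq: "a # p = a # A @ b # B @ c # D" using A B by simp
    show False
    proof (rule no_claw_list[of a A b B c D x Ra Rb Rc])
      show "ihole (a # A @ b # B @ c # D)" using p eq by simp
      show "x \<notin> set (a # A @ b # B @ c # D)" using p C unfolding eq by simp
      show "(set Ra \<union> set Rb \<union> set Rc) \<inter> set (a # A @ b # B @ c # D) = {}"
        unfolding eq[symmetric] p(2) using Ra Rb Rc ld by blast
      show "set Ra \<inter> set Rb = {}" "set Ra \<inter> set Rc = {}" "set Rb \<inter> set Rc = {}" using Ra Rb Rc dis by blast+
      show "\<And>u v. u \<in> set Ra \<Longrightarrow> v \<in> set Rb \<union> set Rc \<Longrightarrow> \<not> E u v" "\<And>u v. u \<in> set Rb \<Longrightarrow> v \<in> set Rc \<Longrightarrow> \<not> E u v"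
        using anti Ra Rb Rc by blast+
      show "\<And>v. v \<in> set (A @ B @ D) \<Longrightarrow> \<not> E x v"
      proof
        fix v assume v: "v \<in> set (A @ B @ D)" "E x v"
        have "v \<in> set C" unfolding p(2)[symmetric] eq using v by auto
        then have "v = a \<or> v = b \<or> v = c" using nx v by blast
        then show False using v dp unfolding eq by auto
      qed
    qed (use Ra Rb Rc in \<open>simp_all only: eq[symmetric] p(2); blast intro: lt\<close>)+
  next
    case False
    then have "c \<in> set A" using bc A abc by auto
    then obtain A' B where B: "A = A' @ c # B" by (meson split_list)
    have eq: "a # p = a # A' @ c # B @ b # B'" using A B by simp
    show False
    proof (rule no_claw_list[of a A' c B b B' x Ra Rc Rb])
      show "ihole (a # A' @ c # B @ b # B')" using p eq by simp
      show "x \<notin> set (a # A' @ c # B @ b # B')" using p C unfolding eq by simp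
      show "(set Ra \<union> set Rc \<union> set Rb) \<inter> set (a # A' @ c # B @ b # B') = {}"
        unfolding eq[symmetric] p(2) using Ra Rb Rc ld by blast
      show "set Ra \<inter> set Rc = {}" "set Ra \<inter> set Rb = {}" "set Rc \<inter> set Rb = {}" using Ra Rb Rc dis by blast+
      show "\<And>u v. u \<in> set Ra \<Longrightarrow> v \<in> set Rc \<union> set Rb \<Longrightarrow> \<not> E u v" "\<And>u v. u \<in> set Rc \<Longrightarrow> v \<in> set Rb \<Longrightarrow> \<not> E u v"
        using anti(1)[of u v for u v] anti(2)[of v u for u v] Ra Rb Rc sym_iff[of u v for u v] by (metis UnE UnI1 UnI2 subsetD)+
      show "\<And>v. v \<in> set (A' @ B @ B') \<Longrightarrow> \<not> E x v"
      proof
        fix v assume v: "v \<in> set (A' @ B @ B')" "E x v"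
        have "v \<in> set C" unfolding p(2)[symmetric] eq using v by auto
        then have "v = a \<or> v = b \<or> v = c" using nx v by blast
        then show False using v dp unfolding eq by auto
      qed
    qed (use Ra Rb Rc in \<open>simp_all only: eq[symmetric] p(2); blast intro: lt\<close>)+
  qed
qed

section \<open>Counting the neighbours of a vertex along a path or rim\<close>

definition cnt :: "'a \<Rightarrow> 'a list \<Rightarrow> nat" where
  "cnt x Q = length (filter (E x) Q)"

lemma cnt_simps [simp]:
  "cnt x [] = 0" "cnt x (p @ q) = cnt x p + cnt x q"
  "cnt x (a # p) = (if E x a then Suc (cnt x p) else cnt x p)"
  "cnt x (rev p) = cnt x p"
  by (simp_all add: cnt_def rev_filter[symmetric])

lemma cnt_0_iff: "cnt x p = 0 \<longleftrightarrow> (\<forall>v\<in>set p. \<not> E x v)"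
  by (auto simp: cnt_def filter_empty_conv)

lemma cnt_card: "distinct Q \<Longrightarrow> cnt x Q = card {v \<in> set Q. E x v}"
  unfolding cnt_def by (metis distinct_filter distinct_card set_filter)

lemma cnt_2E:
  assumes "cnt x Q = 2" "distinct Q"
  obtains a b where "a \<noteq> b" "a \<in> set Q" "b \<in> set Q" "\<And>v. v \<in> set Q \<Longrightarrow> E x v \<longleftrightarrow> v = a \<or> v = b"
proof -
  have "card {v \<in> set Q. E x v} = 2" using assms(1) cnt_card[OF assms(2), of x] by simp
  then obtain a b where "{v \<in> set Q. E x v} = {a, b}" "a \<noteq> b" by (meson card_2_iff)
  then show ?thesis using that[of a b] by blast
qed

text \<open>Three bare edges form a claw: the hole together with \<open>x\<close> would itself be an
  ISK4.\<close>

lemma no_three_spokes: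
  assumes "ihole C" "x \<notin> set C" "cnt x C = 3" shows False
proof -
  have "card {v \<in> set C. E x v} = 3" using assms(3) cnt_card[OF ihole_distinct[OF assms(1)], of x] by simp
  then obtain a b c where abc: "{v \<in> set C. E x v} = {a, b, c}" "a \<noteq> b" "a \<noteq> c" "b \<noteq> c" by (auto simp: card_3_iff)
  then have "a \<in> set C" "b \<in> set C" "c \<in> set C" "E x a" "E x b" "E x c" by blast+
  then show False using no_claw[OF assms(1,2), of a b c "{}" "{}" "{}"] abc by (auto simp: link_def)
qed

text \<open>The two spokes are bare edges and \<open>D\<close> is the third link. Contradictions
  below usually take this form, with a piece of the discarded rim as \<open>D\<close>.\<close>

lemma no_two_spokes_link:
  assumes C: "ihole C" "x \<notin> set C" "cnt x C = 2"
    and D: "conn D" "x \<notin> D" "D \<inter> set C = {}" "touches D x" "\<And>v. v \<in> set C \<Longrightarrow> touches D v \<longleftrightarrow> v = c"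
    and c: "c \<in> set C" "\<not> E x c"
  shows False
proof -
  obtain a b where ab: "a \<noteq> b" "a \<in> set C" "b \<in> set C" "\<And>v. v \<in> set C \<Longrightarrow> E x v \<longleftrightarrow> v = a \<or> v = b"
    using cnt_2E[OF C(3) ihole_distinct[OF C(1)]] by blast
  show False
  proof (rule no_claw[OF C(1,2), of a b c "{}" "{}" D])
    show "distinct [a, b, c]" "{a, b, c} \<subseteq> set C" using ab c by auto
    show "link x (set C) {} a" "link x (set C) {} b" using ab(2-4) by (auto simp: link_def)
    show "link x (set C) D c" unfolding link_def using D by blast
    show "(v = a \<and> {} = {}) \<or> (v = b \<and> {} = {}) \<or> (v = c \<and> D = {})" if "v \<in> set C" "E x v" for v
      using ab(4) that by auto
  qed auto
qed

text \<open>A shortest path through \<open>M\<close> between the neighbourhoods of the ends of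
  \<open>Q\<close>. If \<open>Q\<close> is one edge, this path has at least two vertices, as there
  is no triangle; so the cycle has length at least 4.\<close>

lemma ihole_close:
  assumes Q: "ipath Q" "2 \<le> length Q" and M: "conn M" "M \<inter> set Q = {}"
    and t: "\<And>v. v \<in> set Q \<Longrightarrow> touches M v \<longleftrightarrow> v = hd Q \<or> v = last Q"
  obtains P where "P \<noteq> []" "ipath P" "set P \<subseteq> M" "ihole (Q @ P)" "E (last Q) (hd P)" "E (hd Q) (last P)"
proof -
  have ne: "Q \<noteq> []" using Q by auto
  have hl: "hd Q \<noteq> last Q" using ipath_distinct[OF Q(1)] Q(2) by (cases Q) (auto split: if_splits)
  obtain a where a: "a \<in> M" "E a (last Q)" using t[of "last Q"] ne by (auto simp: touches_def)
  obtain b where b: "b \<in> M" "E b (hd Q)" using t[of "hd Q"] ne by (auto simp: touches_def)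
  obtain P where P: "P \<noteq> []" "ipath P" "set P \<subseteq> M" "E (hd P) (last Q)" "E (last P) (hd Q)"
    "\<And>u. u \<in> set P \<Longrightarrow> E u (last Q) \<Longrightarrow> u = hd P" "\<And>u. u \<in> set P \<Longrightarrow> E u (hd Q) \<Longrightarrow> u = last P"
    using conn_path[OF M(1) a(1), of "\<lambda>u. E u (last Q)" b "\<lambda>u. E u (hd Q)"] a b by blast
  have len: "4 \<le> length (Q @ P)"
  proof (cases "3 \<le> length Q")
    case True
    then show ?thesis using P(1) by (cases P) auto
  next
    case False
    then obtain u w where uw: "Q = [u, w]" using Q(2) by (cases Q; cases "tl Q"; cases "tl (tl Q)") auto
    have "length P \<noteq> 1"
    proof
      assume "length P = 1"
      then obtain z where "P = [z]" by (cases P) auto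
      then show False using P(4,5) uw Q(1) no_triangle[of z u w] by auto
    qed
    moreover have "length P \<noteq> 0" using P(1) by simp
    moreover have "length (Q @ P) = 2 + length P" using uw by simp
    ultimately show ?thesis by linarith
  qed
  have cross: "E u v \<longleftrightarrow> (u = last Q \<and> v = hd P) \<or> (u = hd Q \<and> v = last P)" if "u \<in> set Q" "v \<in> set P" for u v
  proof
    assume e: "E u v"
    then have "touches M u" using that P(3) by (auto simp: touches_sym)
    then have "u = hd Q \<or> u = last Q" using t that by blast
    then show "(u = last Q \<and> v = hd P) \<or> (u = hd Q \<and> v = last P)" using P(6)[OF that(2)] P(7)[OF that(2)] sym[OF e] by blast
  qed (use sym[OF P(4)] sym[OF P(5)] in blast)
  have "ihole (Q @ P)" unfolding ihole_append[OF ne P(1)] using len Q P M cross by blast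
  then show ?thesis using that P(1-3) sym[OF P(4)] sym[OF P(5)] by blast
qed

text \<open>Let \<open>q1\<close> and \<open>q2\<close> be the first and last neighbours of
  \<open>v\<close> in the sector \<open>Y\<close>. The part of \<open>Q\<close> up to
  \<open>q1\<close> and the part from \<open>q2\<close> on touch \<open>M\<close> only in their
  ends, and each loses a spoke, since \<open>q\<close> has spokes on both sides. If neither has 4
  spokes, neither has 3, as it closes to a hole through \<open>M\<close>; with at most 2 on each,
  all counts are forced and a piece of \<open>Y\<close> completes a claw.\<close>

lemma split_gap:
  assumes Q: "ipath Q" and xQ: "x \<notin> set Q"
    and Qd: "Q = \<alpha> @ Y @ \<beta>" "Y = y # t @ [y']" and y: "E x y" "E x y'" "\<And>z. z \<in> set t \<Longrightarrow> \<not> E x z"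
    and M: "conn M" "M \<inter> set Q = {}" "x \<notin> M" "\<And>m. m \<in> M \<Longrightarrow> \<not> E x m"
    and ends: "touches M (hd Q)" "touches M (last Q)"
    and v: "v \<in> M" and att: "\<And>m z. m \<in> M \<Longrightarrow> z \<in> set Q \<Longrightarrow> E m z \<Longrightarrow> z = hd Q \<or> z = last Q \<or> (m = v \<and> z \<in> set Y)"
    and c4: "4 \<le> cnt x Q"
    and q: "Q = \<rho> @ q # \<sigma>" "E v q" "cnt x \<rho> \<noteq> 0" "cnt x \<sigma> \<noteq> 0"
  shows "\<exists>Q' \<rho>' \<sigma>'. Q = \<rho>' @ Q' @ \<sigma>' \<and> 4 \<le> cnt x Q' \<and> cnt x Q' < cnt x Q
     \<and> (\<forall>z\<in>set Q'. touches M z \<longleftrightarrow> z = hd Q' \<or> z = last Q')"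
proof (rule ccontr)
  assume neg: "\<not> ?thesis"
  have dQ: "distinct Q" using Q ipath_distinct by blast
  have "\<rho> \<noteq> []" "\<sigma> \<noteq> []" using q by auto
  then have qne: "q \<noteq> hd Q" "q \<noteq> last Q" using q(1) dQ by (auto simp: hd_append)
  have qY: "q \<in> set Y" using att[OF v _ q(2)] qne q(1) by auto
  obtain Y1 q1 Y1' where Y1: "Y = Y1 @ q1 # Y1'" "E v q1" "\<forall>z\<in>set Y1. \<not> E v z"
    using split_list_first_prop[of Y "E v"] qY q(2) by blast
  obtain Y2' q2 Y2 where Y2: "Y = Y2' @ q2 # Y2" "E v q2" "\<forall>z\<in>set Y2. \<not> E v z"
    using split_list_last_prop[of Y "E v"] qY q(2) by blast
  let ?Q1 = "\<alpha> @ Y1 @ [q1]" and ?Q2 = "q2 # Y2 @ \<beta>"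
  have Q1: "Q = ?Q1 @ (Y1' @ \<beta>)" and Q2: "Q = (\<alpha> @ Y2') @ ?Q2" using Qd(1) Y1(1) Y2(1) by simp_all
  have t1: "touches M z \<longleftrightarrow> z = hd ?Q1 \<or> z = last ?Q1" if z: "z \<in> set ?Q1" for z
  proof
    assume "touches M z"
    then obtain m where m: "m \<in> M" "E m z" by (auto simp: touches_def)
    have zQ: "z \<in> set Q" using z Q1 by auto
    from att[OF m(1) zQ m(2)] show "z = hd ?Q1 \<or> z = last ?Q1"
    proof (elim disjE)
      assume "z = hd Q" then show ?thesis using Q1 by (auto simp: hd_append)
    next
      assume "z = last Q"
      then show ?thesis using z distinct_last_notin[of ?Q1 "Y1' @ \<beta>"] dQ Q1 by (cases "Y1' @ \<beta> = []") auto
    next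
      assume "m = v \<and> z \<in> set Y"
      then show ?thesis using m z dQ Y1 unfolding Qd(1) by auto
    qed
  next
    assume "z = hd ?Q1 \<or> z = last ?Q1"
    moreover have "hd ?Q1 = hd Q" unfolding Q1 by (simp add: hd_append)
    ultimately show "touches M z" using ends(1) v Y1(2) by (auto simp: touches_def)
  qed
  have t2: "touches M z \<longleftrightarrow> z = hd ?Q2 \<or> z = last ?Q2" if z: "z \<in> set ?Q2" for z
  proof
    assume "touches M z"
    then obtain m where m: "m \<in> M" "E m z" by (auto simp: touches_def)
    have zQ: "z \<in> set Q" unfolding Q2 using z by auto
    from att[OF m(1) zQ m(2)] show "z = hd ?Q2 \<or> z = last ?Q2"
    proof (elim disjE)
      assume "z = hd Q"
      then show ?thesis using z distinct_hd_notin[of "\<alpha> @ Y2'" ?Q2] dQ Q2 by (cases "\<alpha> @ Y2' = []") auto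
    next
      assume "z = last Q" then show ?thesis unfolding Q2 by simp
    next
      assume "m = v \<and> z \<in> set Y"
      then show ?thesis using m z dQ Y2 unfolding Qd(1) by auto
    qed
  next
    assume "z = hd ?Q2 \<or> z = last ?Q2"
    moreover have "last ?Q2 = last Q" unfolding Q2 by simp
    ultimately show "touches M z" using ends(2) v Y2(2) by (auto simp: touches_def)
  qed
  \<comment> \<open>\<open>q\<close> does not precede \<open>q1\<close>, so whatever follows
    \<open>q\<close> on \<open>Q\<close> follows \<open>q1\<close>; the spoke behind
    \<open>q\<close> is lost in the part ending at \<open>q1\<close>.\<close>
  have s1: "set \<sigma> \<subseteq> set (Y1' @ \<beta>)"
  proof -
    have "q \<notin> set (\<alpha> @ Y1)" using qY q(2) Y1 dQ unfolding Qd(1) by auto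
    moreover have "q \<in> set Q" using q(1) by simp
    ultimately have "q \<in> set (q1 # Y1' @ \<beta>)" unfolding Q1 by auto
    then obtain \<mu> \<nu> where mn: "q1 # Y1' @ \<beta> = \<mu> @ q # \<nu>" by (meson split_list)
    then have "Q = (\<alpha> @ Y1 @ \<mu>) @ q # \<nu>" using Q1 by simp
    then have "\<sigma> = \<nu>" using distinct_split_unique(2)[of \<rho> q \<sigma>] q(1) dQ by metis
    then show ?thesis using mn by (cases \<mu>) auto
  qed
  have s2: "set \<rho> \<subseteq> set (\<alpha> @ Y2')"
  proof -
    have "q \<notin> set (Y2 @ \<beta>)" using qY q(2) Y2 dQ unfolding Qd(1) by auto
    moreover have "q \<in> set Q" using q(1) by simp
    ultimately have "q \<in> set (\<alpha> @ Y2' @ [q2])" unfolding Q2 by auto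
    then obtain \<mu> \<nu> where mn: "\<alpha> @ Y2' @ [q2] = \<mu> @ q # \<nu>" by (meson split_list)
    then have "Q = \<mu> @ q # (\<nu> @ Y2 @ \<beta>)" using Q2 by (metis append.assoc append_Cons append_Nil)
    then have "\<rho> = \<mu>" using distinct_split_unique(1)[of \<rho> q \<sigma>] q(1) dQ by metis
    then show ?thesis using mn by (cases \<nu> rule: rev_cases) auto
  qed
  have "cnt x (Y1' @ \<beta>) \<noteq> 0" using s1 q(4) unfolding cnt_0_iff by blast
  moreover have "cnt x Q = cnt x ?Q1 + cnt x (Y1' @ \<beta>)" by (subst Q1) (rule cnt_simps(2))
  ultimately have lt1: "cnt x ?Q1 < cnt x Q" by linarith
  have "cnt x (\<alpha> @ Y2') \<noteq> 0" using s2 q(3) unfolding cnt_0_iff by blast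
  moreover have "cnt x Q = cnt x (\<alpha> @ Y2') + cnt x ?Q2" by (subst Q2) (rule cnt_simps(2))
  ultimately have lt2: "cnt x ?Q2 < cnt x Q" by linarith
  have hole_of: "\<exists>P. P \<noteq> [] \<and> ipath P \<and> set P \<subseteq> M \<and> ihole (R @ P) \<and> E (last R) (hd P)" 
    if R: "ipath R" "set R \<subseteq> set Q" "2 \<le> cnt x R" "\<And>z. z \<in> set R \<Longrightarrow> touches M z \<longleftrightarrow> z = hd R \<or> z = last R" for R
  proof -
    have "2 \<le> length R" using R(3) length_filter_le[of "E x" R] unfolding cnt_def by linarith
    moreover have "M \<inter> set R = {}" using R(2) M(2) by blast
    ultimately obtain P where "P \<noteq> []" "ipath P" "set P \<subseteq> M" "ihole (R @ P)" "E (last R) (hd P)" "E (hd R) (last P)"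
      by (rule ihole_close[OF R(1) _ M(1) _ R(4)])
    then show ?thesis by (intro exI[of _ P] conjI)
  qed
  have cP: "cnt x P = 0" if "set P \<subseteq> M" for P using that M(4) by (auto simp: cnt_0_iff)
  have ip1: "ipath ?Q1" by (rule ipath_appendD(1)[OF Q[unfolded Q1]])
  have ip2: "ipath ?Q2" by (rule ipath_appendD(2)[OF Q[unfolded Q2]])
  have sub1: "set ?Q1 \<subseteq> set Q" unfolding Q1 by auto
  have sub2: "set ?Q2 \<subseteq> set Q" by (subst Q2) auto
  have not3: "cnt x R \<noteq> 3" if R: "ipath R" "set R \<subseteq> set Q" "\<And>z. z \<in> set R \<Longrightarrow> touches M z \<longleftrightarrow> z = hd R \<or> z = last R" for R
  proof
    assume c: "cnt x R = 3"
    then have "2 \<le> cnt x R" by simp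
    then obtain P where P: "set P \<subseteq> M" "ihole (R @ P)" using hole_of[OF R(1,2) _ R(3)] by blast
    show False using no_three_spokes[OF P(2), of x] c cP[OF P(1)] xQ R(2) P(1) M(3) by auto
  qed
  have "\<not> 4 \<le> cnt x ?Q1" 
  proof
    assume "4 \<le> cnt x ?Q1"
    then have "Q = [] @ ?Q1 @ (Y1' @ \<beta>) \<and> 4 \<le> cnt x ?Q1 \<and> cnt x ?Q1 < cnt x Q \<and> (\<forall>z\<in>set ?Q1. touches M z \<longleftrightarrow> z = hd ?Q1 \<or> z = last ?Q1)"
      using Q1 lt1 t1 by simp
    then show False using neg by blast
  qed
  then have le1: "cnt x ?Q1 \<le> 2" using not3[OF ip1 sub1 t1] by linarith
  have "\<not> 4 \<le> cnt x ?Q2" 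
  proof
    assume "4 \<le> cnt x ?Q2"
    then have "Q = (\<alpha> @ Y2') @ ?Q2 @ [] \<and> 4 \<le> cnt x ?Q2 \<and> cnt x ?Q2 < cnt x Q \<and> (\<forall>z\<in>set ?Q2. touches M z \<longleftrightarrow> z = hd ?Q2 \<or> z = last ?Q2)"
      using Q2 lt2 t2 by simp
    then show False using neg by blast
  qed
  then have le2: "cnt x ?Q2 \<le> 2" using not3[OF ip2 sub2 t2] by linarith
  have cY: "cnt x Y = 2" using y cnt_0_iff[of x t] by (simp add: Qd(2))
  have cQ: "cnt x Q = cnt x \<alpha> + 2 + cnt x \<beta>" using cY by (simp add: Qd(1))
  have y_in: "y \<in> set (Y1 @ [q1])" using Y1(1) Qd(2) by (cases Y1) auto
  have y'_in: "y' \<in> set (q2 # Y2)" using Y2(1) Qd(2) by (cases Y2 rule: rev_cases) auto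
  have g1: "1 \<le> cnt x (Y1 @ [q1])" using y_in y(1) cnt_0_iff[of x "Y1 @ [q1]"] by fastforce
  have g2: "1 \<le> cnt x (q2 # Y2)" using y'_in y(2) cnt_0_iff[of x "q2 # Y2"] by fastforce
  have a1: "cnt x ?Q1 = cnt x \<alpha> + cnt x (Y1 @ [q1])" and a2: "cnt x ?Q2 = cnt x (q2 # Y2) + cnt x \<beta>" by simp_all
  \<comment> \<open>Each part contains an end of \<open>Y\<close>, so at most one spoke lies on
    either side of \<open>Y\<close>; as \<open>Q\<close> has at least four, there is exactly one on
    either side.\<close>
  have e: "cnt x \<alpha> = 1" "cnt x \<beta> = 1" "cnt x (Y1 @ [q1]) = 1" "cnt x (q2 # Y2) = 1"
    using le1 le2 c4 cQ g1 g2 a1 a2 by linarith+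
  then have ne: "\<alpha> \<noteq> []" "\<beta> \<noteq> []" by auto
  obtain P where P: "P \<noteq> []" "ipath P" "set P \<subseteq> M" "ihole (?Q1 @ P)" "E (last ?Q1) (hd P)"
    using hole_of[OF ip1 sub1 _ t1] e a1 by auto
  have "hd Q = hd \<alpha>" "last Q = last \<beta>" using ne by (auto simp: Qd(1))
  then have Yends: "z \<noteq> hd Q" "z \<noteq> last Q" if "z \<in> set Y" for z
  proof -
    have "set \<alpha> \<inter> set Y = {}" "set Y \<inter> set \<beta> = {}" using dQ Qd(1) by auto
    then show "z \<noteq> hd Q" "z \<noteq> last Q"
      unfolding \<open>hd Q = hd \<alpha>\<close> \<open>last Q = last \<beta>\<close>
      using that hd_in_set[OF ne(1)] last_in_set[OF ne(2)] by (metis disjoint_iff)+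
  qed
  \<comment> \<open>No vertex of \<open>Y\<close> is an end of \<open>Q\<close>, so within
    \<open>M\<close> only \<open>v\<close> is adjacent to \<open>q1\<close>: the new hole passes
    through \<open>v\<close>.\<close>
  have "hd P = v"
  proof -
    have "E (hd P) q1" "hd P \<in> M" "q1 \<in> set Q" "q1 \<in> set Y" using P(1,3) sym[OF P(5)] Y1(1) Qd(1) by auto
    then show ?thesis using att[of "hd P" q1] Yends[of q1] by blast
  qed
  then have vP: "v \<in> set P" using P(1) hd_in_set by metis
  have xC: "x \<notin> set (?Q1 @ P)" using xQ sub1 P(3) M(3) by auto
  have cC: "cnt x (?Q1 @ P) = 2" using cP[OF P(3)] e a1 by (metis add_0_right cnt_simps(2) one_add_one)
  have yy': "y \<noteq> y'" using dQ Qd by auto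
  have attD: "m = v \<and> E v z" if "m \<in> set P" "z \<in> set Y" "E m z" for m z
    using att[of m z] that P(3) Yends[of z] Qd(1) by auto
  show False
  proof (cases "q1 = q2")
    \<comment> \<open>Here \<open>v\<close> has a single neighbour in \<open>Y\<close>. The part of
      \<open>Y\<close> behind it contains the spoke end \<open>y'\<close> and links \<open>x\<close>
      to \<open>q1\<close>.\<close>
    case True
    have dY: "distinct Y" using dQ Qd(1) by simp
    then have eqs: "Y2' = Y1" "Y2 = Y1'" using distinct_split_unique[of Y1 q1 Y1' Y2' Y2] Y1(1) Y2(1) True by auto
    have "y' \<noteq> q1"
    proof
      assume "y' = q1"
      moreover from this have "y \<in> set Y1" using y_in yy' by auto
      then have "cnt x Y1 \<noteq> 0" using y(1) cnt_0_iff by blast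
      ultimately show False using e(3) y(2) by simp
    qed
    then have y'Y2: "y' \<in> set Y2" using y'_in True by auto
    have nxq: "\<not> E x q1"
    proof
      assume "E x q1"
      moreover have "cnt x Y2 \<noteq> 0" using y'Y2 y(2) cnt_0_iff by blast
      ultimately show False using e(4) True by simp
    qed
    have Qs: "Q = ?Q1 @ Y2 @ \<beta>" using Q1 eqs by simp
    have ipY2: "ipath Y2" by (rule ipath_appendD(1)[OF ipath_appendD(2)[OF Q[unfolded Qs]]])
    have Y2ne: "Y2 \<noteq> []" using y'Y2 by auto
    have cross: "\<forall>u\<in>set ?Q1. \<forall>w\<in>set (Y2 @ \<beta>). E u w \<longleftrightarrow> u = last ?Q1 \<and> w = hd (Y2 @ \<beta>)"
      using Q unfolding Qs ipath_append[of ?Q1] by blast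
    show False
    proof (rule no_two_spokes_link[OF P(4) xC cC, of "set Y2" q1])
      show "conn (set Y2)" using conn_ipath ipY2 Y2ne by blast
      show "x \<notin> set Y2" using xQ unfolding Qs by auto
      show "set Y2 \<inter> set (?Q1 @ P) = {}" using dQ P(3) M(2) unfolding Qs by auto
      show "touches (set Y2) x" using y'Y2 y(2) by (auto simp: touches_sym)
      show "q1 \<in> set (?Q1 @ P)" by simp
      show "\<not> E x q1" by fact
      fix w assume w: "w \<in> set (?Q1 @ P)"
      show "touches (set Y2) w \<longleftrightarrow> w = q1"
      proof
        assume "touches (set Y2) w"
        then obtain z where z: "z \<in> set Y2" "E z w" by (auto simp: touches_def)
        show "w = q1"
        proof (cases "w \<in> set P")
          case True
          then show ?thesis using attD[of w z] z(1) sym[OF z(2)] Y2(1,3) by auto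
        next
          case False
          then have "w \<in> set ?Q1" using w by auto
          then show ?thesis using cross z(1) sym[OF z(2)] by auto
        qed
      next
        assume "w = q1"
        then have "E w (hd Y2)" using cross Y2ne by (auto simp: hd_append)
        then show "touches (set Y2) w" using Y2ne by (auto simp: touches_sym)
      qed
    qed
  next
    \<comment> \<open>Here the part of \<open>Y\<close> from \<open>q2\<close> to \<open>y'\<close>
      links \<open>x\<close> to \<open>v\<close>. It does not touch \<open>q1\<close>: adjacent
      \<open>q1\<close> and \<open>q2\<close> would form a triangle with \<open>v\<close>, so
      \<open>\<kappa>\<close> lies between them.\<close>
    case False
    have "q2 \<notin> set (Y1 @ [q1])" using False Y1(3) Y2(2) by auto
    moreover have "q2 \<in> set Y" using Y2(1) by simp
    ultimately have "q2 \<in> set Y1'" unfolding Y1(1) by auto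
    then obtain \<kappa> \<nu> where k: "Y1' = \<kappa> @ q2 # \<nu>" by (meson split_list)
    have dY: "distinct Y" using dQ Qd(1) by simp
    have "Y = (Y1 @ q1 # \<kappa>) @ q2 # \<nu>" using Y1(1) k by simp
    then have "\<nu> = Y2" using distinct_split_unique(2)[of Y2' q2 Y2] Y2(1) dY by metis
    then have Qs: "Q = ?Q1 @ \<kappa> @ (q2 # Y2) @ \<beta>" using Q1 k by simp
    have ipD: "ipath (q2 # Y2)" by (rule ipath_appendD(1)[OF ipath_appendD(2)[OF ipath_appendD(2)[OF Q[unfolded Qs]]]])
    have cross: "\<forall>u\<in>set ?Q1. \<forall>w\<in>set (\<kappa> @ (q2 # Y2) @ \<beta>). E u w \<longleftrightarrow> u = last ?Q1 \<and> w = hd (\<kappa> @ (q2 # Y2) @ \<beta>)"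
      using Q unfolding Qs ipath_append[of ?Q1] by blast
    have "\<not> E q1 q2" using Y1(2) Y2(2) no_triangle[of v q1 q2] by blast
    then have kne: "\<kappa> \<noteq> []" using cross by auto
    show False
    proof (rule no_two_spokes_link[OF P(4) xC cC, of "set (q2 # Y2)" v])
      show "conn (set (q2 # Y2))" using conn_ipath ipD by blast
      show "x \<notin> set (q2 # Y2)" using xQ unfolding Qs by auto
      show "set (q2 # Y2) \<inter> set (?Q1 @ P) = {}" using dQ P(3) M(2) unfolding Qs by auto
      show "touches (set (q2 # Y2)) x" using y'_in y(2) unfolding touches_sym by blast
      show "v \<in> set (?Q1 @ P)" using vP by simp
      show "\<not> E x v" using M(4) v by blast
      fix w assume w: "w \<in> set (?Q1 @ P)"
      show "touches (set (q2 # Y2)) w \<longleftrightarrow> w = v"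
      proof
        assume "touches (set (q2 # Y2)) w"
        then obtain z where z: "z \<in> set (q2 # Y2)" "E z w" by (auto simp: touches_def)
        show "w = v"
        proof (cases "w \<in> set P")
          case True
          then show ?thesis using attD[of w z] z(1) sym[OF z(2)] Y2(1) by auto
        next
          case False
          then have "w \<in> set ?Q1" using w by auto
          moreover have "E w z" using sym[OF z(2)] .
          ultimately have "z = hd (\<kappa> @ (q2 # Y2) @ \<beta>)" using cross z(1) by auto
          then have "z \<in> set \<kappa>" using kne by simp
          then show ?thesis using z(1) dQ unfolding Qs by auto
        qed
      next
        assume "w = v"
        then show "touches (set (q2 # Y2)) w" using Y2(2) by (auto simp: touches_sym)
      qed
    qed
  qed
qed

text \<open>A closed sector in either direction. Only the vertex set of the rim enters, so rotations
  do not matter and a sector inside a common part of two rims is a sector of both.\<close>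

definition csec :: "'a set \<Rightarrow> 'a \<Rightarrow> 'a list \<Rightarrow> bool" where
  "csec S x Y \<longleftrightarrow> ipath Y \<and> set Y \<subseteq> S \<and>
     (\<exists>y t y'. Y = y # t @ [y'] \<and> E x y \<and> E x y' \<and> (\<forall>z\<in>set t. \<not> E x z))"

text \<open>Once the path is completed to the whole hole, edges to the rest leave only from its two
  ends.\<close>

lemma hole_inner_nbr:
  assumes "ihole c" "ipath (y # m @ [y'])" "set (y # m @ [y']) \<subseteq> set c" "u \<in> set m" "w \<in> set c" "E u w"
  shows "w \<in> set (y # m @ [y'])"
proof -
  let ?Q = "y # m @ [y']"
  obtain r where r: "r \<noteq> []" "ihole (?Q @ r)" "set (?Q @ r) = set c" using ihole_extend[OF assms(1,2) _ assms(3)] by blast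
  have "distinct ?Q" using ipath_distinct assms(2) by blast
  moreover have "\<forall>u\<in>set ?Q. \<forall>v\<in>set r. E u v \<longrightarrow> u = last ?Q \<or> u = hd ?Q"
    using r by (subst (asm) ihole_append) auto
  ultimately have "w \<notin> set r" using assms(4,6) by auto
  then show ?thesis using r(3) assms(5) by auto
qed

text \<open>A sector cannot pass a spoke end. Its interior contains no neighbour of
  \<open>x\<close>, hence neither \<open>y\<close> nor \<open>y'\<close>, so walking along it from a
  vertex of \<open>m\<close> never leaves \<open>m\<close>.\<close>

lemma csec_sub:
  assumes c: "ihole c" and Q: "ipath (y # m @ [y'])" "set (y # m @ [y']) \<subseteq> set c" "E x y" "E x y'"
    and Y: "csec (set c) x Y" and q: "q \<in> set m" "q \<in> set Y"
  shows "set Y \<subseteq> set (y # m @ [y'])"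
proof -
  obtain a s b where Y': "Y = a # s @ [b]" "ipath Y" "set Y \<subseteq> set c" "E x a" "E x b" "\<forall>z\<in>set s. \<not> E x z"
    using Y by (auto simp: csec_def)
  have sne: "s \<noteq> []" using Y' no_triangle[of x a b] by auto
  have E1: "E a (hd s)" "E b (last s)" and ips: "ipath s"
    using Y'(2) sne unfolding Y'(1) by (auto simp: ipath_append sym_iff[of b])
  note inb = hole_inner_nbr[OF c Q(1,2)]
  have m: "u \<in> set m" if "u \<in> set s" "u \<in> set (y # m @ [y'])" for u using that Y'(6) Q(3,4) by auto
  have sc: "set s \<subseteq> set c" using Y' by auto
  have hl: "hd s \<in> set s" "last s \<in> set s" "hd s \<in> set c" "last s \<in> set c" using sne sc hd_in_set last_in_set by blast+
  \<comment> \<open>The common vertex \<open>q\<close> may be an end of the sector; the adjacent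
    interior vertex then serves instead.\<close>
  have "\<exists>u\<in>set s. u \<in> set m"
  proof -
    consider "q \<in> set s" | "q = a" | "q = b" using q(2) Y'(1) by auto
    then show ?thesis
    proof cases
      case 2
      then have "hd s \<in> set (y # m @ [y'])" using inb[OF q(1) hl(3)] E1(1) by simp
      then show ?thesis using m[OF hl(1)] hl(1) by blast
    next
      case 3
      then have "last s \<in> set (y # m @ [y'])" using inb[OF q(1) hl(4)] E1(2) by simp
      then show ?thesis using m[OF hl(2)] hl(2) by blast
    qed (use q in auto)
  qed
  then obtain u where u: "u \<in> set s" "u \<in> set m" by blast
  have all: "w \<in> set m" if "w \<in> set s" for w
  proof -
    have "(\<lambda>u v. u \<in> set s \<and> v \<in> set s \<and> E u v)\<^sup>*\<^sup>* u w"
      using conn_ipath[OF ips sne] u(1) that unfolding conn_def by blast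
    then show ?thesis
    proof (induction rule: rtranclp_induct)
      case (step v w)
      then have "v \<in> set m" "w \<in> set s" "w \<in> set c" "E v w" using sc by blast+
      then show ?case using m[OF _ inb] by blast
    qed (use u in simp)
  qed
  have "a \<in> set (y # m @ [y'])" using inb[OF all[OF hl(1)] _ sym[OF E1(1)]] Y'(1,3) by auto
  moreover have "b \<in> set (y # m @ [y'])" using inb[OF all[OF hl(2)] _ sym[OF E1(2)]] Y'(1,3) by auto
  ultimately show ?thesis unfolding Y'(1) using all by (simp add: subset_iff)
qed

lemma successively_stays:
  assumes "successively E p" "set p \<subseteq> A \<union> B" "\<And>u v. u \<in> A \<Longrightarrow> v \<in> B \<Longrightarrow> \<not> E u v" "p \<noteq> []" "hd p \<in> B"
  shows "set p \<subseteq> B"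
  using assms
proof (induction p rule: induct_list012)
  case (3 a b p)
  have "b \<in> B" using "3.prems" sym[of a b] by auto
  then have "set (b # p) \<subseteq> B" using 3 by simp
  then show ?case using "3.prems" by simp
qed auto

text \<open>After its first vertex \<open>a\<close>, the path \<open>Y\<close> cannot change between
  the two sides of \<open>a\<close> in \<open>Q\<close>, as no edge joins them; on the side of the
  next vertex it is determined by \<open>ipath_prefix\<close>.\<close>

lemma ipath_sub:
  assumes Q: "ipath Q" and Y: "ipath Y" "Y \<noteq> []" "set Y \<subseteq> set Q"
  shows "\<exists>\<alpha> \<beta>. Q = \<alpha> @ Y @ \<beta> \<or> Q = \<alpha> @ rev Y @ \<beta>"
proof -
  obtain a Y' where Y': "Y = a # Y'" using Y(2) by (cases Y) auto
  obtain \<alpha> \<beta> where Qs: "Q = \<alpha> @ a # \<beta>" using Y(3) Y' split_list[of a Q] by auto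
  show ?thesis
  proof (cases "Y' = []")
    case True
    then show ?thesis using Qs Y' by auto
  next
    case False
    have ipb: "ipath (a # \<beta>)" "ipath \<alpha>" using Q unfolding Qs by (simp_all only: ipath_append)
    have ipa: "ipath (a # rev \<alpha>)"
    proof -
      have "ipath (\<alpha> @ [a])" using ipath_appendD(1)[of "\<alpha> @ [a]" \<beta>] Q Qs by simp
      then show ?thesis using ipath_rev[of "\<alpha> @ [a]"] by simp
    qed
    have no: "\<not> E u v" if "u \<in> set \<alpha>" "v \<in> set \<beta>" for u v
    proof
      assume "E u v"
      moreover have "\<forall>u\<in>set \<alpha>. \<forall>v\<in>set (a # \<beta>). E u v \<longleftrightarrow> u = last \<alpha> \<and> v = a"
        using Q unfolding Qs ipath_append by simp
      ultimately have "v = a" using that by auto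
      then show False using ipb(1) that by auto
    qed
    have sub: "set Y' \<subseteq> set \<alpha> \<union> set \<beta>" using Y Y' Qs by auto
    have suc: "successively E Y'" using ipath_successively Y Y' by auto
    have "hd Y' \<in> set Y'" using False by simp
    then consider "hd Y' \<in> set \<alpha>" | "hd Y' \<in> set \<beta>" using sub by auto
    then show ?thesis
    proof cases
      case 2
      have "set Y' \<subseteq> set \<beta>" by (rule successively_stays[OF suc sub no False 2])
      then have "set Y \<subseteq> set (a # \<beta>)" using Y' by auto
      from ipath_prefix[OF ipb(1) Y(1) this Y(2)] obtain r where "a # \<beta> = Y @ r" using Y' by auto
      then show ?thesis using Qs by auto
    next
      case 1
      have no': "\<not> E u v" if "u \<in> set \<beta>" "v \<in> set \<alpha>" for u v using no[OF that(2,1)] sym[of u v] by blast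
      have "set Y' \<subseteq> set \<beta> \<union> set \<alpha>" using sub by blast
      from successively_stays[OF suc this no' False 1] have "set Y' \<subseteq> set \<alpha>" .
      then have "set Y \<subseteq> set (a # rev \<alpha>)" using Y' by auto
      from ipath_prefix[OF ipa Y(1) this Y(2)] obtain r where r: "a # rev \<alpha> = Y @ r" using Y' by auto
      then have "rev (a # rev \<alpha>) = rev r @ rev Y" by simp
      then have "\<alpha> @ [a] = rev r @ rev Y" by simp
      then have "Q = rev r @ rev Y @ \<beta>" using Qs by (metis append.assoc append_Cons append_Nil)
      then show ?thesis by blast
    qed
  qed
qed

lemma csec_rev: "csec S x Y \<Longrightarrow> csec S x (rev Y)"
proof -
  assume Y: "csec S x Y"
  then obtain y t y' where "Y = y # t @ [y']" "E x y" "E x y'" "\<forall>z\<in>set t. \<not> E x z" unfolding csec_def by blast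
  then have "rev Y = y' # rev t @ [y] \<and> E x y' \<and> E x y \<and> (\<forall>z\<in>set (rev t). \<not> E x z)" by simp
  then have "\<exists>y t y'. rev Y = y # t @ [y'] \<and> E x y \<and> E x y' \<and> (\<forall>z\<in>set t. \<not> E x z)" by blast
  then show ?thesis using Y unfolding csec_def ipath_rev set_rev by (intro conjI) auto
qed

lemma csec_in_ipath:
  assumes "ipath Q" "csec S x Y" "set Y \<subseteq> set Q"
  obtains \<alpha> y t y' \<beta> where "Q = \<alpha> @ (y # t @ [y']) @ \<beta>" "set (y # t @ [y']) = set Y" "E x y" "E x y'" "\<And>z. z \<in> set t \<Longrightarrow> \<not> E x z"
proof -
  have ip: "ipath Y" "Y \<noteq> []" using assms(2) by (auto simp: csec_def)
  obtain \<alpha> \<beta> Y' where Y': "Q = \<alpha> @ Y' @ \<beta>" "Y' = Y \<or> Y' = rev Y" using ipath_sub[OF assms(1) ip assms(3)] by blast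
  then have "csec S x Y'" "set Y' = set Y" using assms(2) csec_rev by auto
  then show ?thesis using that Y'(1) unfolding csec_def by metis
qed

lemma cnt_set_eq: "distinct p \<Longrightarrow> distinct q \<Longrightarrow> set p = set q \<Longrightarrow> cnt x p = cnt x q"
  by (simp add: cnt_card)

lemma cnt_pos: "z \<in> set p \<Longrightarrow> E x z \<Longrightarrow> cnt x p \<noteq> 0"
  unfolding cnt_0_iff by blast

section \<open>Bad connections across a sector\<close>

definition is_wheel :: "'a list \<Rightarrow> 'a \<Rightarrow> bool" where
  "is_wheel c x \<longleftrightarrow> ihole c \<and> x \<notin> set c \<and> 3 \<le> cnt x c"

lemma wheel_4: "is_wheel c x \<Longrightarrow> 4 \<le> cnt x c"
  using no_three_spokes[of c x] by (cases "cnt x c = 3") (auto simp: is_wheel_def)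

lemma ipath_V:
  assumes "ipath p" "2 \<le> length p" shows "set p \<subseteq> V"
proof
  fix u assume "u \<in> set p"
  then obtain \<alpha> \<beta> where s: "p = \<alpha> @ u # \<beta>" by (meson split_list)
  have "\<exists>w. E u w"
  proof (cases \<beta>)
    case (Cons w \<beta>')
    then show ?thesis using ipath_adj[of \<alpha> u w \<beta>'] assms(1) s by auto
  next
    case Nil
    then obtain \<alpha>' w where "\<alpha> = \<alpha>' @ [w]" using assms(2) s by (cases \<alpha> rule: rev_cases) auto
    then show ?thesis using sym[OF ipath_adj[of \<alpha>' w u "[]"]] assms(1) s Nil by auto
  qed
  then show "u \<in> V" using E_V by blast
qed

definition proper :: "'a list \<Rightarrow> 'a \<Rightarrow> bool" where
  "proper c x \<longleftrightarrow> (\<forall>v\<in>V. v \<notin> set c \<longrightarrow> v \<noteq> x \<longrightarrow> \<not> E x v \<longrightarrow>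
     (\<exists>Y. csec (set c) x Y \<and> (\<forall>z\<in>set c. E v z \<longrightarrow> z \<in> set Y)))"

text \<open>The obstruction to a decomposition at this wheel: by \<open>sector_separates\<close>,
  without such a \<open>D\<close> every sector is cut off as required.\<close>

definition bad :: "'a list \<Rightarrow> 'a \<Rightarrow> bool" where
  "bad c x \<longleftrightarrow> (\<exists>y t y' D. csec (set c) x (y # t @ [y']) \<and> (\<forall>z\<in>set t. \<not> E x z) \<and> conn D \<and> D \<subseteq> V - set c \<and> x \<notin> D \<and> (\<forall>d\<in>D. \<not> E x d)
     \<and> (\<exists>z\<in>set t. touches D z) \<and> (\<exists>z\<in>set c - set (y # t @ [y']). touches D z))"

text \<open>
  A shortest path through \<open>M\<close> closes \<open>Q\<close> to the rim of a wheel with hub \<open>x\<close> and fewer spokes than \<open>c\<close>.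
\<close>

definition shortcut :: "'a list \<Rightarrow> 'a \<Rightarrow> 'a set \<Rightarrow> 'a list \<Rightarrow> bool" where
  "shortcut c x M Q \<longleftrightarrow> ipath Q \<and> set Q \<subseteq> set c \<and> conn M \<and> M \<subseteq> V \<and> M \<inter> set Q = {} \<and> x \<notin> M \<and> (\<forall>m\<in>M. \<not> E x m)
     \<and> (\<forall>z\<in>set Q. touches M z \<longleftrightarrow> z = hd Q \<or> z = last Q) \<and> 4 \<le> cnt x Q \<and> cnt x Q < cnt x c"

lemma first_last_spoke:
  assumes "2 \<le> cnt x Q"
  obtains Qa ya Qm yb Qb where "Q = Qa @ ya # Qm @ yb # Qb" "E x ya" "E x yb" "cnt x Qa = 0" "cnt x Qb = 0"
proof -
  have "\<exists>z\<in>set Q. E x z" using assms cnt_0_iff[of x Q] by auto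
  then obtain Qa ya R where 1: "Q = Qa @ ya # R" "E x ya" "\<forall>z\<in>set Qa. \<not> E x z"
    using split_list_first_prop[of Q "E x"] by blast
  then have a: "cnt x Qa = 0" using cnt_0_iff by blast
  then have "cnt x R \<noteq> 0" using assms 1 by simp
  then have "\<exists>z\<in>set R. E x z" using cnt_0_iff[of x R] by auto
  from split_list_last_prop[OF this] obtain Qm yb Qb where 2: "R = Qm @ yb # Qb" "E x yb" "\<forall>z\<in>set Qb. \<not> E x z"
    by blast
  then have "cnt x Qb = 0" using cnt_0_iff by blast
  then show ?thesis using that 1 2 a by simp
qed

text \<open>The rim closed from \<open>Q\<close> through \<open>M\<close> has fewer spokes than
  \<open>c\<close>, so by minimality it is not proper. A vertex \<open>v\<close> violating
  properness has a neighbour between the outer spokes of \<open>Q\<close> and another on the closing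
  path \<open>P\<close>, so \<open>insert v (set P)\<close> is a connected set with which
  \<open>split_gap\<close> cuts \<open>Q\<close> down further.\<close>

lemma shortcut_improve:
  assumes w: "is_wheel c x" "proper c x" and xV: "x \<in> V"
    and min: "\<And>c' x'. is_wheel c' x' \<Longrightarrow> proper c' x' \<Longrightarrow> cnt x c \<le> cnt x' c'"
    and st: "shortcut c x M Q"
  shows "\<exists>M' Q'. shortcut c x M' Q' \<and> cnt x Q' < cnt x Q"
proof -
  have Q: "ipath Q" "set Q \<subseteq> set c" and M: "conn M" "M \<subseteq> V" "M \<inter> set Q = {}" "x \<notin> M" "\<And>m. m \<in> M \<Longrightarrow> \<not> E x m"
    and t: "\<And>z. z \<in> set Q \<Longrightarrow> touches M z \<longleftrightarrow> z = hd Q \<or> z = last Q" and c4: "4 \<le> cnt x Q" "cnt x Q < cnt x c"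
    using st unfolding shortcut_def by blast+
  have c: "ihole c" "x \<notin> set c" using w by (auto simp: is_wheel_def)
  have "2 \<le> length Q" using c4(1) length_filter_le[of "E x" Q] unfolding cnt_def by linarith
  then obtain P where P: "P \<noteq> []" "ipath P" "set P \<subseteq> M" "ihole (Q @ P)" "E (last Q) (hd P)" "E (hd Q) (last P)"
    by (rule ihole_close[OF Q(1) _ M(1) M(3) t])
  let ?C = "Q @ P"
  have cP: "cnt x P = 0" using P(3) M(5) cnt_0_iff[of x P] by blast
  have xC: "x \<notin> set ?C" using c(2) Q(2) P(3) M(4) by auto
  have "is_wheel ?C x" using P(4) xC cP c4 by (simp add: is_wheel_def)
  then have "\<not> proper ?C x" using min[of ?C x] c4 cP by fastforce
  then obtain v where v: "v \<in> V" "v \<notin> set ?C" "v \<noteq> x" "\<not> E x v"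
    and nosec: "\<And>Y. csec (set ?C) x Y \<Longrightarrow> \<exists>z\<in>set ?C. E v z \<and> z \<notin> set Y" unfolding proper_def by blast
  have "2 \<le> cnt x Q" using c4 by simp
  then obtain Qa ya Qm yb Qb where Qd: "Q = Qa @ ya # Qm @ yb # Qb" "E x ya" "E x yb" "cnt x Qa = 0" "cnt x Qb = 0"
    by (rule first_last_spoke)
  have "cnt x Qm \<noteq> 0" using c4 Qd by simp
  then have Qmne: "Qm \<noteq> []" by auto
  \<comment> \<open>The sector of the new rim through \<open>P\<close>, from the last spoke of
    \<open>Q\<close> round to the first. It misses a neighbour of \<open>v\<close>, which therefore
    lies strictly between these two spokes.\<close>
  let ?W = "yb # Qb @ P @ Qa @ [ya]"
  have "ihole ((Qa @ [ya] @ Qm) @ (yb # Qb @ P))" using P(4) Qd(1) by simp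
  from ihole_rotate[OF this] have "ihole (?W @ Qm)" by simp
  then have ipW: "ipath ?W" using ihole_ipath[of ?W Qm] Qmne by simp
  have "csec (set ?C) x ?W"
  proof -
    have "?W = yb # (Qb @ P @ Qa) @ [ya]" by simp
    moreover have "\<forall>z\<in>set (Qb @ P @ Qa). \<not> E x z" using Qd(4,5) cP unfolding cnt_0_iff by auto
    moreover have "set ?W \<subseteq> set ?C" using Qd(1) by auto
    ultimately show ?thesis using ipW Qd(2,3) unfolding csec_def by blast
  qed
  from nosec[OF this] obtain q where q: "q \<in> set ?C" "E v q" "q \<notin> set ?W" by blast
  then have qm: "q \<in> set Qm" using Qd(1) by auto
  have subQ: "set (ya # Qm @ [yb]) \<subseteq> set Q" using Qd(1) by auto
  have ipm: "ipath (ya # Qm @ [yb])"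
  proof -
    have "Q = Qa @ (ya # Qm @ [yb]) @ Qb" using Qd(1) by simp
    then show ?thesis using Q(1) ipath_appendD by metis
  qed
  have subc: "set (ya # Qm @ [yb]) \<subseteq> set c" using subQ Q(2) by blast
  have vc: "v \<notin> set c"
  proof
    assume "v \<in> set c"
    from hole_inner_nbr[OF c(1) ipm subc qm this sym[OF q(2)]] show False using subQ v(2) by auto
  qed
  obtain Y2 where Y2: "csec (set c) x Y2" "\<And>z. z \<in> set c \<Longrightarrow> E v z \<Longrightarrow> z \<in> set Y2"
    using w(2) v vc unfolding proper_def by blast
  have qY: "q \<in> set Y2" using Y2(2)[OF _ q(2)] qm subc by auto
  have "set Y2 \<subseteq> set (ya # Qm @ [yb])" by (rule csec_sub[OF c(1) ipm subc Qd(2,3) Y2(1) qm qY])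
  then have Y2Q: "set Y2 \<subseteq> set Q" using subQ by blast
  \<comment> \<open>Lying on \<open>Q\<close>, the sector \<open>Y2\<close> of \<open>c\<close> is
    also one of the new rim. It misses a neighbour of \<open>v\<close> there but contains all those
    on \<open>c\<close>, so the missed one is on \<open>P\<close>.\<close>
  have "csec (set ?C) x Y2" using Y2(1) Y2Q unfolding csec_def by auto
  from nosec[OF this] obtain z where z: "z \<in> set ?C" "E v z" "z \<notin> set Y2" by blast
  then have zP: "z \<in> set P" using Y2(2)[of z] Q(2) by auto
  let ?M = "insert v (set P)"
  have conM: "conn ?M" using conn_insert[OF conn_ipath[OF P(2,1)], of v] zP z(2) by (auto simp: touches_sym)
  obtain \<alpha> y t' y' \<beta> where Y: "Q = \<alpha> @ (y # t' @ [y']) @ \<beta>" "set (y # t' @ [y']) = set Y2" "E x y" "E x y'" "\<And>z. z \<in> set t' \<Longrightarrow> \<not> E x z"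
    by (rule csec_in_ipath[OF Q(1) Y2(1) Y2Q]) blast
  obtain m1 m2 where m: "Qm = m1 @ q # m2" using qm by (meson split_list)
  have MQ: "?M \<inter> set Q = {}" using v(2) P(3) M(3) by auto
  have ex: "\<exists>Q' \<rho>' \<sigma>'. Q = \<rho>' @ Q' @ \<sigma>' \<and> 4 \<le> cnt x Q' \<and> cnt x Q' < cnt x Q
     \<and> (\<forall>z\<in>set Q'. touches ?M z \<longleftrightarrow> z = hd Q' \<or> z = last Q')"
  proof (rule split_gap[OF Q(1) _ Y(1) refl Y(3,4,5) conM MQ])
    show "x \<notin> set Q" using xC by simp
    show "x \<notin> ?M" using v(3) P(3) M(4) by auto
    show "\<not> E x m" if "m \<in> ?M" for m using that v(4) P(3) M(5) by auto
    show "touches ?M (hd Q)" using P(1,6) by (auto simp: touches_sym)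
    show "touches ?M (last Q)" using P(1,5) by (auto simp: touches_sym)
    show "v \<in> ?M" by simp
    show "z = hd Q \<or> z = last Q \<or> (m = v \<and> z \<in> set (y # t' @ [y']))" if mz: "m \<in> ?M" "z \<in> set Q" "E m z" for m z
    proof (cases "m = v")
      case True
      then show ?thesis using Y2(2)[of z] mz Q(2) Y(2) by auto
    next
      case False
      then have "touches M z" using mz P(3) by (auto simp: touches_def)
      then show ?thesis using t[OF mz(2)] by blast
    qed
    show "4 \<le> cnt x Q" by (rule c4(1))
    show "Q = (Qa @ ya # m1) @ q # (m2 @ yb # Qb)" using Qd(1) m by simp
    show "E v q" by (rule q(2))
    show "cnt x (Qa @ ya # m1) \<noteq> 0" "cnt x (m2 @ yb # Qb) \<noteq> 0" using Qd(2,3) by simp_all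
  qed
  then obtain Q' \<rho>' \<sigma>' where Q': "Q = \<rho>' @ Q' @ \<sigma>'" "4 \<le> cnt x Q'" "cnt x Q' < cnt x Q"
     "\<forall>z\<in>set Q'. touches ?M z \<longleftrightarrow> z = hd Q' \<or> z = last Q'" by blast
  have "ipath Q'" using Q(1) Q'(1) ipath_appendD by metis
  moreover have s: "set Q' \<subseteq> set Q" using Q'(1) by auto
  moreover have "?M \<subseteq> V" using v(1) P(3) M(2) by auto
  moreover have "\<forall>m\<in>?M. \<not> E x m" "x \<notin> ?M" using v P(3) M(4,5) by auto
  ultimately have "shortcut c x ?M Q'"
    unfolding shortcut_def using Q' c4 Q(2) conM MQ by (intro conjI) auto
  then show ?thesis using Q'(3) by blast
qed

text \<open>Every shortcut yields one with fewer spokes, an infinite descent.\<close>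

lemma no_shortcut:
  assumes w: "is_wheel c x" "proper c x" "x \<in> V"
    and min: "\<And>c' x'. is_wheel c' x' \<Longrightarrow> proper c' x' \<Longrightarrow> cnt x c \<le> cnt x' c'"
  shows "\<not> shortcut c x M Q"
proof (induction "cnt x Q" arbitrary: M Q rule: less_induct)
  case less
  then show ?case using shortcut_improve[OF w min] by blast
qed

text \<open>Let \<open>p\<close> be a shortest path in \<open>D\<close> from the interior
  \<open>t\<close> of the sector to the rest of the rim, with last vertex \<open>v\<close>. As
  \<open>c\<close> is proper, the rim neighbours of \<open>v\<close> lie in one sector, so
  \<open>set p \<union> set t\<close> touches the rim without \<open>t\<close> only at its ends and
  in that sector. \<open>split_gap\<close> then produces a shortcut.\<close>

lemma not_bad:
  assumes w: "is_wheel c x" "proper c x" and xV: "x \<in> V"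
    and min: "\<And>c' x'. is_wheel c' x' \<Longrightarrow> proper c' x' \<Longrightarrow> cnt x c \<le> cnt x' c'"
  shows "\<not> bad c x"
proof
  assume "bad c x"
  then obtain y t y' D z1 z2 where Y: "csec (set c) x (y # t @ [y'])" "\<forall>z\<in>set t. \<not> E x z" and D: "conn D" "D \<subseteq> V - set c" "x \<notin> D" "\<forall>d\<in>D. \<not> E x d"
    and z1: "z1 \<in> set t" "touches D z1" and z2: "z2 \<in> set c - set (y # t @ [y'])" "touches D z2" unfolding bad_def by blast
  let ?Y = "y # t @ [y']"
  have c: "ihole c" "x \<notin> set c" using w by (auto simp: is_wheel_def)
  have ipY: "ipath ?Y" "set ?Y \<subseteq> set c" and xy: "E x y" "E x y'" using Y(1) by (auto simp: csec_def)
  obtain d1 where d1: "d1 \<in> D" "E d1 z1" using z1 by (auto simp: touches_def)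
  obtain d2 where d2: "d2 \<in> D" "E d2 z2" using z2 by (auto simp: touches_def)
  have e1: "\<exists>z\<in>set t. E d1 z" and e2: "\<exists>z\<in>set c - set ?Y. E d2 z" using d1 d2 z1 z2 by blast+
  obtain p where p: "p \<noteq> []" "ipath p" "set p \<subseteq> D" "\<exists>z\<in>set t. E (hd p) z" "\<exists>z\<in>set c - set ?Y. E (last p) z"
    "\<And>u. u \<in> set p \<Longrightarrow> \<exists>z\<in>set t. E u z \<Longrightarrow> u = hd p"
    "\<And>u. u \<in> set p \<Longrightarrow> \<exists>z\<in>set c - set ?Y. E u z \<Longrightarrow> u = last p"
    by (rule conn_path[of D d1 "\<lambda>u. \<exists>z\<in>set t. E u z" d2 "\<lambda>u. \<exists>z\<in>set c - set ?Y. E u z", OF D(1) d1(1) e1 d2(1) e2]) blast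
  define v where "v = last p"
  obtain z0 where z0: "z0 \<in> set c - set ?Y" "E v z0" using p(5) v_def by blast
  have vp: "v \<in> set p" using p(1) v_def by simp
  have v: "v \<in> V" "v \<notin> set c" "v \<noteq> x" "\<not> E x v" using vp p(3) D by auto
  obtain Y2 where Y2: "csec (set c) x Y2" "\<And>z. z \<in> set c \<Longrightarrow> E v z \<Longrightarrow> z \<in> set Y2"
    using w(2) v unfolding proper_def by blast
  have z0Y2: "z0 \<in> set Y2" using Y2(2) z0 by blast
  \<comment> \<open>A common vertex would put \<open>Y2\<close> inside \<open>?Y\<close> by
    \<open>csec_sub\<close>, although \<open>Y2\<close> contains \<open>z0\<close>.\<close>
  have tY2: "set t \<inter> set Y2 = {}"
  proof (rule ccontr)
    assume "set t \<inter> set Y2 \<noteq> {}"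
    then obtain q where "q \<in> set t" "q \<in> set Y2" by blast
    from csec_sub[OF c(1) ipY xy Y2(1) this] show False using z0 z0Y2 by blast
  qed
  obtain r where r: "r \<noteq> []" "ihole (?Y @ r)" "set (?Y @ r) = set c" using ihole_extend[OF c(1) ipY(1) _ ipY(2)] by blast
  \<comment> \<open>The rim without the interior of the sector, taken the long way round. It keeps
    all spokes of \<open>c\<close>, so it is not yet a shortcut; only \<open>split_gap\<close>
    lowers the count.\<close>
  let ?Q = "y' # r @ [y]"
  have tne: "t \<noteq> []" using z1 by auto
  have h: "ihole (t @ ?Q)" using ihole_rotate[of "[y]" "t @ [y'] @ r"] r(2) by simp
  have ipQ: "ipath ?Q" and ipt: "ipath t" using ihole_ipath[OF h tne] by simp_all
  have dis: "distinct (t @ ?Q)" using ihole_distinct[OF h] .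
  have setc: "set c = set t \<union> set ?Q" using r(3) by auto
  have rc: "set r = set c - set ?Y" using r(3) ihole_distinct[OF r(2)] by auto
  have cross: "w = y' \<or> w = y" if "u \<in> set t" "w \<in> set ?Q" "E u w" for u w
    using ihole_cross[OF h tne _ that] by auto
  have Ety: "E (hd t) y" "E (last t) y'"
  proof -
    have "\<forall>u\<in>set t. \<forall>w\<in>set ?Q. E u w \<longleftrightarrow> (u = last t \<and> w = hd ?Q) \<or> (u = hd t \<and> w = last ?Q)"
      using h unfolding ihole_append[OF tne, of ?Q, simplified] by simp
    then show "E (hd t) y" "E (last t) y'" using tne by auto
  qed
  have Y2Q: "set Y2 \<subseteq> set ?Q" using Y2(1) tY2 setc unfolding csec_def by blast
  obtain \<alpha> y2 t2 y2' \<beta> where Yd: "?Q = \<alpha> @ (y2 # t2 @ [y2']) @ \<beta>" "set (y2 # t2 @ [y2']) = set Y2" "E x y2" "E x y2'" "\<And>z. z \<in> set t2 \<Longrightarrow> \<not> E x z"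
    by (rule csec_in_ipath[OF ipQ Y2(1) Y2Q]) blast
  let ?M = "set p \<union> set t"
  obtain zt where zt: "zt \<in> set t" "E (hd p) zt" using p(4) by blast
  have conM: "conn ?M"
    using conn_UnI[OF conn_ipath[OF p(2,1)] conn_ipath[OF ipt tne], of "hd p" zt] p(1) zt by simp
  have MQ: "?M \<inter> set ?Q = {}" using p(3) D(2) setc dis by auto
  have cQ: "cnt x ?Q = cnt x c"
  proof -
    have "cnt x (t @ ?Q) = cnt x c" by (rule cnt_set_eq[OF dis ihole_distinct[OF c(1)]]) (simp add: setc)
    moreover have "cnt x t = 0" using Y(2) cnt_0_iff by blast
    ultimately show ?thesis by simp
  qed
  have "z0 \<in> set r" using z0(1) rc by blast
  then obtain r1 r2 where rr: "r = r1 @ z0 # r2" by (meson split_list)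
  have ex: "\<exists>Q' \<rho>' \<sigma>'. ?Q = \<rho>' @ Q' @ \<sigma>' \<and> 4 \<le> cnt x Q' \<and> cnt x Q' < cnt x ?Q
     \<and> (\<forall>z\<in>set Q'. touches ?M z \<longleftrightarrow> z = hd Q' \<or> z = last Q')"
  proof (rule split_gap[OF ipQ _ Yd(1) refl Yd(3,4,5) conM MQ])
    show "x \<notin> set ?Q" using c(2) setc by simp
    show "x \<notin> ?M" using p(3) D(3) c(2) setc by auto
    show "\<not> E x m" if "m \<in> ?M" for m using that p(3) D(4) Y(2) by auto
    show "touches ?M (hd ?Q)" using Ety tne by (auto simp: touches_def)
    show "touches ?M (last ?Q)" using Ety tne by (auto simp: touches_def)
    show "v \<in> ?M" using vp by simp
    show "z = hd ?Q \<or> z = last ?Q \<or> (m = v \<and> z \<in> set (y2 # t2 @ [y2']))" if mz: "m \<in> ?M" "z \<in> set ?Q" "E m z" for m z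
    proof (cases "m \<in> set t")
      case True
      then show ?thesis using cross[OF True mz(2,3)] by auto
    next
      case False
      then have mp: "m \<in> set p" using mz by blast
      show ?thesis
      proof (cases "z \<in> set r")
        case True
        then have "m = v" using p(7)[OF mp] mz(3) rc v_def by blast
        then show ?thesis using Y2(2)[of z] mz setc Yd(2) by auto
      qed (use mz in auto)
    qed
    show "4 \<le> cnt x ?Q" using cQ wheel_4[OF w(1)] by simp
    show "?Q = (y' # r1) @ z0 # (r2 @ [y])" using rr by simp
    show "E v z0" by (rule z0(2))
    show "cnt x (y' # r1) \<noteq> 0" "cnt x (r2 @ [y]) \<noteq> 0" using xy by simp_all
  qed
  then obtain Q' \<rho>' \<sigma>' where Q': "?Q = \<rho>' @ Q' @ \<sigma>'" "4 \<le> cnt x Q'" "cnt x Q' < cnt x ?Q"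
     "\<forall>z\<in>set Q'. touches ?M z \<longleftrightarrow> z = hd Q' \<or> z = last Q'" by blast
  have "ipath Q'" using ipQ Q'(1) ipath_appendD by metis
  moreover have s: "set Q' \<subseteq> set ?Q" using Q'(1) by (metis Un_iff set_append subsetI)
  moreover have "?M \<subseteq> V" 
  proof -
    have "set t \<subseteq> V" using ipath_V[OF ipY(1)] by auto
    then show ?thesis using p(3) D(2) by auto
  qed
  moreover have "\<forall>m\<in>?M. \<not> E x m" "x \<notin> ?M" using Y(2) p(3) D c(2) setc by auto
  ultimately have "shortcut c x ?M Q'"
    unfolding shortcut_def using Q' cQ setc conM MQ by (intro conjI) auto
  then show False using no_shortcut[OF w xV min] by blast
qed

section \<open>Properness of a wheel with shortest rim and then fewest spokes\<close>

lemma csecI: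
  assumes "ihole ((y # t @ [y']) @ r)" "r \<noteq> []" "set ((y # t @ [y']) @ r) = S" "E x y" "E x y'" "cnt x t = 0"
  shows "csec S x (y # t @ [y'])"
proof -
  have "ipath (y # t @ [y'])" using ihole_ipath[OF assms(1) _ assms(2)] by simp
  then show ?thesis using assms(3-6) unfolding csec_def cnt_0_iff by auto
qed

text \<open>If \<open>z\<close> is a spoke end, run to the next one; otherwise the nearest spoke
  ends on both sides of \<open>z\<close> bound the sector. A third spoke keeps the sector from
  exhausting the rim.\<close>

lemma csec_exists:
  assumes c: "ihole c" "3 \<le> cnt x c" and z: "z \<in> set c"
  shows "\<exists>Y. csec (set c) x Y \<and> z \<in> set Y"
proof -
  obtain p where p: "ihole (z # p)" "set (z # p) = set c" using ihole_start[OF c(1) z] by blast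
  have cp: "cnt x (z # p) = cnt x c"
    by (rule cnt_set_eq[OF ihole_distinct[OF p(1)] ihole_distinct[OF c(1)] p(2)])
  show ?thesis
  proof (cases "E x z")
    case True
    then have "2 \<le> cnt x p" using cp c(2) by simp
    then have "\<exists>z\<in>set p. E x z" using cnt_0_iff[of x p] by auto
    from split_list_first_prop[OF this] obtain A y B where A: "p = A @ y # B" "E x y" "\<forall>z\<in>set A. \<not> E x z" by blast
    have A0: "cnt x A = 0" using A(3) cnt_0_iff by blast
    then have "cnt x B \<noteq> 0" using \<open>2 \<le> cnt x p\<close> A by simp
    then have "B \<noteq> []" by auto
    have eq: "(z # A @ [y]) @ B = z # p" using A(1) by simp
    have "csec (set c) x (z # A @ [y])"
    proof (rule csecI)
      show "ihole ((z # A @ [y]) @ B)" "set ((z # A @ [y]) @ B) = set c" using p unfolding eq by blast+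
    qed fact+
    then show ?thesis by (intro exI conjI) auto
  next
    case False
    then have "2 \<le> cnt x p" using cp c(2) by simp
    then obtain Qa ya Qm yb Qb where Qd: "p = Qa @ ya # Qm @ yb # Qb" "E x ya" "E x yb" "cnt x Qa = 0" "cnt x Qb = 0"
      by (rule first_last_spoke)
    have "cnt x Qm \<noteq> 0" using Qd False cp c(2) by simp
    then have ne: "Qm \<noteq> []" by auto
    have eq: "(z # Qa @ ya # Qm) @ (yb # Qb) = z # p" using Qd(1) by simp
    have "ihole ((yb # Qb) @ (z # Qa @ ya # Qm))" by (rule ihole_rotate) (simp only: eq p(1))
    moreover have e2: "(yb # Qb) @ (z # Qa @ ya # Qm) = (yb # (Qb @ z # Qa) @ [ya]) @ Qm" by simp
    ultimately have h: "ihole ((yb # (Qb @ z # Qa) @ [ya]) @ Qm)" by (simp only:)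
    have "set ((yb # (Qb @ z # Qa) @ [ya]) @ Qm) = set (z # p)" unfolding Qd(1) by auto
    then have "csec (set c) x (yb # (Qb @ z # Qa) @ [ya])"
      using csecI[OF h ne] p(2) Qd False by simp
    then show ?thesis by (intro exI conjI) auto
  qed
qed

lemma cnt_1_unique: "cnt x Q = 1 \<Longrightarrow> distinct Q \<Longrightarrow> a \<in> set Q \<Longrightarrow> b \<in> set Q \<Longrightarrow> E x a \<Longrightarrow> E x b \<Longrightarrow> a = b"
proof -
  assume a: "cnt x Q = 1" "distinct Q" "a \<in> set Q" "b \<in> set Q" "E x a" "E x b"
  have "card {v \<in> set Q. E x v} = 1" using a(1) cnt_card[OF a(2), of x] by simp
  then obtain w where "{v \<in> set Q. E x v} = {w}" by (meson card_1_singletonE)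
  moreover have "a \<in> {v \<in> set Q. E x v}" "b \<in> {v \<in> set Q. E x v}" using a by auto
  ultimately show "a = b" by (metis singletonD)
qed

text \<open>\<open>v\<close> violates properness of a doubly minimal wheel and stays fixed up to
  \<open>min_contradiction\<close>.\<close>

context
  fixes c x v
  assumes w: "is_wheel c x" and v: "v \<notin> set c" "v \<noteq> x" "\<not> E x v"
    and min: "\<And>c' x'. is_wheel c' x' \<Longrightarrow> length c \<le> length c' \<and> (length c' = length c \<longrightarrow> cnt x c \<le> cnt x' c')"
    and no: "\<And>Y. csec (set c) x Y \<Longrightarrow> \<exists>z\<in>set c. E v z \<and> z \<notin> set Y"
begin

lemma c_hole: "ihole c" and x_c: "x \<notin> set c" and c_4: "4 \<le> cnt x c"
  using w wheel_4 by (auto simp: is_wheel_def)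

text \<open>\<open>v\<close> closes \<open>Q\<close> to a hole. With 4 or more spokes this is a
  wheel whose comparison with \<open>c\<close> leaves one spokeless vertex outside \<open>Q\<close>,
  and a sector through it contains all neighbours of \<open>v\<close>. With exactly 2, a piece of
  the rest \<open>r\<close> of the rim links \<open>x\<close> to an end of \<open>Q\<close> or to
  \<open>v\<close>, unless \<open>Q\<close> is itself a sector.\<close>

lemma gap_le_1:
  assumes Q: "ipath Q" "set Q \<subseteq> set c" "3 \<le> length Q" and t: "\<And>z. z \<in> set Q \<Longrightarrow> E v z \<longleftrightarrow> z = hd Q \<or> z = last Q"
  shows "cnt x Q \<le> 1"
proof (rule ccontr)
  assume "\<not> cnt x Q \<le> 1"
  then have c2: "2 \<le> cnt x Q" by simp
  have ne: "Q \<noteq> []" using Q(3) by auto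
  have vQ: "v \<notin> set Q" using v Q by blast
  have H: "ihole (Q @ [v])"
  proof -
    have "E u v \<longleftrightarrow> u = last Q \<or> u = hd Q" if "u \<in> set Q" for u using t[OF that] sym_iff[of u v] by blast
    then show ?thesis unfolding ihole_append[OF ne, of "[v]", simplified] using Q vQ by auto
  qed
  have xH: "x \<notin> set (Q @ [v])" using x_c Q(2) v by auto
  have cH: "cnt x (Q @ [v]) = cnt x Q" using v by simp
  obtain r where r: "r \<noteq> []" "ihole (Q @ r)" "set (Q @ r) = set c" using ihole_extend[OF c_hole Q(1) ne Q(2)] by blast
  have lc: "length c = length Q + length r" using ihole_card[OF r(2)] ihole_card[OF c_hole] r(3) by simp
  have cc: "cnt x c = cnt x Q + cnt x r"
    using cnt_set_eq[OF ihole_distinct[OF r(2)] ihole_distinct[OF c_hole] r(3), of x] by simp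
  have hl: "hd Q \<in> set Q" "last Q \<in> set Q" "hd r \<in> set r" "last r \<in> set r" using ne r(1) by auto
  have vhl: "E v (hd Q)" "E v (last Q)" using t hl by blast+
  have crossI: "E (last Q) (hd r)" "E (hd Q) (last r)"
    using r(2) hl unfolding ihole_append[OF ne r(1)] by blast+
  note cross = ihole_cross[OF r(2) ne r(1)]
  have dr: "distinct (Q @ r)" using ihole_distinct[OF r(2)] .
  have ipr: "ipath r" using ihole_ipath[OF r(2) ne r(1)] by blast
  have nvr: "\<not> E v (hd r)" "\<not> E v (last r)"
    using no_triangle[OF vhl(2) crossI(1)] no_triangle[OF vhl(1) crossI(2)] by blast+
  show False
  proof (cases "cnt x Q = 2")
    case False
    moreover have "cnt x Q \<noteq> 3" using no_three_spokes[OF H xH] cH by auto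
    ultimately have c4: "4 \<le> cnt x Q" using c2 by linarith
    have "is_wheel (Q @ [v]) x" using H xH cH c4 by (simp add: is_wheel_def)
    from min[OF this] have m: "length c \<le> length Q + 1" "length Q + 1 = length c \<longrightarrow> cnt x c \<le> cnt x Q" using cH by auto
    have "length r \<noteq> 0" using r(1) by simp
    \<comment> \<open>By minimality the new rim merely exchanges one vertex \<open>s\<close> for
      \<open>v\<close>, and \<open>s\<close> is no spoke end. The sector through \<open>s\<close>
      contains both ends of \<open>Q\<close>.\<close>
    then have r1: "length r = 1" using m(1) lc by linarith
    then obtain s where s: "r = [s]" by (cases r) auto
    have "cnt x r = 0" using m(2) lc r1 cc by simp
    then have xs: "\<not> E x s" using s by (simp split: if_splits)
    obtain Qa ya Qm yb Qb where Qd: "Q = Qa @ ya # Qm @ yb # Qb" "E x ya" "E x yb" "cnt x Qa = 0" "cnt x Qb = 0"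
      using c2 by (rule first_last_spoke)
    have "cnt x Qm \<noteq> 0" using Qd c4 by simp
    then have Qmne: "Qm \<noteq> []" by auto
    have eq: "(Qa @ ya # Qm) @ (yb # Qb @ [s]) = Q @ r" using Qd(1) s by simp
    have "ihole ((yb # Qb @ [s]) @ (Qa @ ya # Qm))" by (rule ihole_rotate) (simp only: eq r(2))
    then have h: "ihole ((yb # (Qb @ s # Qa) @ [ya]) @ Qm)" by simp
    have "set ((yb # (Qb @ s # Qa) @ [ya]) @ Qm) = set c" unfolding r(3)[symmetric] Qd(1) s by auto
    then have "csec (set c) x (yb # (Qb @ s # Qa) @ [ya])" using csecI[OF h Qmne] Qd xs by simp
    from no[OF this] obtain z where z: "z \<in> set c" "E v z" "z \<notin> set (yb # (Qb @ s # Qa) @ [ya])" by blast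
    have "z \<noteq> s" using z by auto
    then have "z \<in> set Q" using z(1) r(3) s by auto
    then have "z = hd Q \<or> z = last Q" using t z(2) by blast
    moreover have "hd Q \<in> set (Qa @ [ya])" using Qd(1) by (cases Qa) auto
    moreover have "last Q \<in> set (yb # Qb)" using Qd(1) by (cases Qb rule: rev_cases) auto
    ultimately show False using z(3) by auto
  next
    case True
    then have cH2: "cnt x (Q @ [v]) = 2" using cH by simp
    \<comment> \<open>Of at least four spokes only two are on \<open>Q\<close>; the others make
      pieces of \<open>r\<close> usable as links.\<close>
    have cr: "2 \<le> cnt x r" using cc True c_4 by linarith
    have "2 \<le> length r" using cr length_filter_le[of "E x" r] unfolding cnt_def by linarith
    then obtain b1 rm b2 where rd: "r = b1 # rm @ [b2]"
      by (cases r; cases "tl r" rule: rev_cases) auto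
    have b: "hd r = b1" "last r = b2" using rd by auto
    have vx: "\<not> E x v" using v by blast
    have out: "D \<inter> set (Q @ [v]) = {}" "x \<notin> D" if "D \<subseteq> set r" for D
      using that dr v(1) r(3) x_c by auto
    have cr': "u = last Q \<and> z = b1 \<or> u = hd Q \<and> z = b2" if "u \<in> set Q" "z \<in> set r" "E z u" for u z
      using cross[OF that(1,2) sym[OF that(3)]] b by blast
    have b12: "b1 \<noteq> b2" "b1 \<notin> set rm" "b2 \<notin> set rm" using dr rd by auto
    have ip_parts: "ipath (b1 # rm)" "ipath (rm @ [b2])" "ipath rm"
      using ipr ipath_appendD(1)[of "b1 # rm" "[b2]"] ipath_appendD(2)[of "[b1]" "rm @ [b2]"] ipath_appendD(1)[of rm "[b2]"] unfolding rd by auto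
    show False
    proof (cases "\<exists>z\<in>set r. E v z")
      case False
      show False
      proof (cases "E x (last Q)")
        \<comment> \<open>Without its last vertex \<open>b2\<close>, the path \<open>r\<close>
          touches the hole at \<open>last Q\<close> only and still contains a spoke end.\<close>
        case l: False
        show False
        proof (rule no_two_spokes_link[OF H xH cH2, of "set (b1 # rm)" "last Q"])
          show "conn (set (b1 # rm))" using conn_ipath[OF ip_parts(1)] by simp
          show "touches (set (b1 # rm)) x"
          proof -
            have "cnt x (b1 # rm) \<noteq> 0" using cr rd by (auto split: if_splits)
            then show ?thesis unfolding cnt_0_iff touches_sym by blast
          qed
          show "touches (set (b1 # rm)) u \<longleftrightarrow> u = last Q" if "u \<in> set (Q @ [v])" for u
          proof
            assume "touches (set (b1 # rm)) u"
            then obtain z where z: "z \<in> set (b1 # rm)" "E z u" unfolding touches_def by blast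
            have zr: "z \<in> set r" using z(1) rd by auto
            have "u \<noteq> v" using False zr sym[OF z(2)] by blast
            then have "u \<in> set Q" using that by auto
            from cr'[OF this zr z(2)] show "u = last Q" using z(1) b12 by auto
          next
            assume "u = last Q"
            then show "touches (set (b1 # rm)) u" unfolding touches_sym using crossI(1) b by auto
          qed
          show "set (b1 # rm) \<inter> set (Q @ [v]) = {}" "x \<notin> set (b1 # rm)" using out[of "set (b1 # rm)"] rd by auto
        qed (use hl l in auto)
      next
        case l: True
        show False
        proof (cases "E x (hd Q)")
          case f: False
          show False
          proof (rule no_two_spokes_link[OF H xH cH2, of "set (rm @ [b2])" "hd Q"])
            show "conn (set (rm @ [b2]))" using conn_ipath[OF ip_parts(2)] by simp
            show "touches (set (rm @ [b2])) x"
            proof -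
              have "cnt x (rm @ [b2]) \<noteq> 0" using cr rd by (auto split: if_splits)
              then show ?thesis unfolding cnt_0_iff touches_sym by blast
            qed
            show "touches (set (rm @ [b2])) u \<longleftrightarrow> u = hd Q" if "u \<in> set (Q @ [v])" for u
            proof
              assume "touches (set (rm @ [b2])) u"
              then obtain z where z: "z \<in> set (rm @ [b2])" "E z u" unfolding touches_def by blast
              have zr: "z \<in> set r" using z(1) rd by auto
              have "u \<noteq> v" using False zr sym[OF z(2)] by blast
              then have "u \<in> set Q" using that by auto
              from cr'[OF this zr z(2)] show "u = hd Q" using z(1) b12 by auto
            next
              assume "u = hd Q"
              then show "touches (set (rm @ [b2])) u" unfolding touches_sym using crossI(2) b by auto
            qed
            show "set (rm @ [b2]) \<inter> set (Q @ [v]) = {}" "x \<notin> set (rm @ [b2])" using out[of "set (rm @ [b2])"] rd by auto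
          qed (use hl f in auto)
        next
          \<comment> \<open>Both ends of \<open>Q\<close> are spoke ends, and there is no other on
            \<open>Q\<close>; so \<open>Q\<close> is a sector containing all neighbours of
            \<open>v\<close>, contrary to \<open>no\<close>.\<close>
          case f: True
          obtain q1 qm q2 where qd: "Q = q1 # qm @ [q2]" using Q(3) by (cases Q; cases "tl Q" rule: rev_cases) auto
          have "cnt x qm = 0" using True l f qd by simp
          then have "csec (set c) x Q" using csecI[of q1 qm q2 r "set c" x] r l f qd by simp
          from no[OF this] show False using r(3) False by auto
        qed
      qed
    next
      case True
      then obtain z where z: "z \<in> set r" "E v z" by blast
      have zm: "z \<in> set rm" using z rd nvr b by auto
      show False
      proof (cases "E x b1")
        \<comment> \<open>The single vertex \<open>b1\<close> is the link: on the hole it sees only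
          \<open>last Q\<close>, since an edge to \<open>v\<close> would close a triangle.\<close>
        case x1: True
        have nl: "\<not> E x (last Q)" using no_triangle[OF x1, of "last Q"] sym[OF crossI(1)] b by auto
        show False
        proof (rule no_two_spokes_link[OF H xH cH2, of "{b1}" "last Q"])
          show "touches {b1} x" using x1 by (simp add: touches_sym)
          show "touches {b1} u \<longleftrightarrow> u = last Q" if "u \<in> set (Q @ [v])" for u
          proof
            assume "touches {b1} u"
            then have e: "E b1 u" by (simp add: touches_def)
            have "u \<noteq> v" using nvr(1) b sym[OF e] by auto
            then have "u \<in> set Q" using that by auto
            from cr'[OF this _ e] show "u = last Q" using b12 rd by auto
          next
            assume "u = last Q"
            then show "touches {b1} u" unfolding touches_sym using crossI(1) b by auto
          qed
          show "{b1} \<inter> set (Q @ [v]) = {}" "x \<notin> {b1}" using out[of "{b1}"] rd by auto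
        qed (use hl nl in auto)
      next
        case x1: False
        show False
        proof (cases "E x b2")
          case x2: True
          have nl: "\<not> E x (hd Q)" using no_triangle[OF x2, of "hd Q"] sym[OF crossI(2)] b by auto
          show False
          proof (rule no_two_spokes_link[OF H xH cH2, of "{b2}" "hd Q"])
            show "touches {b2} x" using x2 by (simp add: touches_sym)
            show "touches {b2} u \<longleftrightarrow> u = hd Q" if "u \<in> set (Q @ [v])" for u
            proof
              assume "touches {b2} u"
              then have e: "E b2 u" by (simp add: touches_def)
              have "u \<noteq> v" using nvr(2) b sym[OF e] by auto
              then have "u \<in> set Q" using that by auto
              from cr'[OF this _ e] show "u = hd Q" using b12 rd by auto
            next
              assume "u = hd Q"
              then show "touches {b2} u" unfolding touches_sym using crossI(2) b by auto
            qed
            show "{b2} \<inter> set (Q @ [v]) = {}" "x \<notin> {b2}" using out[of "{b2}"] rd by auto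
          qed (use hl nl in auto)
        next
          \<comment> \<open>No end of \<open>r\<close> is a spoke end, so the inner part
            \<open>rm\<close> contains spoke ends. It also has a neighbour of \<open>v\<close> and
            sees no vertex of \<open>Q\<close>, so it links \<open>x\<close> to
            \<open>v\<close>.\<close>
          case x2: False
          show False
          proof (rule no_two_spokes_link[OF H xH cH2, of "set rm" v])
            have "rm \<noteq> []" using zm by auto
            then show "conn (set rm)" using conn_ipath[OF ip_parts(3)] by simp
            show "touches (set rm) x"
            proof -
              have "cnt x rm \<noteq> 0" using cr rd x1 x2 by auto
              then show ?thesis unfolding cnt_0_iff touches_sym by blast
            qed
            show "touches (set rm) u \<longleftrightarrow> u = v" if "u \<in> set (Q @ [v])" for u
            proof
              assume "touches (set rm) u"
              then obtain z where z: "z \<in> set rm" "E z u" unfolding touches_def by blast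
              have zr: "z \<in> set r" using z(1) rd by auto
              show "u = v"
              proof (rule ccontr)
                assume "u \<noteq> v"
                then have "u \<in> set Q" using that by auto
                from cr'[OF this zr z(2)] show False using z(1) b12 by auto
              qed
            next
              assume "u = v"
              then show "touches (set rm) u" unfolding touches_sym using zm z(2) by auto
            qed
            show "set rm \<inter> set (Q @ [v]) = {}" "x \<notin> set rm" using out[of "set rm"] rd by auto
          qed (use vx in auto)
        qed
      qed
    qed
  qed
qed

text \<open>If \<open>v\<close> misses the interior \<open>t\<close>, the arc through
  \<open>t\<close> between two neighbours of \<open>v\<close> contains the whole sector with both
  its spoke ends, against \<open>gap_le_1\<close>.\<close>

lemma sector_touched:
  assumes Y: "csec (set c) x (y # t @ [y'])" "cnt x t = 0"
  shows "\<exists>z\<in>set t. E v z"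
proof (rule ccontr)
  assume nt: "\<not> ?thesis"
  let ?Y = "y # t @ [y']"
  have ipY: "ipath ?Y" "set ?Y \<subseteq> set c" using Y by (auto simp: csec_def)
  have xy: "E x y" "E x y'"
  proof -
    obtain a s b where "?Y = a # s @ [b]" "E x a" "E x b" using Y(1) unfolding csec_def by blast
    then show "E x y" "E x y'" by auto
  qed
  have tne: "t \<noteq> []" using ipY(1) no_triangle[OF xy(1), of y'] xy(2) by auto
  obtain r where r: "r \<noteq> []" "ihole (?Y @ r)" "set (?Y @ r) = set c" using ihole_extend[OF c_hole ipY(1) _ ipY(2)] by blast
  let ?Q = "y' # r @ [y]"
  have h: "ihole (t @ ?Q)" using ihole_rotate[of "[y]" "t @ [y'] @ r"] r(2) by simp
  have dQ: "distinct (t @ ?Q)" using ihole_distinct[OF h] .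
  have setc: "set c = set t \<union> set ?Q" using r(3) by auto
  obtain z where z: "z \<in> set c" "E v z" using no[OF Y(1)] by blast
  have zQ: "u \<in> set ?Q" if "u \<in> set c" "E v u" for u using that nt setc by auto
  have ex: "\<exists>u\<in>set ?Q. E v u" using zQ z by blast
  from split_list_first_prop[OF ex] obtain A q1 B1 where A: "?Q = A @ q1 # B1" "E v q1" "\<forall>u\<in>set A. \<not> E v u" by blast
  from split_list_last_prop[OF ex] obtain B2 q2 C where C: "?Q = B2 @ q2 # C" "E v q2" "\<forall>u\<in>set C. \<not> E v u" by blast
  \<comment> \<open>A single neighbour would lie in some sector, contrary to the choice of
    \<open>v\<close>.\<close>
  have q12: "q1 \<noteq> q2"
  proof
    assume eq: "q1 = q2"
    have dQ': "distinct (A @ q1 # B1)" using dQ A(1) by simp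
    have "B1 = C" using distinct_split_unique(2)[OF dQ'] A(1) C(1) eq by metis
    then have only: "u = q1" if "u \<in> set c" "E v u" for u using zQ[OF that] that A C by auto
    have "q1 \<in> set c" using setc A(1) by (metis Un_iff in_set_conv_decomp)
    then obtain Y' where "csec (set c) x Y'" "q1 \<in> set Y'" using csec_exists[OF c_hole, of x q1] c_4 by auto
    then show False using no only by blast
  qed
  have "q2 \<in> set B1"
  proof -
    have "q2 \<in> set (A @ q1 # B1)" using A(1) C(1) by (metis in_set_conv_decomp)
    then show ?thesis using q12 A(3) C(2) by auto
  qed
  then obtain B C' where B: "B1 = B @ q2 # C'" by (meson split_list)
  have e1: "?Q = (A @ q1 # B) @ q2 # C'" using A(1) B by simp
  have dQ2: "distinct (B2 @ q2 # C)" using dQ C(1) by simp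
  have "C = C'" using distinct_split_unique(2)[OF dQ2] C(1) e1 by metis
  then have Qs: "?Q = A @ q1 # B @ q2 # C" using A(1) B by simp
  have eq: "(t @ A @ q1 # B) @ (q2 # C) = t @ ?Q" unfolding Qs by simp
  have "ihole ((q2 # C) @ (t @ A @ q1 # B))" by (rule ihole_rotate) (simp only: eq h)
  then have hQ: "ihole ((q2 # C @ t @ A @ [q1]) @ B)" by simp
  have Bne: "B \<noteq> []"
  proof
    assume "B = []"
    then have "ipath (A @ q1 # q2 # C)" using ihole_ipath[OF h tne] Qs by simp
    from ipath_adj[OF this] show False using no_triangle[OF A(2), of q2] C(2) by blast
  qed
  let ?G = "q2 # C @ t @ A @ [q1]"
  have "cnt x ?G \<le> 1"
  proof (rule gap_le_1)
    show "ipath ?G" using ihole_ipath[OF hQ _ Bne] by simp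
    show "set ?G \<subseteq> set c"
    proof -
      have "set ?G \<subseteq> set (t @ ?Q)" unfolding Qs by auto
      then show ?thesis using setc by auto
    qed
    show "3 \<le> length ?G" using tne by (cases t) auto
    show "E v u \<longleftrightarrow> u = hd ?G \<or> u = last ?G" if "u \<in> set ?G" for u
      using that A(2,3) C(2,3) nt by auto
  qed
  moreover have "y' \<in> set (A @ [q1])" using A(1) by (cases A) auto
  then have "cnt x (A @ [q1]) \<noteq> 0" using cnt_pos xy(2) by blast
  moreover have "y \<in> set (q2 # C)"
  proof -
    have "last (q2 # C) \<in> set (q2 # C)" by (rule last_in_set) simp
    moreover have "y = last (q2 # C)" using arg_cong[OF Qs, of last] by simp
    ultimately show ?thesis by (simp only:)
  qed
  then have "cnt x (q2 # C) \<noteq> 0" using cnt_pos xy(1) by blast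
  moreover have "cnt x ?G = cnt x (q2 # C) + cnt x t + cnt x (A @ [q1])" by simp
  ultimately show False by linarith
qed

text \<open>The hub closes the sector to a hole \<open>x # ?Y\<close>. Three neighbours of
  \<open>v\<close> on it would make a wheel with hub \<open>v\<close> and a shorter rim. With two,
  the rest of the rim without its end vertices links \<open>v\<close> to \<open>x\<close>, because
  \<open>v\<close> touches the interior of a second sector there. None is excluded by
  \<open>sector_touched\<close>.\<close>

lemma sector_count:
  assumes Y: "csec (set c) x (y # t @ [y'])" "cnt x t = 0"
  shows "cnt v (y # t @ [y']) = 1"
proof -
  let ?Y = "y # t @ [y']"
  have ipY: "ipath ?Y" "set ?Y \<subseteq> set c" using Y by (auto simp: csec_def)
  have xy: "E x y" "E x y'"
  proof -
    obtain a s b where "?Y = a # s @ [b]" "E x a" "E x b" using Y(1) unfolding csec_def by blast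
    then show "E x y" "E x y'" by auto
  qed
  have tne: "t \<noteq> []" using ipY(1) no_triangle[OF xy(1), of y'] xy(2) by auto
  obtain r where r: "r \<noteq> []" "ihole (?Y @ r)" "set (?Y @ r) = set c" using ihole_extend[OF c_hole ipY(1) _ ipY(2)] by blast
  have cc: "cnt x c = 2 + cnt x r"
    using cnt_set_eq[OF ihole_distinct[OF r(2)] ihole_distinct[OF c_hole] r(3), of x] xy Y(2) by simp
  have Yne: "?Y \<noteq> []" by simp
  have dr: "distinct (?Y @ r)" using ihole_distinct[OF r(2)] .
  have cr: "2 \<le> cnt x r" using cc c_4 by linarith
  have "2 \<le> length r" using cr length_filter_le[of "E x" r] unfolding cnt_def by linarith
  then obtain b1 rm b2 where rd: "r = b1 # rm @ [b2]" by (cases r; cases "tl r" rule: rev_cases) auto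
  have crossI: "E y' b1" "E y b2"
  proof -
    have "\<forall>u\<in>set ?Y. \<forall>w\<in>set r. E u w \<longleftrightarrow> (u = last ?Y \<and> w = hd r) \<or> (u = hd ?Y \<and> w = last r)"
      using r(2) ihole_append[OF Yne r(1)] by blast
    then show "E y' b1" "E y b2" using rd by auto
  qed
  have xb: "\<not> E x b1" "\<not> E x b2" using no_triangle[OF xy(2) crossI(1)] no_triangle[OF xy(1) crossI(2)] by blast+
  then have crm: "2 \<le> cnt x rm" using cr rd by simp
  then have "\<exists>z\<in>set rm. E x z" using cnt_0_iff[of x rm] by auto
  \<comment> \<open>The first two spoke ends in \<open>rm\<close> bound a second sector, whose
    interior \<open>v\<close> must touch.\<close>
  from split_list_first_prop[OF this] obtain m1 y1 R where m1: "rm = m1 @ y1 # R" "E x y1" "\<forall>z\<in>set m1. \<not> E x z" by blast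
  have "cnt x m1 = 0" using m1(3) cnt_0_iff by blast
  then have "cnt x R \<noteq> 0" using crm m1 by simp
  then have "\<exists>z\<in>set R. E x z" using cnt_0_iff[of x R] by auto
  from split_list_first_prop[OF this] obtain m2 y2 m3 where m2: "R = m2 @ y2 # m3" "E x y2" "\<forall>z\<in>set m2. \<not> E x z" by blast
  have m20: "cnt x m2 = 0" using m2(3) cnt_0_iff by blast
  have eq: "(?Y @ b1 # m1) @ ((y1 # m2 @ [y2]) @ m3 @ [b2]) = ?Y @ r" using rd m1(1) m2(1) by simp
  have "ihole (((y1 # m2 @ [y2]) @ m3 @ [b2]) @ (?Y @ b1 # m1))" by (rule ihole_rotate) (simp only: eq r(2))
  then have h3: "ihole ((y1 # m2 @ [y2]) @ (m3 @ [b2] @ ?Y @ b1 # m1))" by simp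
  have "set ((y1 # m2 @ [y2]) @ (m3 @ [b2] @ ?Y @ b1 # m1)) = set (?Y @ r)" unfolding rd m1(1) m2(1) by auto
  then have "csec (set c) x (y1 # m2 @ [y2])" using csecI[OF h3 _ _ m1(2) m2(2) m20] r(3) by simp
  from sector_touched[OF this m20] obtain z3 where z3: "z3 \<in> set m2" "E v z3" by blast
  have z3m: "z3 \<in> set rm" using z3 m1 m2 by auto
  have K: "ihole (x # ?Y)"
  proof -
    have xY: "x \<notin> set ?Y" using x_c ipY(2) by blast
    have "\<forall>u\<in>set ?Y. E x u \<longleftrightarrow> u = y \<or> u = y'"
      using xy Y(2) unfolding cnt_0_iff by auto
    moreover have "1 \<le> length t" using tne by (cases t) auto
    ultimately show ?thesis using xY ipY(1) unfolding ihole_def by simp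
  qed
  have vK: "v \<notin> set (x # ?Y)" using v ipY(2) by auto
  have cK: "cnt v (x # ?Y) = cnt v ?Y" using v(3) sym_iff[of v x] by simp
  have "\<not> 3 \<le> cnt v ?Y"
  proof
    assume "3 \<le> cnt v ?Y"
    then have "is_wheel (x # ?Y) v" using K vK cK unfolding is_wheel_def by simp
    from min[OF this] have "length c \<le> length ?Y + 1" by simp
    moreover have "length c = length ?Y + length r" using ihole_card[OF r(2)] ihole_card[OF c_hole] r(3) by simp
    ultimately show False using \<open>2 \<le> length r\<close> by simp
  qed
  moreover have "cnt v ?Y \<noteq> 2"
  proof
    assume "cnt v ?Y = 2"
    then have c2: "cnt v (x # ?Y) = 2" using cK by simp
    have ipr: "ipath r" using ihole_ipath[OF r(2) Yne r(1)] by blast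
    have iprm: "ipath rm" using ipath_appendD(2)[of "[b1]" "rm @ [b2]"] ipath_appendD(1)[of rm "[b2]"] ipr rd by simp
    show False
    proof (rule no_two_spokes_link[OF K vK c2, of "set rm" x])
      have "rm \<noteq> []" using z3m by auto
      then show "conn (set rm)" using conn_ipath[OF iprm] by simp
      show "v \<notin> set rm" using v(1) r(3) rd by auto
      show "set rm \<inter> set (x # ?Y) = {}" using dr rd x_c r(3) by auto
      show "touches (set rm) v" using z3m z3(2) by (auto simp: touches_sym)
      show "x \<in> set (x # ?Y)" by simp
      show "\<not> E v x" using v(3) sym[of v x] by blast
      show "touches (set rm) u \<longleftrightarrow> u = x" if "u \<in> set (x # ?Y)" for u
      proof
        assume "touches (set rm) u"
        then obtain z where z: "z \<in> set rm" "E u z" unfolding touches_sym by blast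
        show "u = x"
        proof (rule ccontr)
          assume "u \<noteq> x"
          then have "u \<in> set ?Y" using that by simp
          from ihole_cross[OF r(2) Yne r(1) this _ z(2)] show False using z(1) rd dr by auto
        qed
      next
        assume "u = x"
        then show "touches (set rm) u" unfolding touches_sym using m1 by auto
      qed
    qed
  qed
  moreover have "cnt v ?Y \<noteq> 0"
  proof -
    obtain z where "z \<in> set t" "E v z" using sector_touched[OF Y] by blast
    then show ?thesis using cnt_pos[of z ?Y v] by simp
  qed
  ultimately show ?thesis by linarith
qed

text \<open>Two consecutive sectors share the spoke end \<open>y'\<close>, and \<open>v\<close> has
  one neighbour in the interior of each, \<open>z\<close> and \<open>z'\<close>. The arc from
  \<open>z\<close> to \<open>z'\<close> closed by \<open>v\<close> is a hole on which
  \<open>x\<close> sees \<open>y'\<close>; the outer remainders of the two sectors link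
  \<open>x\<close> to \<open>z\<close> and \<open>z'\<close>, completing a claw with centre
  \<open>x\<close>.\<close>

lemma min_contradiction: False
proof -
  have "c \<noteq> []" using ihole_length[OF c_hole] by auto
  then obtain Y0 where Y0: "csec (set c) x Y0" using csec_exists[OF c_hole, of x "hd c"] c_4 by auto
  then obtain y t y' where Yd: "Y0 = y # t @ [y']" "E x y" "E x y'" "\<forall>z\<in>set t. \<not> E x z" unfolding csec_def by blast
  let ?Y = "y # t @ [y']"
  have Y: "csec (set c) x ?Y" and t0: "cnt x t = 0" using Y0 Yd cnt_0_iff[of x t] by auto
  have ipY: "ipath ?Y" "set ?Y \<subseteq> set c" using Y by (auto simp: csec_def)
  obtain r where r: "r \<noteq> []" "ihole (?Y @ r)" "set (?Y @ r) = set c" using ihole_extend[OF c_hole ipY(1) _ ipY(2)] by blast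
  have cc: "cnt x c = 2 + cnt x r"
    using cnt_set_eq[OF ihole_distinct[OF r(2)] ihole_distinct[OF c_hole] r(3), of x] Yd t0 by simp
  have cr: "2 \<le> cnt x r" using cc c_4 by linarith
  then have "\<exists>z\<in>set r. E x z" using cnt_0_iff[of x r] by auto
  from split_list_first_prop[OF this] obtain t' y'' r' where r': "r = t' @ y'' # r'" "E x y''" "\<forall>z\<in>set t'. \<not> E x z" by blast
  have t'0: "cnt x t' = 0" using r'(3) cnt_0_iff by blast
  then have "cnt x r' \<noteq> 0" using cr r' by simp
  \<comment> \<open>Because of the fourth spoke the two sectors do not exhaust the rim, so together
    they form an induced path.\<close>
  then have r'ne: "r' \<noteq> []" by auto
  have eq: "(y # t) @ ((y' # t' @ [y'']) @ r') = ?Y @ r" using r'(1) by simp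
  have "ihole (((y' # t' @ [y'']) @ r') @ (y # t))" by (rule ihole_rotate) (simp only: eq r(2))
  then have h2: "ihole ((y' # t' @ [y'']) @ (r' @ y # t))" by simp
  have "set ((y' # t' @ [y'']) @ (r' @ y # t)) = set (?Y @ r)" unfolding r'(1) by auto
  then have Y': "csec (set c) x (y' # t' @ [y''])" using csecI[OF h2 _ _ Yd(3) r'(2) t'0] r(3) by simp
  obtain z where z: "z \<in> set t" "E v z" using sector_touched[OF Y t0] by blast
  obtain z' where z': "z' \<in> set t'" "E v z'" using sector_touched[OF Y' t'0] by blast
  have dY: "distinct ?Y" "distinct (y' # t' @ [y''])" using Y Y' ipath_distinct unfolding csec_def by blast+
  have uz: "u = z" if "u \<in> set ?Y" "E v u" for u
    using cnt_1_unique[OF sector_count[OF Y t0] dY(1) that(1) _ that(2), of z] z by simp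
  have uz': "u = z'" if "u \<in> set (y' # t' @ [y''])" "E v u" for u
    using cnt_1_unique[OF sector_count[OF Y' t'0] dY(2) that(1) _ that(2), of z'] z' by simp
  obtain t1 t2 where t: "t = t1 @ z # t2" using z(1) by (meson split_list)
  obtain t1' t2' where t': "t' = t1' @ z' # t2'" using z'(1) by (meson split_list)
  let ?X = "y # t1" and ?Q = "z # t2 @ y' # t1' @ [z']" and ?Z = "t2' @ [y'']"
  have "(?X @ ?Q @ ?Z) @ r' = ?Y @ r" using t t' r'(1) by simp
  then have hh: "ihole ((?X @ ?Q @ ?Z) @ r')" using r(2) by (simp only:)
  have ipA: "ipath (?X @ ?Q @ ?Z)" using ihole_ipath[OF hh _ r'ne] by simp
  have ipX: "ipath ?X" and ipQ: "ipath ?Q" and ipZ: "ipath ?Z"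
    using ipath_appendD(1)[OF ipA] ipath_appendD(1)[OF ipath_appendD(2)[OF ipA]] ipath_appendD(2)[OF ipath_appendD(2)[OF ipA]] by blast+
  have dA: "distinct (?X @ ?Q @ ?Z)" using ipath_distinct[OF ipA] .
  have XQ: "E u u' \<longleftrightarrow> u = last ?X \<and> u' = z" if "u \<in> set ?X" "u' \<in> set (?Q @ ?Z)" for u u'
  proof -
    have X: "\<forall>u\<in>set ?X. \<forall>u'\<in>set (?Q @ ?Z). E u u' \<longleftrightarrow> u = last ?X \<and> u' = hd (?Q @ ?Z)"
      using ipA unfolding ipath_append[of ?X] by blast
    have hq: "hd (?Q @ ?Z) = z" by simp
    show ?thesis using bspec[OF bspec[OF X that(1)] that(2)] unfolding hq .
  qed
  have QZ: "E u u' \<longleftrightarrow> u = z' \<and> u' = hd ?Z" if "u \<in> set ?Q" "u' \<in> set ?Z" for u u'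
  proof -
    have X: "\<forall>u\<in>set ?Q. \<forall>u'\<in>set ?Z. E u u' \<longleftrightarrow> u = last ?Q \<and> u' = hd ?Z"
      using ipath_appendD(2)[OF ipA] unfolding ipath_append[of ?Q] by blast
    have lq: "last ?Q = z'" by simp
    show ?thesis using bspec[OF bspec[OF X that(1)] that(2)] unfolding lq .
  qed
  have sub: "set (?X @ ?Q @ ?Z) \<subseteq> set c" using r(3) t t' r'(1) by auto
  have vy': "\<not> E v y'" using uz[of y'] z(1) dY(1) by auto
  have vQ: "E v u \<longleftrightarrow> u = z \<or> u = z'" if "u \<in> set ?Q" for u
    using that z(2) z'(2) uz[of u] uz'[of u] t t' by auto
  have H: "ihole (?Q @ [v])"
  proof -
    have "E u v \<longleftrightarrow> u = last ?Q \<or> u = hd ?Q" if "u \<in> set ?Q" for u using vQ[OF that] sym_iff[of u v] by auto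
    moreover have "v \<notin> set ?Q" using sub v(1) by auto
    ultimately show ?thesis using ihole_append[of ?Q "[v]"] ipQ by simp
  qed
  have xC: "x \<notin> set (?Q @ [v])" using sub x_c v(2) by auto
  show False
  proof (rule no_claw[OF H xC, of z z' y' "set ?X" "set ?Z" "{}"])
    show "distinct [z, z', y']" using dA by auto
    show "{z, z', y'} \<subseteq> set (?Q @ [v])" by auto
    show "link x (set (?Q @ [v])) (set ?X) z"
      unfolding link_def
    proof (intro disjI2 conjI ballI)
      show "conn (set ?X)" using conn_ipath[OF ipX] by simp
      show "x \<notin> set ?X" "set ?X \<inter> set (?Q @ [v]) = {}" using sub x_c v(1) dA by auto
      show "touches (set ?X) x" using Yd(2) by (simp add: touches_sym)
      fix u assume u: "u \<in> set (?Q @ [v])"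
      show "touches (set ?X) u \<longleftrightarrow> u = z"
      proof
        assume "touches (set ?X) u"
        then obtain d where d: "d \<in> set ?X" "E d u" unfolding touches_def by blast
        have "u \<noteq> v"
        proof
          assume "u = v"
          then have "d = z" using uz[of d] sym[OF d(2)] d(1) t by auto
          then show False using d(1) dA by auto
        qed
        then show "u = z" using XQ[OF d(1), of u] d(2) u by auto
      next
        assume u: "u = z"
        have l: "last ?X \<in> set ?X" by (rule last_in_set) simp
        then have "E (last ?X) z" using XQ[of "last ?X" z] by simp
        then show "touches (set ?X) u" unfolding touches_def u using l by blast
      qed
    qed
    show "link x (set (?Q @ [v])) (set ?Z) z'"
      unfolding link_def
    proof (intro disjI2 conjI ballI)
      show "conn (set ?Z)" using conn_ipath[OF ipZ] by simp
      show "x \<notin> set ?Z" "set ?Z \<inter> set (?Q @ [v]) = {}" using sub x_c v(1) dA by auto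
      show "touches (set ?Z) x" using r'(2) by (simp add: touches_sym)
      fix u assume u: "u \<in> set (?Q @ [v])"
      show "touches (set ?Z) u \<longleftrightarrow> u = z'"
      proof
        assume "touches (set ?Z) u"
        then obtain d where d: "d \<in> set ?Z" "E u d" unfolding touches_sym by blast
        have "u \<noteq> v"
        proof
          assume "u = v"
          then have "d = z'" using uz'[of d] d t' by auto
          then show False using d(1) dA by auto
        qed
        then show "u = z'" using QZ[of u d] d u by auto
      next
        assume "u = z'"
        moreover have "hd ?Z \<in> set ?Z" by (rule hd_in_set) simp
        ultimately show "touches (set ?Z) u" unfolding touches_sym using QZ[of z' "hd ?Z"] by auto
      qed
    qed
    show "link x (set (?Q @ [v])) {} y'" using Yd(3) by (simp add: link_def)
    show "set ?X \<inter> set ?Z = {}" "set ?X \<inter> {} = {}" "set ?Z \<inter> {} = {}" using dA by auto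
    show "\<not> E u u'" if "u \<in> set ?X" "u' \<in> set ?Z \<union> {}" for u u'
      using XQ[of u u'] that dA by auto
    show "\<not> E u u'" if "u \<in> set ?Z" "u' \<in> {}" for u u' using that by simp
    show "u = z \<and> set ?X = {} \<or> u = z' \<and> set ?Z = {} \<or> u = y' \<and> {} = {}" if "u \<in> set (?Q @ [v])" "E x u" for u
      using that v(3) Yd(4) r'(3) t t' by auto
  qed
qed

end

lemma min_wheel_proper:
  assumes "is_wheel c x"
    and min: "\<And>c' x'. is_wheel c' x' \<Longrightarrow> length c \<le> length c' \<and> (length c' = length c \<longrightarrow> cnt x c \<le> cnt x' c')"
  shows "proper c x"
  unfolding proper_def
proof (intro ballI impI)
  fix v assume v: "v \<in> V" "v \<notin> set c" "v \<noteq> x" "\<not> E x v"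
  show "\<exists>Y. csec (set c) x Y \<and> (\<forall>z\<in>set c. E v z \<longrightarrow> z \<in> set Y)"
    using min_contradiction[OF assms(1) v(2-4) min] by blast
qed

text \<open>Rim length is minimised only to obtain some proper wheel. The final choice minimises
  spokes alone among proper wheels, as the rims compared in \<open>not_bad\<close> may be longer
  than the given one.\<close>

lemma wheel_not_bad:
  assumes "is_wheel c0 x0"
  shows "\<exists>c x. is_wheel c x \<and> \<not> bad c x"
proof -
  obtain c1 x1 where 1: "is_wheel c1 x1" "\<And>c x. is_wheel c x \<Longrightarrow> length c1 \<le> length c"
    using ex_has_least_nat[of "\<lambda>(c, x). is_wheel c x" "(c0, x0)" "\<lambda>(c, x). length c"] assms by auto
  obtain c2 x2 where 2: "is_wheel c2 x2" "length c2 = length c1" "\<And>c x. is_wheel c x \<Longrightarrow> length c = length c1 \<Longrightarrow> cnt x2 c2 \<le> cnt x c"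
    using ex_has_least_nat[of "\<lambda>(c, x). is_wheel c x \<and> length c = length c1" "(c1, x1)" "\<lambda>(c, x). cnt x c"] 1 by auto
  have "proper c2 x2" by (rule min_wheel_proper[OF 2(1)]) (use 1 2 in auto)
  then obtain c3 x3 where 3: "is_wheel c3 x3" "proper c3 x3" "\<And>c x. is_wheel c x \<Longrightarrow> proper c x \<Longrightarrow> cnt x3 c3 \<le> cnt x c"
    using ex_has_least_nat[of "\<lambda>(c, x). is_wheel c x \<and> proper c x" "(c2, x2)" "\<lambda>(c, x). cnt x c"] 2 by auto
  have "cnt x3 c3 \<noteq> 0" using wheel_4[OF 3(1)] by simp
  then have "x3 \<in> V" using E_V(1) unfolding cnt_0_iff by blast
  then show ?thesis using not_bad[OF 3(1,2) _ 3(3)] 3(1) by blast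
qed

lemma conn_successively: "successively E p \<Longrightarrow> p \<noteq> [] \<Longrightarrow> conn (set p)"
proof (induction p rule: induct_list012)
  case (3 a b p)
  then have "conn (set (b # p))" "touches (set (b # p)) a" by (simp_all add: touches_sym)
  from conn_insert[OF this] show ?case by simp
qed simp_all

lemma ihole_Cons: "ihole (b # R) \<Longrightarrow> ipath R \<and> (\<forall>z\<in>set R. E b z \<longleftrightarrow> z = hd R \<or> z = last R)"
  by (cases "R = []") (auto simp: ihole_def)

section \<open>Wheels in graphs that are not series-parallel\<close>

definition attachments :: "'a list \<Rightarrow> 'a set \<Rightarrow> 'a set" where
  "attachments Z D = {z \<in> set Z. touches D z}"

lemma finite_attachments [simp]: "finite (attachments Z D)" by (simp add: attachments_def)

lemma card_3_le: "distinct [a, b, c] \<Longrightarrow> {a, b, c} \<subseteq> A \<Longrightarrow> finite A \<Longrightarrow> 3 \<le> card A"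
  using card_mono[of A "{a, b, c}"] by simp

text \<open>A cycle that may have chords; \<open>shrink_cycle\<close> turns it into a hole.\<close>

definition cyc :: "'a list \<Rightarrow> bool" where
  "cyc Z \<longleftrightarrow> 3 \<le> length Z \<and> distinct Z \<and> successively E Z \<and> E (last Z) (hd Z)"

lemma cyc_rotate:
  assumes "cyc (p @ q)" shows "cyc (q @ p)"
proof (cases "p = [] \<or> q = []")
  case True then show ?thesis using assms by auto
next
  case False
  then show ?thesis using assms unfolding cyc_def by (auto simp: successively_append_iff)
qed

lemma cyc_chord:
  assumes "cyc Z" "4 \<le> length Z" "\<not> ihole Z"
  obtains \<alpha> u \<beta> v \<gamma> where "Z = \<alpha> @ u # \<beta> @ v # \<gamma>" "E u v" "\<beta> \<noteq> []" "\<gamma> @ \<alpha> \<noteq> []"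
proof -
  obtain a p where Z: "Z = a # p" using assms(2) by (cases Z) auto
  have pne: "p \<noteq> []" using assms(2) Z by auto
  have d: "distinct Z" "successively E Z" "E (last Z) (hd Z)" using assms(1) by (auto simp: cyc_def)
  have sp: "successively E p" "E a (hd p)" using d(2) pne by (cases p; simp add: Z)+
  show ?thesis
  proof (cases "ipath p")
    case False
    from not_ipath_chord[OF sp(1) False] obtain \<alpha> u \<beta> v \<gamma> where
      "p = \<alpha> @ u # \<beta> @ v # \<gamma>" "u = v \<or> (\<beta> \<noteq> [] \<and> E u v)" by blast
    then show ?thesis using that[of "a # \<alpha>" u \<beta> v \<gamma>] d(1) Z by auto
  next
    case True
    have "E a (last p)" using sym[OF d(3)] pne by (simp add: Z)
    then have "\<exists>v\<in>set p. E a v \<and> v \<noteq> hd p \<and> v \<noteq> last p"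
      using assms(2,3) True d(1) sp(2) pne unfolding ihole_def Z by auto
    then obtain v where v: "v \<in> set p" "E a v" "v \<noteq> hd p" "v \<noteq> last p" by blast
    obtain \<beta> \<gamma> where p: "p = \<beta> @ v # \<gamma>" using v(1) by (meson split_list)
    then have "\<beta> \<noteq> []" "\<gamma> \<noteq> []" using v(3,4) by auto
    then show ?thesis using that[of "[]" a \<beta> v \<gamma>] Z p v(2) by simp
  qed
qed

text \<open>A chord \<open>u v\<close> splits the cycle into sides \<open>\<beta>\<close> and
  \<open>\<gamma>\<close>. If \<open>D\<close> misses one side, the cycle through the other keeps
  all attachments. If it touches both, \<open>\<gamma>\<close> is absorbed into \<open>D\<close>,
  which then sees \<open>u\<close>, \<open>v\<close> and a vertex of \<open>\<beta>\<close>. Either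
  way the cycle gets shorter.\<close>

lemma shrink_cycle:
  assumes "cyc Z" "conn D" "D \<subseteq> V" "D \<inter> set Z = {}" "3 \<le> card (attachments Z D)"
  shows "\<exists>C D. ihole C \<and> conn D \<and> D \<subseteq> V \<and> D \<inter> set C = {} \<and> 3 \<le> card (attachments C D)"
  using assms
proof (induction "length Z" arbitrary: Z D rule: less_induct)
  case less
  show ?case
  proof (cases "ihole Z")
    case True
    then show ?thesis using less.prems by blast
  next
    case False
    have "length Z \<noteq> 3"
    proof
      assume "length Z = 3"
      then obtain a b c where "Z = [a, b, c]" by (cases Z; cases "tl Z"; cases "tl (tl Z)"; auto)
      then show False using less.prems(1) no_triangle[of a b c] sym[of c a] by (auto simp: cyc_def)
    qed
    then have "4 \<le> length Z" using less.prems(1) unfolding cyc_def by linarith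
    from cyc_chord[OF less.prems(1) this False] obtain \<alpha> u \<beta> v \<gamma>0 where
      ch: "Z = \<alpha> @ u # \<beta> @ v # \<gamma>0" "E u v" "\<beta> \<noteq> []" "\<gamma>0 @ \<alpha> \<noteq> []" by blast
    define \<gamma> where "\<gamma> = \<gamma>0 @ \<alpha>"
    let ?Z = "u # \<beta> @ v # \<gamma>"
    have eqs: "(u # \<beta> @ v # \<gamma>0) @ \<alpha> = ?Z" by (simp add: \<gamma>_def)
    have Z': "cyc ?Z" using cyc_rotate[of \<alpha> "u # \<beta> @ v # \<gamma>0"] less.prems(1) unfolding ch(1) eqs by simp
    have set: "set ?Z = set Z" "length ?Z = length Z" using ch(1) by (auto simp: \<gamma>_def)
    have gne: "\<gamma> \<noteq> []" using ch(4) \<gamma>_def by simp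
    have dZ: "distinct ?Z" "successively E ?Z" "E (last ?Z) u" using Z' by (auto simp: cyc_def)
    have sb: "successively E (u # \<beta> @ [v])" and sg: "successively E (v # \<gamma>)"
      using dZ(2) successively_append_iff[of E "u # \<beta> @ [v]" \<gamma>] successively_append_iff[of E "u # \<beta>" "v # \<gamma>"] by simp_all
    have Z1: "cyc (u # \<beta> @ [v])" unfolding cyc_def using sb dZ(1) sym[OF ch(2)] ch(3) by (cases \<beta>) auto
    have lg: "E (last \<gamma>) u" using dZ(3) gne by simp
    have Z2: "cyc (u # v # \<gamma>)" unfolding cyc_def using sg dZ(1) ch(2) lg gne by (cases \<gamma>) auto
    have len: "length (u # \<beta> @ [v]) < length Z" "length (u # v # \<gamma>) < length Z"
      using set(2) gne ch(3) by (cases \<gamma>; simp; cases \<beta>; simp)+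
    show ?thesis
    proof (cases "\<exists>b\<in>set \<beta>. touches D b")
      case False
      then have "attachments Z D = attachments (u # v # \<gamma>) D" unfolding attachments_def set(1)[symmetric] by auto
      moreover have "D \<inter> set (u # v # \<gamma>) = {}" using less.prems(4) set(1) by auto
      ultimately show ?thesis using less.hyps[OF len(2) Z2 less.prems(2,3)] less.prems(5) by simp
    next
      case b: True
      show ?thesis
      proof (cases "\<exists>g\<in>set \<gamma>. touches D g")
        case False
        then have "attachments Z D = attachments (u # \<beta> @ [v]) D" unfolding attachments_def set(1)[symmetric] by auto
        moreover have "D \<inter> set (u # \<beta> @ [v]) = {}" using less.prems(4) set(1) by auto
        ultimately show ?thesis using less.hyps[OF len(1) Z1 less.prems(2,3)] less.prems(5) by simp
      next
        case True
        then obtain g d where g: "g \<in> set \<gamma>" "d \<in> D" "E d g" unfolding touches_def by blast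
        obtain b where b: "b \<in> set \<beta>" "touches D b" using b by blast
        have "successively E \<gamma>" using sg gne by (cases \<gamma>) auto
        then have cg: "conn (set \<gamma>)" using conn_successively gne by blast
        have c: "conn (D \<union> set \<gamma>)" using conn_UnI[OF less.prems(2) cg g(2,1)] g(3) by blast
        have gV: "set \<gamma> \<subseteq> V"
        proof
          fix w assume w: "w \<in> set \<gamma>"
          show "w \<in> V"
          proof (cases "\<exists>w'\<in>set \<gamma>. E w w'")
            case True then show ?thesis using E_V by blast
          next
            case False
            have "(\<lambda>u v. u \<in> set \<gamma> \<and> v \<in> set \<gamma> \<and> E u v)\<^sup>*\<^sup>* w (last \<gamma>)" using cg w gne unfolding conn_def by simp
            then have "w = last \<gamma>" using False by (cases rule: converse_rtranclpE) auto
            then show ?thesis using E_V(1)[OF lg] by simp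
          qed
        qed
        have "{u, b, v} \<subseteq> attachments (u # \<beta> @ [v]) (D \<union> set \<gamma>)"
        proof -
          have "touches (D \<union> set \<gamma>) u" using lg gne unfolding touches_def by auto
          moreover have "E v (hd \<gamma>)" using sg gne by (cases \<gamma>) auto
          then have "touches (D \<union> set \<gamma>) v" using gne unfolding touches_sym by auto
          moreover have "touches (D \<union> set \<gamma>) b" using b unfolding touches_def by auto
          ultimately show ?thesis using b unfolding attachments_def by auto
        qed
        moreover have "distinct [u, b, v]" using dZ(1) b by auto
        ultimately have "3 \<le> card (attachments (u # \<beta> @ [v]) (D \<union> set \<gamma>))"
          using card_3_le[OF _ _ finite_attachments] by blast
        moreover have "(D \<union> set \<gamma>) \<inter> set (u # \<beta> @ [v]) = {}" using less.prems(4) dZ(1) unfolding set(1)[symmetric] by auto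
        moreover have "D \<union> set \<gamma> \<subseteq> V" using gV less.prems(3) by blast
        ultimately show ?thesis using less.hyps[OF len(1) Z1 c] by blast
      qed
    qed
  qed
qed

text \<open>A claw with centre \<open>w\<close> on the path: the parts \<open>\<alpha>\<close> and
  \<open>\<beta>\<close> link \<open>w\<close> to \<open>a1\<close> and \<open>a2\<close>, an empty
  part meaning that \<open>w\<close> is that end of the path. The third link is \<open>D\<close>, or
  the bare edge to \<open>b\<close> if \<open>D = {}\<close>.\<close>

lemma no_path_claw:
  assumes C: "ihole C" and p: "p = \<alpha> @ w # \<beta>" "ipath p" "set p \<inter> set C = {}"
    and abc: "distinct [a1, a2, b]" "{a1, a2, b} \<subseteq> set C"
    and att: "\<And>d z. d \<in> set p \<Longrightarrow> z \<in> set C \<Longrightarrow> E d z \<longleftrightarrow> (d = hd p \<and> z = a1) \<or> (d = last p \<and> z = a2) \<or> (d = w \<and> z = b \<and> D = {})"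
    and D: "link w (set C) D b" "D \<inter> set p = {}" "\<And>u v. u \<in> set \<alpha> \<union> set \<beta> \<Longrightarrow> v \<in> D \<Longrightarrow> \<not> E u v"
  shows False
proof -
  have ipab: "ipath \<alpha>" "ipath (w # \<beta>)" "ipath \<beta>" using p(1,2) ipath_appendD[of \<alpha> "w # \<beta>"] by auto
  have dp: "distinct p" using ipath_distinct p(2) by blast
  have aw: "E u u' \<longleftrightarrow> u = last \<alpha> \<and> u' = w" if "u \<in> set \<alpha>" "u' \<in> set (w # \<beta>)" for u u'
    using p(2) that unfolding p(1) ipath_append[of \<alpha>] by auto
  have wb: "E w u \<longleftrightarrow> u = hd \<beta>" if "u \<in> set \<beta>" for u using ipab(2) that by simp
  have wC: "w \<notin> set C" using p by auto
  have la: "link w (set C) (set \<alpha>) a1"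
  proof (cases "\<alpha> = []")
    case True
    then have "E w a1" using att[of w a1] p(1) abc(2) by auto
    then show ?thesis using True by (simp add: link_def)
  next
    case False
    have hp: "hd p = hd \<alpha>" using False p(1) by simp
    have ha: "hd \<alpha> \<in> set \<alpha>" using False by simp
    have lp: "last p \<notin> set \<alpha>" using distinct_last_notin[of \<alpha> "w # \<beta>"] dp p(1) by simp
    have wa: "w \<notin> set \<alpha>" using dp p(1) by simp
    show ?thesis unfolding link_def
    proof (intro disjI2 conjI ballI)
      show "conn (set \<alpha>)" using conn_ipath[OF ipab(1) False] .
      show "w \<notin> set \<alpha>" by fact
      show "set \<alpha> \<inter> set C = {}" using p(1,3) by auto
      show "touches (set \<alpha>) w" using aw[of "last \<alpha>" w] False unfolding touches_def by auto
      fix z assume z: "z \<in> set C"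
      show "touches (set \<alpha>) z \<longleftrightarrow> z = a1"
      proof
        assume "touches (set \<alpha>) z"
        then obtain d where d: "d \<in> set \<alpha>" "E d z" unfolding touches_def by blast
        then show "z = a1" using att[of d z] z p(1) lp wa by auto
      next
        assume "z = a1"
        moreover have "hd \<alpha> \<in> set p" using ha p(1) by simp
        ultimately have "E (hd \<alpha>) z" using att[of "hd \<alpha>" z] z hp by simp
        then show "touches (set \<alpha>) z" using ha unfolding touches_def by blast
      qed
    qed
  qed
  have lb: "link w (set C) (set \<beta>) a2"
  proof (cases "\<beta> = []")
    case True
    then have "E w a2" using att[of w a2] p(1) abc(2) by auto
    then show ?thesis using True by (simp add: link_def)
  next
    case False
    have hp: "last p = last \<beta>" using False p(1) by simp
    have ha: "last \<beta> \<in> set \<beta>" using False by simp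
    have lp: "hd p \<notin> set \<beta>" using distinct_hd_notin[of "\<alpha> @ [w]" \<beta>] dp p(1) by simp
    have wa: "w \<notin> set \<beta>" using dp p(1) by simp
    show ?thesis unfolding link_def
    proof (intro disjI2 conjI ballI)
      show "conn (set \<beta>)" using conn_ipath[OF ipab(3) False] .
      show "w \<notin> set \<beta>" by fact
      show "set \<beta> \<inter> set C = {}" using p(1,3) by auto
      show "touches (set \<beta>) w" using wb[of "hd \<beta>"] False unfolding touches_sym by auto
      fix z assume z: "z \<in> set C"
      show "touches (set \<beta>) z \<longleftrightarrow> z = a2"
      proof
        assume "touches (set \<beta>) z"
        then obtain d where d: "d \<in> set \<beta>" "E d z" unfolding touches_def by blast
        then show "z = a2" using att[of d z] z p(1) lp wa by auto
      next
        assume "z = a2"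
        moreover have "last \<beta> \<in> set p" using ha p(1) by simp
        ultimately have "E (last \<beta>) z" using att[of "last \<beta>" z] z hp by simp
        then show "touches (set \<beta>) z" using ha unfolding touches_def by blast
      qed
    qed
  qed
  show False
  proof (rule no_claw[OF C wC abc la lb D(1)])
    show "set \<alpha> \<inter> set \<beta> = {}" using dp p(1) by auto
    show "set \<alpha> \<inter> D = {}" "set \<beta> \<inter> D = {}" using D(2) p(1) by auto
    show "\<not> E u v" if "u \<in> set \<alpha>" "v \<in> set \<beta> \<union> D" for u v
    proof (cases "v \<in> D")
      case True then show ?thesis using D(3)[of u v] that by blast
    next
      case False
      then have "v \<in> set \<beta>" using that by blast
      then show ?thesis using aw[OF that(1), of v] dp p(1) by auto
    qed
    show "\<not> E u v" if "u \<in> set \<beta>" "v \<in> D" for u v using D(3)[of u v] that by blast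
    show "v = a1 \<and> set \<alpha> = {} \<or> v = a2 \<and> set \<beta> = {} \<or> v = b \<and> D = {}" if "v \<in> set C" "E w v" for v
    proof -
      have "(w = hd p \<and> v = a1) \<or> (w = last p \<and> v = a2) \<or> (v = b \<and> D = {})" using att[of w v] that p(1) by auto
      moreover have "w = hd p \<Longrightarrow> \<alpha> = []" using distinct_hd_notin[of \<alpha> "w # \<beta>"] dp p(1) by auto
      moreover have "w = last p \<Longrightarrow> \<beta> = []" using distinct_last_notin[of "\<alpha> @ [w]" \<beta>] dp p(1) by auto
      ultimately show ?thesis by auto
    qed
  qed
qed

end

section \<open>Attachments of connected sets to a hole when there is no wheel\<close>

locale no_wheel_no_K33 = ISK4_triangle_free +
  assumes no_wheel: "\<not> is_wheel c x"
    and no_K33: "distinct [a1, a2, a3, b1, b2, b3] \<Longrightarrow> \<exists>a\<in>{a1, a2, a3}. \<exists>b\<in>{b1, b2, b3}. \<not> E a b"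
begin

lemma le_2: "ihole c \<Longrightarrow> x \<notin> set c \<Longrightarrow> cnt x c \<le> 2"
  using no_wheel[of c x] unfolding is_wheel_def by linarith

text \<open>\<open>d1\<close> closes the arc \<open>a # A @ [a']\<close> to a hole that contains
  both attachments of \<open>d2\<close>. The path \<open>m\<close> then links \<open>d2\<close> to
  \<open>d1\<close>; if it is empty, their edge is a third spoke.\<close>

lemma no_noncrossing:
  assumes C: "ihole (a # A @ a' # B)" and p: "ipath (d1 # m @ [d2])" "set (d1 # m @ [d2]) \<inter> set (a # A @ a' # B) = {}"
    and att: "\<And>d z. d \<in> set (d1 # m @ [d2]) \<Longrightarrow> z \<in> set (a # A @ a' # B) \<Longrightarrow>
       E d z \<longleftrightarrow> (d = d1 \<and> (z = a \<or> z = a')) \<or> (d = d2 \<and> (z = b \<or> z = b'))"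
    and b: "b \<noteq> b'" "b \<in> set A" "b' \<in> set A" and B: "B \<noteq> []"
  shows False
proof -
  let ?Q = "a # A @ [a']"
  have ipQ: "ipath ?Q" using ihole_ipath[of ?Q B] C B by simp
  have dp: "distinct (d1 # m @ [d2])" using ipath_distinct[OF p(1)] .
  have dQ: "distinct ?Q" using ipath_distinct[OF ipQ] .
  have H: "ihole (?Q @ [d1])"
  proof -
    have "E u d1 \<longleftrightarrow> u = last ?Q \<or> u = hd ?Q" if "u \<in> set ?Q" for u
    proof -
      have "u \<in> set (a # A @ a' # B)" using that by auto
      then show ?thesis using att[of d1 u] dp sym_iff[of u d1] by auto
    qed
    moreover have "d1 \<notin> set ?Q" using p(2) by auto
    moreover have "A \<noteq> []" using b by auto
    then have "1 \<le> length A" by (cases A) auto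
    ultimately show ?thesis using ihole_append[of ?Q "[d1]"] ipQ by simp
  qed
  have d2: "d2 \<notin> set (?Q @ [d1])" using p(2) dp by auto
  have cQ: "cnt d2 ?Q = 2"
  proof -
    have "{z \<in> set ?Q. E d2 z} = {b, b'}"
    proof (intro set_eqI iffI)
      fix z assume "z \<in> {z \<in> set ?Q. E d2 z}"
      then have "z \<in> set (a # A @ a' # B)" "E d2 z" by auto
      then show "z \<in> {b, b'}" using att[of d2 z] dp by auto
    next
      fix z assume z: "z \<in> {b, b'}"
      then have "z \<in> set (a # A @ a' # B)" "z \<in> set ?Q" using b by auto
      then show "z \<in> {z \<in> set ?Q. E d2 z}" using att[of d2 z] z by auto
    qed
    then show ?thesis using cnt_card[OF dQ, of d2] b(1) by simp
  qed
  show False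
  proof (cases "m = []")
    case True
    then have "E d2 d1" using p(1) sym[of d1 d2] by simp
    then have "cnt d2 (?Q @ [d1]) = 3" using cQ by (simp only: cnt_simps) simp
    then show False using le_2[OF H d2] by simp
  next
    case False
    have ipm: "ipath m" using p(1) by (simp add: ipath_append)
    have E12: "\<not> E d2 d1" "E d1 (hd m)" "E (last m) d2"
    proof -
      show "\<not> E d2 d1" using p(1) False dp sym[of d2 d1] by (auto simp: hd_append)
      show "E d1 (hd m)" using p(1) False by auto
      show "E (last m) d2" using p(1) False by (simp add: ipath_append)
    qed
    have c2: "cnt d2 (?Q @ [d1]) = 2" using cQ E12(1) by (simp only: cnt_simps) simp
    show False
    proof (rule no_two_spokes_link[OF H d2 c2, of "set m" d1])
      show "conn (set m)" using conn_ipath[OF ipm False] .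
      show "d2 \<notin> set m" using dp by auto
      show "set m \<inter> set (?Q @ [d1]) = {}" using p(2) dp by auto
      show "touches (set m) d2" using E12(3) False unfolding touches_def by auto
      show "d1 \<in> set (?Q @ [d1])" by simp
      show "\<not> E d2 d1" by (rule E12(1))
      show "touches (set m) z \<longleftrightarrow> z = d1" if z: "z \<in> set (?Q @ [d1])" for z
      proof
        assume "touches (set m) z"
        then obtain d where d: "d \<in> set m" "E d z" unfolding touches_def by blast
        have "z \<notin> set ?Q"
        proof
          assume "z \<in> set ?Q"
          then have "z \<in> set (a # A @ a' # B)" by auto
          then show False using att[of d z] d dp by auto
        qed
        then show "z = d1" using z by auto
      next
        assume "z = d1"
        then show "touches (set m) z" using E12(2) False unfolding touches_sym by auto
      qed
    qed
  qed
qed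

text \<open>On the hole formed by \<open>a # A @ [a']\<close> and \<open>d1\<close>, the three links
  from \<open>d2\<close> are the edge to \<open>b\<close>, the path \<open>m\<close> to
  \<open>d1\<close>, and \<open>b' # B2\<close> to \<open>a\<close>. As \<open>B1\<close> is not
  empty, the last of these does not touch \<open>a'\<close>.\<close>

lemma no_crossing:
  assumes C: "ihole (a # A @ a' # B1 @ b' # B2)" and p: "ipath (d1 # m @ [d2])" "set (d1 # m @ [d2]) \<inter> set (a # A @ a' # B1 @ b' # B2) = {}"
    and att: "\<And>d z. d \<in> set (d1 # m @ [d2]) \<Longrightarrow> z \<in> set (a # A @ a' # B1 @ b' # B2) \<Longrightarrow>
       E d z \<longleftrightarrow> (d = d1 \<and> (z = a \<or> z = a')) \<or> (d = d2 \<and> (z = b \<or> z = b'))"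
    and b: "b \<in> set A" and B: "B1 \<noteq> []"
  shows False
proof -
  let ?Q = "a # A @ [a']"
  have eq: "?Q @ (B1 @ b' # B2) = a # A @ a' # B1 @ b' # B2" by simp
  have ipQ: "ipath ?Q" using ihole_ipath[of ?Q "B1 @ b' # B2"] C eq by simp
  have dp: "distinct (d1 # m @ [d2])" using ipath_distinct[OF p(1)] .
  have dC: "distinct (a # A @ a' # B1 @ b' # B2)" using ihole_distinct[OF C] .
  have subQ: "z \<in> set (a # A @ a' # B1 @ b' # B2)" if "z \<in> set ?Q" for z using that by auto
  have H: "ihole (?Q @ [d1])"
  proof -
    have "E u d1 \<longleftrightarrow> u = last ?Q \<or> u = hd ?Q" if "u \<in> set ?Q" for u
      using att[OF _ subQ[OF that], of d1] dp sym_iff[of u d1] by auto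
    moreover have "d1 \<notin> set ?Q" using p(2) by auto
    moreover have "A \<noteq> []" using b by auto
    then have "1 \<le> length A" by (cases A) auto
    ultimately show ?thesis using ihole_append[of ?Q "[d1]"] ipQ by simp
  qed
  have d2: "d2 \<notin> set (?Q @ [d1])" using p(2) dp by auto
  have d2Q: "E d2 z \<longleftrightarrow> z = b" if "z \<in> set ?Q" for z
    using att[OF _ subQ[OF that], of d2] dp that dC by auto
  let ?D = "b' # B2"
  have eq2: "?Q @ B1 @ ?D = a # A @ a' # B1 @ b' # B2" by simp
  have crossD: "(u = a' \<and> z = hd B1) \<or> (u = a \<and> z = last ?D)" if "u \<in> set ?Q" "z \<in> set (B1 @ ?D)" "E u z" for u z
    using ihole_cross[of ?Q "B1 @ ?D" u z] that C B unfolding eq2 by (auto simp: hd_append)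
  have laD: "E a (last ?D)"
  proof -
    have "\<forall>u\<in>set ?Q. \<forall>v\<in>set (B1 @ ?D). E u v \<longleftrightarrow> (u = last ?Q \<and> v = hd (B1 @ ?D)) \<or> (u = hd ?Q \<and> v = last (B1 @ ?D))"
      using C ihole_append[of ?Q "B1 @ ?D"] unfolding eq2 by blast
    moreover have "last ?D \<in> set (B1 @ ?D)" "last (B1 @ ?D) = last ?D" "hd ?Q = a" "a \<in> set ?Q" by auto
    ultimately show ?thesis by metis
  qed
  have ipD: "ipath ?D" using ihole_ipath[of "?Q @ B1" ?D] C by simp
  have attD: "\<not> E d z" if "d \<in> set (d1 # m)" "z \<in> set ?D" for d z
  proof -
    have "z \<in> set (a # A @ a' # B1 @ b' # B2)" "z \<noteq> a" "z \<noteq> a'" using that(2) dC by auto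
    moreover have "d \<noteq> d2" "d \<in> set (d1 # m @ [d2])" using that(1) dp by auto
    ultimately show ?thesis using att[of d z] by auto
  qed
  have attm: "\<not> E d z" if "d \<in> set m" "z \<in> set ?Q" for d z
    using att[OF _ subQ[OF that(2)], of d] that(1) dp by auto
  show False
  proof (rule no_claw[OF H d2, of b d1 a "{}" "set m" "set ?D"])
    show "distinct [b, d1, a]" "{b, d1, a} \<subseteq> set (?Q @ [d1])" using b dC p(2) by auto
    show "link d2 (set (?Q @ [d1])) {} b" using d2Q[of b] b by (simp add: link_def)
    show "link d2 (set (?Q @ [d1])) (set m) d1"
    proof (cases "m = []")
      case True
      then have "E d2 d1" using p(1) sym[of d1 d2] by simp
      then show ?thesis using True by (simp add: link_def)
    next
      case False
      have ipm: "ipath m" using p(1) by (simp add: ipath_append)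
      have E12: "E d1 (hd m)" "E (last m) d2" using p(1) False by (auto simp: ipath_append)
      show ?thesis unfolding link_def
      proof (intro disjI2 conjI ballI)
        show "conn (set m)" using conn_ipath[OF ipm False] .
        show "d2 \<notin> set m" "set m \<inter> set (?Q @ [d1]) = {}" using dp p(2) by auto
        show "touches (set m) d2" using E12(2) False unfolding touches_def by auto
        fix z assume z: "z \<in> set (?Q @ [d1])"
        show "touches (set m) z \<longleftrightarrow> z = d1"
        proof
          assume "touches (set m) z"
          then show "z = d1" using attm z unfolding touches_def by auto
        next
          assume "z = d1"
          then show "touches (set m) z" using E12(1) False unfolding touches_sym by auto
        qed
      qed
    qed
    show "link d2 (set (?Q @ [d1])) (set ?D) a" unfolding link_def
    proof (intro disjI2 conjI ballI)
      show "conn (set ?D)" using conn_ipath[OF ipD] by simp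
      show "d2 \<notin> set ?D" "set ?D \<inter> set (?Q @ [d1]) = {}" using dC p(2) by auto
      show "touches (set ?D) d2" using att[of d2 b'] unfolding touches_sym by auto
      fix z assume z: "z \<in> set (?Q @ [d1])"
      show "touches (set ?D) z \<longleftrightarrow> z = a"
      proof
        assume "touches (set ?D) z"
        then obtain d where d: "d \<in> set ?D" "E z d" unfolding touches_sym by blast
        have "z \<noteq> d1" using attD[of d1 d] d by auto
        then have zQ: "z \<in> set ?Q" using z by auto
        have "set B1 \<inter> set ?D = {}" "hd B1 \<in> set B1" using dC B by auto
        then have "d \<noteq> hd B1" using d(1) by (metis disjoint_iff)
        then show "z = a" using crossD[OF zQ _ d(2)] d(1) by auto
      next
        assume "z = a"
        then show "touches (set ?D) z" using laD unfolding touches_sym by (metis last_in_set list.discI)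
      qed
    qed
    show "{} \<inter> set m = {}" "{} \<inter> set ?D = {}" by auto
    show "set m \<inter> set ?D = {}" using p(2) by auto
    show "\<not> E u v" if "u \<in> {}" "v \<in> set m \<union> set ?D" for u v using that by simp
    show "\<not> E u v" if "u \<in> set m" "v \<in> set ?D" for u v using attD[of u v] that by auto
    show "v = b \<and> {} = {} \<or> v = d1 \<and> set m = {} \<or> v = a \<and> set ?D = {}" if v: "v \<in> set (?Q @ [d1])" "E d2 v" for v
    proof (cases "v = d1")
      case True
      have "m = []"
      proof (rule ccontr)
        assume "m \<noteq> []"
        moreover from this have "d2 \<noteq> hd m" using dp by auto
        ultimately show False using p(1) sym[of d2 d1] v(2) True by (auto simp: hd_append)
      qed
      then show ?thesis using True by simp
    next
      case False
      then have "v \<in> set ?Q" using v(1) by auto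
      then show ?thesis using d2Q[of v] v(2) by simp
    qed
  qed
qed

text \<open>In a smallest connected set \<open>D\<close> with three attachments, deleting a non-cut
  vertex leaves at most two, so every non-cut vertex has a private attachment. If a path
  \<open>p\<close> between two such vertices is not all of \<open>D\<close>, a third one turns
  \<open>D\<close> into a claw. Otherwise \<open>D = set p\<close>, and the cases of three and of
  more attachments are treated separately.\<close>

lemma few_attachments:
  assumes C: "ihole C" and D0: "conn D0" "D0 \<subseteq> V" "D0 \<inter> set C = {}"
  shows "card (attachments C D0) \<le> 2"
proof (rule ccontr)
  assume n: "\<not> ?thesis"
  let ?P = "\<lambda>D. conn D \<and> D \<subseteq> V \<and> D \<inter> set C = {} \<and> 3 \<le> card (attachments C D)"
  have "?P D0" using D0 n by simp
  then obtain D where PD: "?P D" and min: "\<And>D'. ?P D' \<Longrightarrow> card D \<le> card D'"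
    using ex_has_least_nat[of ?P D0 card] by blast
  have D: "conn D" "D \<subseteq> V" "D \<inter> set C = {}" "3 \<le> card (attachments C D)" using PD by blast+
  have finD: "finite D" using D(2) finV finite_subset by blast
  have small: "card (attachments C D') \<le> 2" if "conn D'" "D' \<subset> D" for D'
  proof (rule ccontr)
    assume "\<not> ?thesis"
    then have "?P D'" using that D by auto
    from min[OF this] show False using psubset_card_mono[OF finD that(2)] by simp
  qed
  have attI: "z \<in> attachments C D'" if "z \<in> set C" "d \<in> D'" "E d z" for z d D'
    using that unfolding attachments_def touches_def by blast
  have vert: "card {z \<in> set C. E d z} \<le> 2" if "d \<in> D" for d
    using le_2[OF C, of d] cnt_card[OF ihole_distinct[OF C], of d] that D(3) by auto
  have nsing: "D \<noteq> {d}" for d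
  proof
    assume "D = {d}"
    then have "attachments C D = {z \<in> set C. E d z}" unfolding attachments_def touches_def by simp
    then show False using vert[of d] \<open>D = {d}\<close> D(4) by simp
  qed
  have priv: "\<exists>a\<in>set C. E d a \<and> (\<forall>d'\<in>D. E d' a \<longrightarrow> d' = d)" if "d \<in> D" "conn (D - {d})" for d
  proof -
    have "card (attachments C (D - {d})) \<le> 2" using small[OF that(2)] that(1) by blast
    then have "\<not> attachments C D \<subseteq> attachments C (D - {d})"
      using card_mono[OF finite_attachments, of "attachments C D" C "D - {d}"] D(4) by linarith
    then obtain a where a: "a \<in> set C" "touches D a" "\<not> touches (D - {d}) a" unfolding attachments_def by blast
    then show ?thesis unfolding touches_def by blast
  qed
  obtain s where s: "s \<in> D" using D(1) by (auto simp: conn_def)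
  have "{s} \<subset> D" using s nsing by blast
  from conn_remove_outside[OF finD D(1) conn_sing this] obtain d1 where d1: "d1 \<in> D" "conn (D - {d1})" by blast
  have "{d1} \<subset> D" using d1 nsing by blast
  from conn_remove_outside[OF finD D(1) conn_sing this] obtain d2 where d2: "d2 \<in> D" "d2 \<noteq> d1" "conn (D - {d2})" by blast
  obtain a1 where a1: "a1 \<in> set C" "E d1 a1" "\<And>d. d \<in> D \<Longrightarrow> E d a1 \<Longrightarrow> d = d1" using priv[OF d1] by blast
  obtain a2 where a2: "a2 \<in> set C" "E d2 a2" "\<And>d. d \<in> D \<Longrightarrow> E d a2 \<Longrightarrow> d = d2" using priv[OF d2(1,3)] by blast
  have a12: "a1 \<noteq> a2" using a1(3)[OF d2(1)] a2(2) d2(2) by auto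
  obtain p where p: "p \<noteq> []" "ipath p" "set p \<subseteq> D" "hd p = d1" "last p = d2"
    by (rule conn_path[of D d1 "\<lambda>u. u = d1" d2 "\<lambda>u. u = d2", OF D(1) d1(1) refl d2(1) refl]) blast
  obtain m where pm: "p = d1 # m @ [d2]"
    using p(1,4,5) d2(2) by (cases p; cases "tl p" rule: rev_cases) auto
  have pC: "set p \<inter> set C = {}" using p(3) D(3) by blast
  have dp: "distinct p" using ipath_distinct[OF p(2)] .
  show False
  proof (cases "set p = D")
    case False
    then have psub: "set p \<subset> D" using p(3) by blast
    from conn_remove_outside[OF finD D(1) conn_ipath[OF p(2,1)] this] obtain d3 where
      d3: "d3 \<in> D" "d3 \<notin> set p" "conn (D - {d3})" by blast
    obtain a3 where a3: "a3 \<in> set C" "E d3 a3" "\<And>d. d \<in> D \<Longrightarrow> E d a3 \<Longrightarrow> d = d3" using priv[OF d3(1,3)] by blast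
    have d123: "d1 \<noteq> d3" "d2 \<noteq> d3" using d3(2) pm by auto
    have a123: "a1 \<noteq> a3" "a2 \<noteq> a3" using a1(3)[OF d3(1)] a2(3)[OF d3(1)] a3(2) d123 by auto
    have two: "attachments C (D - {d}) = {a, a'}"
      if "d \<in> D" "conn (D - {d})" "{a, a'} \<subseteq> attachments C (D - {d})" "a \<noteq> a'" for d a a'
    proof -
      have "card (attachments C (D - {d})) \<le> 2" using small[OF that(2)] that(1) by blast
      then have "card (attachments C (D - {d})) \<le> card {a, a'}" using that(4) by simp
      from card_seteq[OF finite_attachments that(3) this] show ?thesis by simp
    qed
    \<comment> \<open>Both \<open>D - {d1}\<close> and \<open>D - {d2}\<close> retain two private
      attachments, which exhausts the bound 2; so \<open>D\<close> has no attachments besides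
      \<open>a1\<close>, \<open>a2\<close>, \<open>a3\<close>.\<close>
    have A1: "attachments C (D - {d1}) = {a2, a3}"
    proof (rule two[OF d1])
      have "a2 \<in> attachments C (D - {d1})" by (rule attI[OF a2(1) _ a2(2)]) (use d2 in simp)
      moreover have "a3 \<in> attachments C (D - {d1})" by (rule attI[OF a3(1) _ a3(2)]) (use d3(1) d123 in simp)
      ultimately show "{a2, a3} \<subseteq> attachments C (D - {d1})" by simp
    qed (rule a123(2))
    have A2: "attachments C (D - {d2}) = {a1, a3}"
    proof (rule two[OF d2(1,3)])
      have "a1 \<in> attachments C (D - {d2})" by (rule attI[OF a1(1) _ a1(2)]) (use d1(1) d2(2) in simp)
      moreover have "a3 \<in> attachments C (D - {d2})" by (rule attI[OF a3(1) _ a3(2)]) (use d3(1) d123 in simp)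
      ultimately show "{a1, a3} \<subseteq> attachments C (D - {d2})" by simp
    qed (rule a123(1))
    have all: "(d = d1 \<and> z = a1) \<or> (d = d2 \<and> z = a2) \<or> (d = d3 \<and> z = a3)" if "d \<in> D" "z \<in> set C" "E d z" for d z
    proof -
      have "z \<in> {a1, a2, a3}"
      proof (cases "d = d1")
        case True
        then have "d \<in> D - {d2}" using that(1) d2(2) by simp
        from attI[OF that(2) this that(3)] show ?thesis using A2 by auto
      next
        case False
        then have "d \<in> D - {d1}" using that(1) by simp
        from attI[OF that(2) this that(3)] show ?thesis using A1 by auto
      qed
      then show ?thesis using a1(3)[OF that(1)] a2(3)[OF that(1)] a3(3)[OF that(1)] that(3) by blast
    qed
    have ptouch: "\<exists>u'\<in>set p. E u u'" if u: "u \<in> set p" for u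
    proof -
      obtain \<alpha> \<beta> where ab: "p = \<alpha> @ u # \<beta>" using u by (meson split_list)
      show ?thesis
      proof (cases \<beta>)
        case (Cons w \<beta>')
        then show ?thesis using ipath_adj[of \<alpha> u w \<beta>'] p(2) ab by auto
      next
        case Nil
        then obtain \<alpha>' w where "\<alpha> = \<alpha>' @ [w]" using ab pm by (cases \<alpha> rule: rev_cases) auto
        then show ?thesis using sym[OF ipath_adj[of \<alpha>' w u "[]"]] p(2) ab Nil by auto
      qed
    qed
    have d1t: "\<exists>u'\<in>set p. E d1 u'" using ptouch[of d1] pm by simp
    obtain q where q: "q \<noteq> []" "ipath q" "set q \<subseteq> D" "hd q = d3" "\<exists>u'\<in>set p. E (last q) u'"
      "\<And>u. u \<in> set q \<Longrightarrow> \<exists>u'\<in>set p. E u u' \<Longrightarrow> u = last q"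
      by (rule conn_path[of D d3 "\<lambda>u. u = d3" d1 "\<lambda>u. \<exists>u'\<in>set p. E u u'", OF D(1) d3(1) refl d1(1) d1t]) blast
    \<comment> \<open>\<open>q\<close> starts off \<open>p\<close> and stops at its first vertex
      adjacent to \<open>p\<close>. If its last vertex were on \<open>p\<close>, the one before
      would already be adjacent to \<open>p\<close>.\<close>
    have lq: "last q \<notin> set p"
    proof
      assume l: "last q \<in> set p"
      obtain q' l' where q': "q = q' @ [l']" using q(1) by (cases q rule: rev_cases) auto
      have ll: "last q = l'" using q' by simp
      have "q' \<noteq> []"
      proof
        assume "q' = []"
        then have "hd q = l'" using q' by simp
        then show False using l ll q(4) d3(2) by simp
      qed
      then obtain q'' u where u: "q' = q'' @ [u]" by (cases q' rule: rev_cases) auto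
      have qq: "q = q'' @ u # [l']" using q' u by simp
      have e: "E u l'" using ipath_adj[of q'' u l' "[]"] q(2) qq by simp
      have "u \<in> set q" using qq by simp
      then have "u = l'" using q(6)[of u] e l ll by auto
      then show False using irrefl e by blast
    qed
    have pq: "set p \<inter> set q = {}"
    proof (rule ccontr)
      assume "set p \<inter> set q \<noteq> {}"
      then obtain u where "u \<in> set p" "u \<in> set q" by blast
      then show False using q(6)[of u] ptouch[of u] lq by auto
    qed
    obtain w where w: "w \<in> set p" "E (last q) w" using q(5) by blast
    have lqq: "last q \<in> set q" "d3 \<in> set q" using q(1,4) by auto
    have attge: "3 \<le> card (attachments C D')" if "d1 \<in> D'" "d2 \<in> D'" "d3 \<in> D'" for D'
    proof -
      have "{a1, a2, a3} \<subseteq> attachments C D'"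
        using attI[OF a1(1) that(1) a1(2)] attI[OF a2(1) that(2) a2(2)] attI[OF a3(1) that(3) a3(2)] by simp
      moreover have "distinct [a1, a2, a3]" using a12 a123 by simp
      ultimately show ?thesis using card_3_le[OF _ _ finite_attachments] by blast
    qed
    have full: "D' = D" if "conn D'" "D' \<subseteq> D" "d1 \<in> D'" "d2 \<in> D'" "d3 \<in> D'" for D'
    proof (rule ccontr)
      assume "D' \<noteq> D"
      then show False using small[OF that(1)] attge[OF that(3-5)] that(2) by fastforce
    qed
    have cq: "conn (set q)" using conn_ipath[OF q(2,1)] .
    have "conn (set p \<union> set q)"
      using conn_UnI[OF conn_ipath[OF p(2,1)] cq w(1) lqq(1)] sym[OF w(2)] by blast
    then have DD: "set p \<union> set q = D" using full[of "set p \<union> set q"] p(3) q(3) lqq pm by auto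
    \<comment> \<open>If the last vertex of \<open>q\<close> saw two vertices of \<open>p\<close>,
      the stretch between them, nonempty for lack of a triangle, could be dropped from
      \<open>D\<close>, against minimality.\<close>
    have key: False if "p = \<alpha> @ u # \<beta> @ u' # \<gamma>" "E (last q) u" "E (last q) u'" for \<alpha> u \<beta> u' \<gamma>
    proof -
      have bne: "\<beta> \<noteq> []"
      proof
        assume "\<beta> = []"
        then have "E u u'" using ipath_adj[of \<alpha> u u' \<gamma>] p(2) that(1) by simp
        then show False using no_triangle[OF that(2), of u'] that(3) by blast
      qed
      have ips: "ipath (\<alpha> @ [u])" "ipath (u' # \<gamma>)"
        using ipath_appendD(1)[of "\<alpha> @ [u]" "\<beta> @ u' # \<gamma>"] ipath_appendD(2)[of "\<alpha> @ u # \<beta>" "u' # \<gamma>"] p(2) that(1) by auto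
      let ?D = "set (\<alpha> @ [u]) \<union> set q \<union> set (u' # \<gamma>)"
      have c1: "conn (set (\<alpha> @ [u]))" "conn (set (u' # \<gamma>))" using conn_ipath ips by blast+
      have "conn (set (\<alpha> @ [u]) \<union> set q)" using conn_UnI[OF c1(1) cq, of u "last q"] lqq sym[OF that(2)] by simp
      from conn_UnI[OF this c1(2), of "last q" u'] have "conn ?D" using lqq that(3) by simp
      moreover have "?D \<subseteq> D" using DD that(1) by auto
      moreover have "d1 \<in> ?D" using pm that(1) by (cases \<alpha>) auto
      moreover have "d2 \<in> ?D"
      proof -
        have "last p = last (u' # \<gamma>)" using that(1) by simp
        moreover have "last (u' # \<gamma>) \<in> set (u' # \<gamma>)" by (rule last_in_set) simp
        ultimately show ?thesis using p(5) by simp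
      qed
      ultimately have "?D = D" using full[of ?D] lqq by blast
      moreover obtain x0 where x0: "x0 \<in> set \<beta>" using bne by (cases \<beta>) auto
      then have "x0 \<in> D" "x0 \<notin> ?D" using DD that(1) dp pq by auto
      ultimately show False by blast
    qed
    obtain \<alpha> \<beta> where ab: "p = \<alpha> @ w # \<beta>" using w(1) by (meson split_list)
    have uniq: "\<not> E (last q) u" if "u \<in> set \<alpha> \<union> set \<beta>" for u
    proof
      assume e: "E (last q) u"
      from that show False
      proof
        assume "u \<in> set \<alpha>"
        then obtain \<alpha>1 \<alpha>2 where "\<alpha> = \<alpha>1 @ u # \<alpha>2" by (meson split_list)
        then show False using key[of \<alpha>1 u \<alpha>2 w \<beta>] ab e w(2) by simp
      next
        assume "u \<in> set \<beta>"
        then obtain \<beta>1 \<beta>2 where "\<beta> = \<beta>1 @ u # \<beta>2" by (meson split_list)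
        then show False using key[of \<alpha> w \<beta>1 u \<beta>2] ab e w(2) by simp
      qed
    qed
    have noq: "\<not> E u v" if "u \<in> set \<alpha> \<union> set \<beta>" "v \<in> set q" for u v
    proof
      assume e: "E u v"
      have "u \<in> set p" using that(1) ab by auto
      then have "v = last q" using q(6)[OF that(2)] sym[OF e] by blast
      then show False using uniq[OF that(1)] sym[OF e] by blast
    qed
    show False
    proof (rule no_path_claw[OF C ab p(2) pC, of a1 a2 a3 "set q"])
      show "distinct [a1, a2, a3]" "{a1, a2, a3} \<subseteq> set C" using a12 a123 a1 a2 a3 by auto
      show "E d z \<longleftrightarrow> (d = hd p \<and> z = a1) \<or> (d = last p \<and> z = a2) \<or> (d = w \<and> z = a3 \<and> set q = {})"
        if dz: "d \<in> set p" "z \<in> set C" for d z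
      proof -
        have "d \<in> D" "d \<noteq> d3" using dz(1) p(3) d3(2) by auto
        then show ?thesis using all[of d z] dz a1(2) a2(2) p(4,5) q(1) by auto
      qed
      show "set q \<inter> set p = {}" using pq by blast
      show "\<not> E u v" if "u \<in> set \<alpha> \<union> set \<beta>" "v \<in> set q" for u v by (rule noq[OF that])
      show "link w (set C) (set q) a3" unfolding link_def
      proof (intro disjI2 conjI ballI)
        show "conn (set q)" by (rule cq)
        show "w \<notin> set q" using w(1) pq by blast
        show "set q \<inter> set C = {}" using q(3) D(3) by blast
        show "touches (set q) w" using w(2) lqq unfolding touches_def by blast
        fix z assume z: "z \<in> set C"
        show "touches (set q) z \<longleftrightarrow> z = a3"
        proof
          assume "touches (set q) z"
          then obtain d where d: "d \<in> set q" "E d z" unfolding touches_def by blast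
          have "d1 \<notin> set q" "d2 \<notin> set q" using pq pm by auto
          then have "d \<noteq> d1" "d \<noteq> d2" using d(1) by blast+
          then show "z = a3" using all[of d z] d z q(3) by blast
        next
          assume "z = a3"
          then show "touches (set q) z" using a3(2) lqq(2) unfolding touches_def by blast
        qed
      qed
    qed
  next
    case DP: True
    define X where "X = attachments C D"
    have Xtouch: "z \<in> X \<longleftrightarrow> z \<in> set C \<and> (\<exists>d\<in>set p. E d z)" for z
      unfolding X_def attachments_def touches_def DP by blast
    have c3: "3 \<le> card X" using D(4) X_def by simp
    have finX: "finite X" by (simp add: X_def)
    have "\<not> X \<subseteq> {a1, a2}" using card_mono[of "{a1, a2}" X] c3 a12 by auto
    then obtain b where b: "b \<in> X" "b \<noteq> a1" "b \<noteq> a2" by blast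
    show False
    proof (cases "X \<subseteq> {a1, a2, b}")
      case True
      have att: "E d z \<longleftrightarrow> (d = d1 \<and> z = a1) \<or> (d = d2 \<and> z = a2) \<or> (z = b \<and> E d b)" if "d \<in> set p" "z \<in> set C" for d z
      proof
        assume e: "E d z"
        have dD: "d \<in> D" using that(1) DP by blast
        have "z \<in> X" using Xtouch[of z] that e by blast
        then have "z = a1 \<or> z = a2 \<or> z = b" using True by blast
        then show "(d = d1 \<and> z = a1) \<or> (d = d2 \<and> z = a2) \<or> (z = b \<and> E d b)" using a1(3)[OF dD] a2(3)[OF dD] e by blast
      next
        assume "(d = d1 \<and> z = a1) \<or> (d = d2 \<and> z = a2) \<or> (z = b \<and> E d b)"
        then show "E d z" using a1(2) a2(2) by blast
      qed
      have bC: "b \<in> set C" using b(1) Xtouch by blast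
      have bp: "b \<notin> set p" using bC pC by blast
      have s0: "cnt b p \<noteq> 0"
      proof -
        obtain d where "d \<in> set p" "E d b" using b(1) Xtouch by blast
        then show ?thesis using cnt_pos[of d p b] sym[of d b] by blast
      qed
      show False
      proof (cases "cnt b p = 1")
        case s1: True
        obtain w where w: "w \<in> set p" "E w b" using b(1) Xtouch by blast
        have wu: "d = w" if "d \<in> set p" "E d b" for d
          using cnt_1_unique[OF s1 dp that(1) w(1)] sym[OF that(2)] sym[OF w(2)] by blast
        obtain \<alpha> \<beta> where ab: "p = \<alpha> @ w # \<beta>" using w(1) by (meson split_list)
        show False
        proof (rule no_path_claw[OF C ab p(2) pC, of a1 a2 b "{}"])
          show "distinct [a1, a2, b]" "{a1, a2, b} \<subseteq> set C" using a12 a1 a2 b bC by auto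
          show "E d z \<longleftrightarrow> (d = hd p \<and> z = a1) \<or> (d = last p \<and> z = a2) \<or> (d = w \<and> z = b \<and> {} = {})"
            if "d \<in> set p" "z \<in> set C" for d z
            using att[OF that] wu[OF that(1)] w(2) p(4,5) by blast
          show "link w (set C) {} b" using w(2) by (simp add: link_def)
        qed auto
      next
        case False
        then have s2: "2 \<le> cnt b p" using s0 by linarith
        \<comment> \<open>The arc from \<open>a1\<close> to \<open>a2\<close> avoiding
          \<open>b\<close>, closed by \<open>p\<close>, is a hole. Without wheels \<open>b\<close>
          has at most two neighbours on it, hence exactly two, both on \<open>p\<close>; the arc
          \<open>U\<close> then links \<open>b\<close> to \<open>a1\<close>.\<close>
        have key: False if C': "ihole (b # U @ a1 # Y @ a2 # W)" "set (b # U @ a1 # Y @ a2 # W) = set C" for U Y W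
        proof -
          let ?Q = "a1 # Y @ [a2]"
          let ?R = "U @ a1 # Y @ a2 # W"
          have ipR: "ipath ?R" and bR: "\<And>z. z \<in> set ?R \<Longrightarrow> E b z \<longleftrightarrow> z = hd ?R \<or> z = last ?R"
            using ihole_Cons[OF C'(1)] by blast+
          have dC': "distinct (b # ?R)" using ihole_distinct[OF C'(1)] .
          have Rs: "?R = U @ ?Q @ W" by simp
          have ipU: "ipath U" and ipQ: "ipath ?Q"
            using ipath_appendD(1)[OF ipR] ipath_appendD(1)[OF ipath_appendD(2)[OF ipR[unfolded Rs]]] by blast+
          have H: "ihole (?Q @ rev p)"
          proof -
            have "E u v \<longleftrightarrow> (u = last ?Q \<and> v = hd (rev p)) \<or> (u = hd ?Q \<and> v = last (rev p))"
              if "u \<in> set ?Q" "v \<in> set (rev p)" for u v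
            proof -
              have "u \<in> set C" "u \<noteq> b" using that(1) C'(2) dC' by auto
              then show ?thesis using att[of v u] that(2) sym_iff[of u v] p(1,4,5) a12 by (auto simp: hd_rev last_rev)
            qed
            moreover have "set ?Q \<inter> set (rev p) = {}" using C'(2) pC by auto
            moreover have "4 \<le> length (?Q @ rev p)" using pm by simp
            ultimately show ?thesis using ihole_append[of ?Q "rev p"] ipQ p(1,2) by simp
          qed
          have bH: "b \<notin> set (?Q @ rev p)" using dC' bp by auto
          have cH: "cnt b (?Q @ rev p) = cnt b ?Q + cnt b p" by (simp only: cnt_simps)
          have "cnt b (?Q @ rev p) \<le> 2" by (rule le_2[OF H bH])
          then have e: "cnt b p = 2" "cnt b ?Q = 0" using cH s2 by linarith+
          then have nba: "\<not> E b a1" using cnt_0_iff[of b ?Q] by simp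
          have Une: "U \<noteq> []"
          proof
            assume "U = []"
            then show False using bR[of a1] nba by simp
          qed
          have lU: "E u z \<longleftrightarrow> u = last U \<and> z = a1" if "u \<in> set U" "z \<in> set (?Q @ W)" for u z
          proof -
            have "\<forall>u\<in>set U. \<forall>z\<in>set (?Q @ W). E u z \<longleftrightarrow> u = last U \<and> z = hd (?Q @ W)"
              using ipR unfolding Rs ipath_append[of U] by blast
            from bspec[OF bspec[OF this that(1)] that(2)] show ?thesis by (simp only: append_Cons list.sel)
          qed
          show False
          proof (rule no_two_spokes_link[OF H bH, of "set U" a1])
            show "cnt b (?Q @ rev p) = 2" using cH e by linarith
            show "conn (set U)" using conn_ipath[OF ipU Une] .
            show "b \<notin> set U" using dC' by auto
            show "set U \<inter> set (?Q @ rev p) = {}" using dC' C'(2) pC by auto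
            show "touches (set U) b" using bR[of "hd U"] Une unfolding touches_sym by auto
            show "a1 \<in> set (?Q @ rev p)" by simp
            show "\<not> E b a1" by fact
            show "touches (set U) z \<longleftrightarrow> z = a1" if z: "z \<in> set (?Q @ rev p)" for z
            proof
              assume "touches (set U) z"
              then obtain u where u: "u \<in> set U" "E u z" unfolding touches_def by blast
              have uC: "u \<in> set C" "u \<noteq> a1" "u \<noteq> a2" "u \<noteq> b" using u(1) C'(2) dC' by auto
              have "z \<notin> set p" using att[of z u] uC sym[OF u(2)] by blast
              then have "z \<in> set (?Q @ W)" using z by auto
              then show "z = a1" using lU[OF u(1)] u(2) by blast
            next
              assume "z = a1"
              then show "touches (set U) z" using lU[of "last U" a1] Une unfolding touches_def by auto
            qed
          qed
        qed
        obtain c' where c': "ihole (b # c')" "set (b # c') = set C" using ihole_start[OF C bC] by blast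
        have "a1 \<in> set c'" "a2 \<in> set c'" using c'(2) a1(1) a2(1) b by auto
        then obtain U R where UR: "c' = U @ a1 # R" by (meson split_list)
        show False
        proof (cases "a2 \<in> set R")
          case True
          then obtain Y W where "R = Y @ a2 # W" by (meson split_list)
          then show False using key[of U Y W] c' UR by simp
        next
          case False
          then have "a2 \<in> set U" using \<open>a2 \<in> set c'\<close> UR a12 by auto
          then obtain U1 U2 where U: "U = U1 @ a2 # U2" by (meson split_list)
          have "ihole (rev (b # c'))" by (rule ihole_rev[OF c'(1)])
          then have "ihole (rev c' @ [b])" by simp
          from ihole_rotate[OF this] have "ihole (b # rev R @ a1 # rev U2 @ a2 # rev U1)" by (simp add: UR U)
          moreover have "set (b # rev R @ a1 # rev U2 @ a2 # rev U1) = set C" unfolding c'(2)[symmetric] UR U by auto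
          ultimately show False by (rule key)
        qed
      qed
    next
      case False
      then obtain b' where b': "b' \<in> X" "b' \<noteq> a1" "b' \<noteq> a2" "b' \<noteq> b" by blast
      have "a1 \<in> X" "a2 \<in> X" using Xtouch[of a1] Xtouch[of a2] a1(1,2) a2(1,2) pm by auto
      then have "card {a1, a2, b, b'} \<le> card X"
        using card_mono[OF finX, of "{a1, a2, b, b'}"] b(1) b'(1) by simp
      then have c4: "4 \<le> card X" using a12 b b' by simp
      define N1 where "N1 = {z \<in> set C. E d1 z}"
      define N2 where "N2 = {z \<in> set C. E d2 z}"
      define A1 where "A1 = attachments C (D - {d1})"
      define A2 where "A2 = attachments C (D - {d2})"
      have fin: "finite N1" "finite N2" "finite A1" "finite A2" by (simp_all add: N1_def N2_def A1_def A2_def)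
      have cards: "card N1 \<le> 2" "card N2 \<le> 2" "card A1 \<le> 2" "card A2 \<le> 2"
        using vert[OF d1(1)] vert[OF d2(1)] small[OF d1(2)] small[OF d2(3)] d1(1) d2(1)
        unfolding N1_def N2_def A1_def A2_def by blast+
      have XA: "X = A1 \<union> N1" "X = A2 \<union> N2"
        unfolding X_def A1_def A2_def N1_def N2_def attachments_def touches_def using d1(1) d2(1) by blast+
      \<comment> \<open>\<open>X\<close> is covered by the neighbours of \<open>d1\<close> and the
        attachments of the rest, at most two each. Having four elements forces equality and
        disjointness; likewise for \<open>d2\<close>.\<close>
      have e1: "card N1 = 2" "card A1 = 2" "A1 \<inter> N1 = {}"
      proof -
        have "card X + card (A1 \<inter> N1) = card A1 + card N1" using card_Un_Int[OF fin(3,1)] XA(1) by simp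
        then have "card (A1 \<inter> N1) = 0" "card N1 = 2" "card A1 = 2" using c4 cards by linarith+
        then show "card N1 = 2" "card A1 = 2" "A1 \<inter> N1 = {}" using fin by auto
      qed
      have e2: "card N2 = 2" "card A2 = 2" "A2 \<inter> N2 = {}"
      proof -
        have "card X + card (A2 \<inter> N2) = card A2 + card N2" using card_Un_Int[OF fin(4,2)] XA(2) by simp
        then have "card (A2 \<inter> N2) = 0" "card N2 = 2" "card A2 = 2" using c4 cards by linarith+
        then show "card N2 = 2" "card A2 = 2" "A2 \<inter> N2 = {}" using fin by auto
      qed
      \<comment> \<open>Hence the inner vertices of \<open>p\<close> have no attachments: theirs
        would lie in both \<open>A1\<close> and \<open>A2\<close>, which are disjoint.\<close>
      have NA: "N1 = A2" "N2 = A1"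
      proof -
        have "N1 \<subseteq> A2" "N2 \<subseteq> A1"
          unfolding N1_def N2_def A1_def A2_def attachments_def touches_def using d1(1) d2(1,2) by blast+
        then show "N1 = A2" "N2 = A1" using card_seteq[OF fin(4), of N1] card_seteq[OF fin(3), of N2] e1 e2 by simp_all
      qed
      have N12: "N1 \<inter> N2 = {}" using e1(3) NA by blast
      obtain a' where N1: "N1 = {a1, a'}" "a1 \<noteq> a'"
      proof -
        have i: "a1 \<in> N1" using a1 N1_def by simp
        then have "card (N1 - {a1}) = 1" using e1(1) fin(1) by simp
        then obtain z where z: "N1 - {a1} = {z}" by (meson card_1_singletonE)
        then have "N1 = {a1, z}" "a1 \<noteq> z" using i by blast+
        then show ?thesis by (rule that)
      qed
      obtain f1 f2 where N2: "N2 = {f1, f2}" "f1 \<noteq> f2" using e2(1) by (meson card_2_iff)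
      have attN: "E d z \<longleftrightarrow> (d = d1 \<and> z \<in> N1) \<or> (d = d2 \<and> z \<in> N2)" if "d \<in> set p" "z \<in> set C" for d z
      proof
        assume e: "E d z"
        show "(d = d1 \<and> z \<in> N1) \<or> (d = d2 \<and> z \<in> N2)"
        proof (rule ccontr)
          assume neg: "\<not> ?thesis"
          have "d \<noteq> d1" using neg e that(2) by (auto simp: N1_def)
          moreover have "d \<noteq> d2" using neg e that(2) by (auto simp: N2_def)
          ultimately have "d \<in> D - {d1}" "d \<in> D - {d2}" using that(1) DP by simp_all
          then have "z \<in> A1" "z \<in> A2" unfolding A1_def A2_def using attI[OF that(2) _ e] by simp_all
          then show False using N12 NA by blast
        qed
      next
        assume "(d = d1 \<and> z \<in> N1) \<or> (d = d2 \<and> z \<in> N2)"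
        then show "E d z" unfolding N1_def N2_def by blast
      qed
      obtain c' where c': "ihole (a1 # c')" "set (a1 # c') = set C" using ihole_start[OF C a1(1)] by blast
      have a'N: "a' \<in> N1" using N1(1) by simp
      then have a'C: "a' \<in> set C" "E d1 a'" by (simp_all add: N1_def)
      then have "a' \<in> set c'" using c'(2) N1(2) by auto
      then obtain A B where AB: "c' = A @ a' # B" by (meson split_list)
      have H: "ihole (a1 # A @ a' # B)" using c'(1) AB by simp
      have setC: "set (a1 # A @ a' # B) = set C" using c'(2) AB by simp
      have naa: "\<not> E a1 a'" using no_triangle[OF a1(2), of a'] a'C(2) by blast
      have a1c: "E a1 z \<longleftrightarrow> z = hd c' \<or> z = last c'" if "z \<in> set c'" for z
        using ihole_Cons[OF c'(1)] that by blast
      have Ane: "A \<noteq> []" using a1c[of a'] naa AB by auto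
      have Bne: "B \<noteq> []" using a1c[of a'] naa AB by auto
      have H': "ihole (a' # B @ a1 # A)" using ihole_rotate[of "a1 # A" "a' # B"] H by simp
      have setC': "set (a' # B @ a1 # A) = set C" using setC by auto
      have p': "ipath (d1 # m @ [d2])" "set (d1 # m @ [d2]) \<inter> set C = {}" using p(2) pC pm by simp_all
      have att1: "E d z \<longleftrightarrow> (d = d1 \<and> (z = a1 \<or> z = a')) \<or> (d = d2 \<and> (z = b \<or> z = b'))"
        if "N2 = {b, b'}" "d \<in> set (d1 # m @ [d2])" "z \<in> set C" for d z b b'
        using attN[of d z] that N1 pm by auto
      have att2: "E d z \<longleftrightarrow> (d = d1 \<and> (z = a' \<or> z = a1)) \<or> (d = d2 \<and> (z = b \<or> z = b'))"
        if "N2 = {b, b'}" "d \<in> set (d1 # m @ [d2])" "z \<in> set C" for d z b b'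
        using att1[OF that] by blast
      have dC: "distinct (a1 # A @ a' # B)" using ihole_distinct[OF H] .
      \<comment> \<open>The attachments of \<open>d1\<close> and \<open>d2\<close> alternate on the
        hole. \<open>no_crossing\<close> in four orientations empties the four arcs between them, so
        the hole is \<open>a1 b a' b'\<close>.\<close>
      have cross: False if N2': "N2 = {b, b'}" and bA: "b \<in> set A" and bB: "b' \<in> set B" for b b'
      proof -
        obtain B1 B2 where B: "B = B1 @ b' # B2" using bB by (meson split_list)
        obtain A1 A2 where A: "A = A1 @ b # A2" using bA by (meson split_list)
        have N2s: "N2 = {b', b}" using N2' by auto
        have B1: "B1 = []"
        proof (rule ccontr)
          assume ne: "B1 \<noteq> []"
          have h: "ihole (a1 # A @ a' # B1 @ b' # B2)" using H B by simp
          have s: "set (a1 # A @ a' # B1 @ b' # B2) = set C" using setC B by simp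
          show False
            by (rule no_crossing[OF h p'(1), unfolded s, OF p'(2) att1[OF N2']]) (use bA ne in auto)
        qed
        have B2: "B2 = []"
        proof (rule ccontr)
          assume ne: "B2 \<noteq> []"
          have "ihole (rev (a1 # A @ a' # B))" by (rule ihole_rev[OF H])
          then have "ihole ((rev B2 @ b' # rev B1) @ (a' # rev A @ [a1]))" by (simp add: B)
          from ihole_rotate[OF this] have h: "ihole (a' # rev A @ a1 # rev B2 @ b' # rev B1)" by simp
          have s: "set (a' # rev A @ a1 # rev B2 @ b' # rev B1) = set C" unfolding setC[symmetric] B by auto
          show False
            by (rule no_crossing[OF h p'(1), unfolded s, OF p'(2) att2[OF N2']]) (use bA ne in auto)
        qed
        have A1: "A1 = []"
        proof (rule ccontr)
          assume ne: "A1 \<noteq> []"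
          have h: "ihole (a' # B @ a1 # A1 @ b # A2)" using H' A by simp
          have s: "set (a' # B @ a1 # A1 @ b # A2) = set C" using setC' A by simp
          show False
            by (rule no_crossing[OF h p'(1), unfolded s, OF p'(2) att2[OF N2s]]) (use bB ne in auto)
        qed
        have A2: "A2 = []"
        proof (rule ccontr)
          assume ne: "A2 \<noteq> []"
          have "ihole (rev (a' # B @ a1 # A))" by (rule ihole_rev[OF H'])
          then have "ihole ((rev A2 @ b # rev A1) @ (a1 # rev B @ [a']))" by (simp add: A)
          from ihole_rotate[OF this] have h: "ihole (a1 # rev B @ a' # rev A2 @ b # rev A1)" by simp
          have s: "set (a1 # rev B @ a' # rev A2 @ b # rev A1) = set C" unfolding setC[symmetric] A by auto
          show False
            by (rule no_crossing[OF h p'(1), unfolded s, OF p'(2) att1[OF N2s]]) (use bB ne in auto)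
        qed
        have C4: "ihole [a1, b, a', b']" using H A B A1 A2 B1 B2 by simp
        have sC: "set C = {a1, b, a', b'}" using setC A B A1 A2 B1 B2 by auto
        have dist: "distinct [a1, b, a', b']" using ihole_distinct[OF C4] .
        have edges: "E a1 b" "E b a'" "E a' b'" "E a1 b'" "\<not> E a1 a'" "\<not> E b b'"
        proof -
          have ipb: "ipath [b, a', b']" and a1v: "\<forall>v\<in>set [b, a', b']. E a1 v \<longleftrightarrow> v = b \<or> v = b'"
            using C4 by (simp_all add: ihole_def)
          show "E a1 b" "E a1 b'" using a1v by simp_all
          show "\<not> E a1 a'" by (rule naa)
          show "E b a'" "E a' b'" using ipb by simp_all
          show "\<not> E b b'" using ipb dist by auto
        qed
        have inC: "a1 \<in> set C" "a' \<in> set C" "b \<in> set C" "b' \<in> set C" using sC by auto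
        have dm: "d1 \<in> set (d1 # m @ [d2])" "d2 \<in> set (d1 # m @ [d2])" by auto
        note att1d = att1[OF N2' dm(1)] att1[OF N2' dm(2)]
        have d1e: "E d1 a1" "E d1 a'" "\<not> E d1 b" "\<not> E d1 b'" and d2e: "E d2 b" "E d2 b'" "\<not> E d2 a1" "\<not> E d2 a'"
          using att1d(1)[OF inC(1)] att1d(1)[OF inC(2)] att1d(1)[OF inC(3)] att1d(1)[OF inC(4)]
            att1d(2)[OF inC(1)] att1d(2)[OF inC(2)] att1d(2)[OF inC(3)] att1d(2)[OF inC(4)] dist d2(2) by auto
        have nd: "d1 \<notin> set C" "d2 \<notin> set C" using p'(2) by auto
        show False
        proof (cases "m = []")
          \<comment> \<open>With \<open>d1\<close> and \<open>d2\<close> adjacent, the six vertices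
            form a K_{3,3} with sides \<open>a1, a', d2\<close> and
            \<open>b, b', d1\<close>.\<close>
          case True
          then have "E d2 d1" using p'(1) sym[of d1 d2] by simp
          moreover have "distinct [a1, a', d2, b, b', d1]" using dist nd sC d2(2) by auto
          moreover have "\<forall>u\<in>{a1, a', d2}. \<forall>v\<in>{b, b', d1}. E u v"
            using edges(1,3,4) sym[OF edges(2)] sym[OF d1e(1)] sym[OF d1e(2)] d2e(1,2) \<open>E d2 d1\<close> by simp
          ultimately show False using no_K33[of a1 a' d2 b b' d1] by blast
        next
          \<comment> \<open>Replacing \<open>b'\<close> by \<open>d1\<close> gives the hole
            \<open>a1 d1 a' b\<close>, on which \<open>b'\<close> sees just \<open>a1\<close> and
            \<open>a'\<close>; the vertex \<open>d2\<close> links \<open>b'\<close> to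
            \<open>b\<close>.\<close>
          case False
          have nd12: "\<not> E d1 d2"
          proof
            assume "E d1 d2"
            then have "d2 = hd m" using p'(1) False by (auto simp: hd_append)
            then show False using dp pm False by auto
          qed
          have h: "ihole [a1, d1, a', b]"
            unfolding ihole_def using edges d1e dist nd sC sym_iff[of a1 d1] sym_iff[of b a'] by auto
          show False
          proof (rule no_two_spokes_link[OF h, of b' "{d2}" b])
            show "b' \<notin> set [a1, d1, a', b]" using dist nd sC by auto
            show "cnt b' [a1, d1, a', b] = 2"
              using edges d1e sym_iff[of b' a1] sym_iff[of b' a'] sym_iff[of b' d1] sym_iff[of b' b] by simp
            show "b' \<notin> {d2}" "{d2} \<inter> set [a1, d1, a', b] = {}" using nd sC d2(2) by auto
            show "touches {d2} b'" using d2e by (simp add: touches_def)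
            show "\<not> E b' b" using edges sym_iff[of b' b] by blast
            show "touches {d2} z \<longleftrightarrow> z = b" if "z \<in> set [a1, d1, a', b]" for z
              using that d2e nd12 sym_iff[of d2 d1] nd sC by (auto simp: touches_def)
          qed auto
        qed
      qed
      have fAB: "f \<in> set A \<or> f \<in> set B" if "f \<in> N2" for f
      proof -
        have "f \<in> set C" using that by (simp add: N2_def)
        moreover have "f \<noteq> a1" "f \<noteq> a'" using that N12 unfolding N1(1) by auto
        ultimately show ?thesis using setC[symmetric] by auto
      qed
      have nc1: False if "f1 \<in> set A" "f2 \<in> set A"
        by (rule no_noncrossing[OF H p'(1), unfolded setC, OF p'(2) att1[OF N2(1)] N2(2) that Bne])
      have nc2: False if "f1 \<in> set B" "f2 \<in> set B"
        by (rule no_noncrossing[OF H' p'(1), unfolded setC', OF p'(2) att2[OF N2(1)] N2(2) that Ane])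
      have "N2 = {f2, f1}" using N2(1) by auto
      then show False using nc1 nc2 cross[OF N2(1)] cross[of f2 f1] fAB[of f1] fAB[of f2] N2(1) by blast
    qed
  qed
qed

end

text \<open>
  Unlike being a subdivision of \<open>K\<^sub>4\<close>, this property is visibly preserved by subdividing an edge and by
  adding edges, and it descends to a shortest cycle, that is, to a hole.
\<close>

definition cycle_attached :: "('a \<Rightarrow> 'a \<Rightarrow> bool) \<Rightarrow> 'a set \<Rightarrow> bool" where
  "cycle_attached R U \<longleftrightarrow> (\<exists>Z D a b c. set Z \<union> D \<subseteq> U \<and> 3 \<le> length Z \<and> distinct Z \<and> successively R Z \<and> R (last Z) (hd Z)
     \<and> D \<inter> set Z = {} \<and> (\<forall>x\<in>D. \<forall>y\<in>D. (\<lambda>u v. u \<in> D \<and> v \<in> D \<and> R u v)\<^sup>*\<^sup>* x y)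
     \<and> distinct [a, b, c] \<and> {a, b, c} \<subseteq> set Z \<and> (\<exists>d\<in>D. R d a) \<and> (\<exists>d\<in>D. R d b) \<and> (\<exists>d\<in>D. R d c))"

lemma cycle_attached_mono:
  assumes "cycle_attached R U" "\<And>u v. R u v \<Longrightarrow> R' u v" "U \<subseteq> U'"
  shows "cycle_attached R' U'"
proof -
  obtain Z D a b c where Z: "set Z \<union> D \<subseteq> U" "3 \<le> length Z" "distinct Z" "successively R Z" "R (last Z) (hd Z)"
    "D \<inter> set Z = {}" and conn: "\<forall>x\<in>D. \<forall>y\<in>D. (\<lambda>u v. u \<in> D \<and> v \<in> D \<and> R u v)\<^sup>*\<^sup>* x y"
    and abc: "distinct [a, b, c]" "{a, b, c} \<subseteq> set Z" and d: "\<exists>d\<in>D. R d a" "\<exists>d\<in>D. R d b" "\<exists>d\<in>D. R d c"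
    using assms(1) unfolding cycle_attached_def by (elim exE conjE) (rule that; assumption)
  show ?thesis unfolding cycle_attached_def
  proof (intro exI conjI)
    show "set Z \<union> D \<subseteq> U'" using Z(1) assms(3) by blast
    show "successively R' Z" using Z(4) by (rule successively_mono) (rule assms(2))
    show "R' (last Z) (hd Z)" by (rule assms(2)[OF Z(5)])
    have "(\<lambda>u v. u \<in> D \<and> v \<in> D \<and> R u v)\<^sup>*\<^sup>* \<le> (\<lambda>u v. u \<in> D \<and> v \<in> D \<and> R' u v)\<^sup>*\<^sup>*"
      by (rule rtranclp_mono) (use assms(2) in blast)
    then show "\<forall>x\<in>D. \<forall>y\<in>D. (\<lambda>u v. u \<in> D \<and> v \<in> D \<and> R' u v)\<^sup>*\<^sup>* x y" using conn by (auto simp: le_fun_def)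
    show "\<exists>d\<in>D. R' d a" "\<exists>d\<in>D. R' d b" "\<exists>d\<in>D. R' d c" using d assms(2) by blast+
  qed (use Z(2,3,6) abc in simp_all)
qed

lemma not_successively_split:
  "\<not> successively P xs \<Longrightarrow> \<exists>\<alpha> p q \<beta>. xs = \<alpha> @ p # q # \<beta> \<and> \<not> P p q"
proof (induction xs rule: induct_list012)
  case (3 x y zs)
  show ?case
  proof (cases "P x y")
    case True
    then obtain \<alpha> p q \<beta> where "y # zs = \<alpha> @ p # q # \<beta>" "\<not> P p q" using 3 by auto
    then show ?thesis by (intro exI[of _ "x # \<alpha>"]) auto
  next
    case False
    then show ?thesis by (intro exI[of _ "[]"]) auto
  qed
qed auto

text \<open>The new vertex \<open>w\<close> is inserted into the cycle if \<open>u v\<close> is a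
  cycle edge, and into \<open>D\<close> if \<open>D\<close> contains an end of \<open>u v\<close>.
  The attachment vertices \<open>a\<close>, \<open>b\<close>, \<open>c\<close> stay the
  same.\<close>

lemma cycle_attached_subdivide:
  assumes att: "cycle_attached R U" and sym: "\<And>u v. R u v \<Longrightarrow> R v u"
    and uv: "R u v" "u \<noteq> v" and w: "w \<notin> U"
    and R': "\<And>x y. R' x y \<longleftrightarrow> (R x y \<and> (x, y) \<noteq> (u, v) \<and> (x, y) \<noteq> (v, u)) \<or> (x, y) \<in> {(u, w), (w, u), (w, v), (v, w)}"
  shows "cycle_attached R' (insert w U)"
proof -
  obtain Z D a b c where Z: "set Z \<union> D \<subseteq> U" "3 \<le> length Z" "distinct Z" "successively R Z" "R (last Z) (hd Z)"
    and DZ: "D \<inter> set Z = {}" and conn: "\<forall>x\<in>D. \<forall>y\<in>D. (\<lambda>u v. u \<in> D \<and> v \<in> D \<and> R u v)\<^sup>*\<^sup>* x y"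
    and abc: "distinct [a, b, c]" "{a, b, c} \<subseteq> set Z" and tch: "\<exists>d\<in>D. R d a" "\<exists>d\<in>D. R d b" "\<exists>d\<in>D. R d c"
    using att unfolding cycle_attached_def by (elim exE conjE) (rule that; assumption)
  \<comment> \<open>This covers edges inside \<open>D\<close> as well as those attaching
    \<open>D\<close> to the cycle. \<open>D'\<close> avoids the new cycle, since \<open>w\<close>
    enters the latter only if both \<open>u\<close> and \<open>v\<close> are on
    \<open>Z\<close>.\<close>
  define D' where "D' = (if u \<in> D \<or> v \<in> D then insert w D else D)"
  have wZD: "w \<notin> set Z" "w \<notin> D" using w Z(1) by auto
  let ?S = "\<lambda>x y. x \<in> D' \<and> y \<in> D' \<and> R' x y"
  have edge: "?S\<^sup>*\<^sup>* x y" if "x \<in> D" "y \<in> D" "R x y" for x y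
  proof (cases "(x, y) = (u, v) \<or> (x, y) = (v, u)")
    case True
    then have "?S x w" "?S w y" using that R' by (auto simp: D'_def)
    then show ?thesis by (rule converse_rtranclp_into_rtranclp[OF _ r_into_rtranclp])
  next
    case False
    then have "?S x y" using that R' by (auto simp: D'_def)
    then show ?thesis by blast
  qed
  have conD: "?S\<^sup>*\<^sup>* x y" if "x \<in> D" "y \<in> D" for x y
  proof -
    have "(\<lambda>u v. u \<in> D \<and> v \<in> D \<and> R u v)\<^sup>*\<^sup>* x y" using conn that by blast
    then show ?thesis
    proof (induction rule: rtranclp_induct)
      case base
      show ?case by simp
    next
      case (step y z)
      then show ?case using rtranclp_trans[OF step.IH edge[of y z]] by simp
    qed
  qed
  have conD': "?S\<^sup>*\<^sup>* x y" if xy: "x \<in> D'" "y \<in> D'" for x y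
  proof (cases "u \<in> D \<or> v \<in> D")
    case False
    then show ?thesis using conD xy by (simp add: D'_def)
  next
    case True
    then obtain e where e: "e \<in> D" "e = u \<or> e = v" by blast
    then have "?S e w" "?S w e" using R' by (auto simp: D'_def)
    then have ew: "?S\<^sup>*\<^sup>* e w" "?S\<^sup>*\<^sup>* w e" by blast+
    have toe: "?S\<^sup>*\<^sup>* z e \<and> ?S\<^sup>*\<^sup>* e z" if "z \<in> D'" for z
      using that conD e(1) ew by (auto simp: D'_def split: if_splits)
    show ?thesis by (rule rtranclp_trans[OF conjunct1[OF toe[OF xy(1)]] conjunct2[OF toe[OF xy(2)]]])
  qed
  have tch': "\<exists>d\<in>D'. R' d z" if z: "z \<in> set Z" "\<exists>d\<in>D. R d z" for z
  proof -
    obtain d where d: "d \<in> D" "R d z" using z(2) by blast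
    show ?thesis
    proof (cases "(d, z) = (u, v) \<or> (d, z) = (v, u)")
      case True
      then have "w \<in> D'" "R' w z" using d(1) R' by (auto simp: D'_def)
      then show ?thesis by blast
    next
      case False
      then have "d \<in> D'" "R' d z" using d R' by (auto simp: D'_def)
      then show ?thesis by blast
    qed
  qed
  have avoid: "successively R' xs" if "successively R xs" "(p, q) = (u, v) \<or> (p, q) = (v, u)" "p \<notin> set xs \<or> q \<notin> set xs" for xs p q
    using that(1)
  proof (rule successively_mono)
    fix x y assume "x \<in> set xs" "y \<in> set xs" "R x y"
    then show "R' x y" using that(2,3) R' by auto
  qed
  have "\<exists>Z'. set Z' \<subseteq> insert w (set Z) \<and> set Z \<subseteq> set Z' \<and> (w \<in> set Z' \<longrightarrow> u \<in> set Z \<and> v \<in> set Z)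
     \<and> 3 \<le> length Z' \<and> distinct Z' \<and> successively R' Z' \<and> R' (last Z') (hd Z')"
  proof (cases "successively R' Z")
    case False
    then obtain \<alpha> p q \<beta> where s: "Z = \<alpha> @ p # q # \<beta>" "\<not> R' p q" using not_successively_split by blast
    have Rpq: "R p q" using Z(4) unfolding s(1) by (simp add: successively_append_iff)
    then have pq: "(p, q) = (u, v) \<or> (p, q) = (v, u)" using s(2) R' by blast
    have sa: "successively R (\<alpha> @ [p])" and sb: "successively R (q # \<beta>)"
      using Z(4) unfolding s(1) by (auto simp: successively_append_iff)
    have "successively R' (\<alpha> @ [p])" by (rule avoid[OF sa pq]) (use Z(3) s(1) in auto)
    moreover have "successively R' (q # \<beta>)" by (rule avoid[OF sb pq]) (use Z(3) s(1) in auto)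
    moreover have "R' p w" "R' w q" using pq R' by auto
    ultimately have "successively R' ((\<alpha> @ [p]) @ w # q # \<beta>)" by (simp add: successively_append_iff)
    moreover have "R' (last (\<alpha> @ p # w # q # \<beta>)) (hd (\<alpha> @ p # w # q # \<beta>))"
    proof -
      have hl: "last (\<alpha> @ p # w # q # \<beta>) = last Z" "hd (\<alpha> @ p # w # q # \<beta>) = hd Z"
        unfolding s(1) by (cases \<alpha>; simp)+
      \<comment> \<open>The subdivided edge occurs only once on the cycle: it could also be the
        closing edge only if \<open>Z\<close> had just two vertices.\<close>
      have "(last Z, hd Z) \<noteq> (p, q)" "(last Z, hd Z) \<noteq> (q, p)"
      proof -
        show "(last Z, hd Z) \<noteq> (p, q)" using Z(3) unfolding s(1) by (cases \<beta> rule: rev_cases) auto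
        show "(last Z, hd Z) \<noteq> (q, p)"
        proof
          assume e: "(last Z, hd Z) = (q, p)"
          then have "\<beta> = []" using Z(3) unfolding s(1) by (cases \<beta> rule: rev_cases) auto
          moreover have "\<alpha> = []" using e Z(3) unfolding s(1) by (cases \<alpha>) auto
          ultimately show False using Z(2) s(1) by simp
        qed
      qed
      then have "(last Z, hd Z) \<noteq> (u, v)" "(last Z, hd Z) \<noteq> (v, u)" using pq by auto
      then show ?thesis unfolding hl using Z(5) R' by blast
    qed
    ultimately show ?thesis using Z(2,3) wZD pq by (intro exI[of _ "\<alpha> @ p # w # q # \<beta>"]) (auto simp: s(1))
  next
    case sZ: True
    show ?thesis
    proof (cases "R' (last Z) (hd Z)")
      case True
      then show ?thesis using Z sZ wZD by (intro exI[of _ Z]) auto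
    next
      case False
      then have pq: "(last Z, hd Z) = (u, v) \<or> (last Z, hd Z) = (v, u)" using Z(5) R' by blast
      then have "R' (last Z) w" "R' w (hd Z)" using R' by auto
      moreover have ne: "Z \<noteq> []" using Z(2) by auto
      ultimately have "successively R' (Z @ [w])" "R' (last (Z @ [w])) (hd (Z @ [w]))"
        using sZ by (auto simp: successively_append_iff)
      moreover have "u \<in> set Z" "v \<in> set Z" using pq hd_in_set[OF ne] last_in_set[OF ne] by auto
      ultimately show ?thesis using Z(2,3) wZD by (intro exI[of _ "Z @ [w]"]) auto
    qed
  qed
  then obtain Z' where Z': "set Z' \<subseteq> insert w (set Z)" "set Z \<subseteq> set Z'" "w \<in> set Z' \<longrightarrow> u \<in> set Z \<and> v \<in> set Z"
     "3 \<le> length Z'" "distinct Z'" "successively R' Z'" "R' (last Z') (hd Z')" by blast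
  have "D' \<inter> set Z' = {}" using Z'(1,3) DZ wZD unfolding D'_def by (auto split: if_splits)
  moreover have "set Z' \<union> D' \<subseteq> insert w U" using Z'(1) Z(1) unfolding D'_def by auto
  moreover have "{a, b, c} \<subseteq> set Z'" using abc(2) Z'(2) by blast
  moreover have "\<exists>d\<in>D'. R' d a" "\<exists>d\<in>D'. R' d b" "\<exists>d\<in>D'. R' d c"
    using tch'[of a] tch'[of b] tch'[of c] abc(2) tch by simp_all
  ultimately show ?thesis
    unfolding cycle_attached_def
    by (intro exI[of _ Z'] exI[of _ D'] exI[of _ a] exI[of _ b] exI[of _ c] conjI ballI conD' Z'(4-7) abc(1))
qed

text \<open>In K_4 itself take a triangle as the cycle and the fourth vertex as \<open>D\<close>;
  \<open>cycle_attached_subdivide\<close> carries this through every subdivision step.\<close>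

lemma K4_subdivision_cycle_attached:
  assumes "K4_subdivision H"
  shows "cycle_attached (\<lambda>u v. (u, v) \<in> parcs H) (pverts H)"
proof -
  obtain K where K: "complete_digraph 4 (with_proj K)" "subdivision_pair K H"
    using assms unfolding K4_subdivision_def by blast
  from K(2) show ?thesis
  proof (induction rule: subdivision_pair_induct)
    case base
    have K4: "finite (pverts K)" "card (pverts K) = 4" "parcs K = {(u, v). (u, v) \<in> pverts K \<times> pverts K \<and> u \<noteq> v}"
      using K(1) unfolding complete_digraph_pair_def by blast+
    obtain xs where xs: "set xs = pverts K" "distinct xs" using finite_distinct_list[OF K4(1)] by blast
    then have "length xs = 4" using K4(2) distinct_card by force
    then obtain a b c d where abcd: "xs = [a, b, c, d]"
      by (cases xs; cases "tl xs"; cases "tl (tl xs)"; cases "tl (tl (tl xs))"; cases "tl (tl (tl (tl xs)))") auto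
    have V: "pverts K = {a, b, c, d}" and dis: "distinct [a, b, c, d]" using xs abcd by auto
    show ?case unfolding cycle_attached_def K4(3) V
      by (rule exI[of _ "[a, b, c]"], rule exI[of _ "{d}"], rule exI[of _ a], rule exI[of _ b], rule exI[of _ c])
         (use dis in auto)
  next
    case (divide e w H)
    obtain u v where e: "e = (u, v)" by (cases e)
    interpret H: pair_bidirected_digraph H by (rule bidirected_digraphI_subdivision[OF divide(3)])
    have uv: "(u, v) \<in> parcs H" using divide(1) e by simp
    then have ne: "u \<noteq> v" using H.pair_no_loops[OF uv] by simp
    have "cycle_attached (\<lambda>x y. (x, y) \<in> parcs (subdivide H (u, v) w)) (insert w (pverts H))"
      by (rule cycle_attached_subdivide[OF divide(4) _ uv ne divide(2)]) (auto intro: H.arcs_symmetric)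
    then show ?case unfolding e by simp
  qed
qed

section \<open>Translation into the stated notions of containment, wheel and sector\<close>

context pair_graph
begin

lemma contains_induced:
  assumes "X \<subseteq> pverts G" "B = \<lparr>pverts = X, parcs = {(u, v). u \<in> X \<and> v \<in> X \<and> (u, v) \<in> parcs G}\<rparr>"
  shows "contains G B"
proof -
  have wf: "wf_digraph (with_proj B)" unfolding wf_digraph_wp_iff assms(2) by unfold_locales auto
  have "induced_subgraph (with_proj B) (with_proj G)"
    unfolding induced_subgraph_def subgraph_def using assms wf by (auto simp: compatible_def wf_digraph_wp_iff intro: pair_wf_digraph)
  moreover have "digraph_iso (with_proj B) (with_proj B)"
  proof -
    let ?f = "\<lparr>iso_verts = id, iso_arcs = id, iso_head = snd, iso_tail = fst\<rparr>"
    have "pre_digraph.digraph_isomorphism (with_proj B) ?f"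
      unfolding pre_digraph.digraph_isomorphism_def using wf by auto
    moreover have "with_proj B = app_iso ?f (with_proj B)" by (simp add: app_iso_def with_proj_def)
    ultimately show ?thesis unfolding digraph_iso_def by blast
  qed
  ultimately show ?thesis unfolding contains_def by blast
qed

end

context ISK4_triangle_free
begin

text \<open>An edge between rim vertices either joins the first vertex to an end of the chordless
  path \<open>p\<close> or is an edge of \<open>p\<close>; in both cases it is an arc of the closed
  walk in one of the two directions.\<close>

lemma wheel_def_eq:
  assumes "is_wheel c x"
  shows "wheel G c x"
proof -
  have c: "ihole c" "x \<notin> set c" "3 \<le> cnt x c" using assms by (auto simp: is_wheel_def)
  have len: "4 \<le> length c" using ihole_length[OF c(1)] .
  then obtain a p where ap: "c = a # p" by (cases c) auto
  have pne: "p \<noteq> []" using len ap by auto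
  have ipp: "ipath p" and ea: "\<forall>z\<in>set p. E a z \<longleftrightarrow> z = hd p \<or> z = last p" using ihole_Cons[of a p] c(1) ap by auto
  have walk: "successively E (c @ [a])"
  proof -
    have "successively E p" using ipath_successively[OF ipp] .
    moreover have "E a (hd p)" "E (last p) a" using ea pne sym[of a "last p"] by auto
    ultimately have "successively E (p @ [a])" "E a (hd (p @ [a]))" using pne by (simp_all add: successively_append_iff)
    then show ?thesis unfolding ap append_Cons successively_Cons by simp
  qed
  have arcs: "set (vwalk_arcs w) \<subseteq> parcs G" if "successively E w" for w
    using that by (induction w rule: vwalk_arcs.induct) auto
  have vs: "pawalk_verts (hd w) (vwalk_arcs w) = w" if "w \<noteq> []" for w :: "'a list"
    using that by (induction w rule: vwalk_arcs.induct) auto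
  have cas: "pcas (hd w) (vwalk_arcs w) (last w)" if "w \<noteq> []" for w :: "'a list"
    using that by (induction w rule: vwalk_arcs.induct) auto
  have ca: "cycle_arcs c = vwalk_arcs (c @ [a])" unfolding cycle_arcs_def ap by simp
  have aV: "a \<in> V" using ea pne E_V(1)[of a "hd p"] by auto
  have cyc: "pre_digraph.cycle (with_proj G) (cycle_arcs c)"
    unfolding ca cycle_def
  proof (intro exI[of _ a] conjI)
    have "pcas a (vwalk_arcs (c @ [a])) a" using cas[of "c @ [a]"] ap by simp
    then show "awalk a (vwalk_arcs (c @ [a])) a" unfolding awalk_def using aV arcs[OF walk] by simp
    have "pawalk_verts a (vwalk_arcs (c @ [a])) = c @ [a]" using vs[of "c @ [a]"] ap by simp
    then show "distinct (tl (pawalk_verts a (vwalk_arcs (c @ [a]))))"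
      using ihole_distinct[OF c(1)] ap by auto
    show "vwalk_arcs (c @ [a]) \<noteq> []" using pne ap by (cases p) auto
  qed
  have chord: "(u, v) \<in> set (cycle_arcs c) \<or> (v, u) \<in> set (cycle_arcs c)" if uv: "u \<in> set c" "v \<in> set c" "E u v" for u v
  proof -
    have sub: "(s, t) \<in> set (vwalk_arcs (\<alpha> @ s # t # \<beta>))" for s t :: 'a and \<alpha> \<beta>
      by (induction \<alpha> rule: vwalk_arcs.induct) auto
    have wa: "(u, v) \<in> set (vwalk_arcs w) \<or> (v, u) \<in> set (vwalk_arcs w)" if "(u, v) \<in> walk_arcs w" for u v :: 'a and w
      using that by (induction w rule: walk_arcs.induct) auto
    have mono: "set (vwalk_arcs p) \<subseteq> set (vwalk_arcs (c @ [a]))"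
    proof -
      have "set (vwalk_arcs p) \<subseteq> set (vwalk_arcs (p @ [a]))" by (rule set_vwalk_arcs_append1)
      also have "\<dots> \<subseteq> set (vwalk_arcs ([a] @ p @ [a]))" by (rule set_vwalk_arcs_append2)
      finally show ?thesis by (simp add: ap)
    qed
    have first: "(a, hd p) \<in> set (cycle_arcs c)" unfolding ca using pne by (cases p) (auto simp: ap)
    have lst: "(last p, a) \<in> set (cycle_arcs c)"
    proof -
      obtain p' l where pl: "p = p' @ [l]" using pne by (cases p rule: rev_cases) auto
      show ?thesis using sub[of l a "a # p'" "[]"] unfolding ca by (simp add: ap pl)
    qed
    have A: ?thesis if "u = a" "v \<in> set p" using ea uv(3) that first lst by auto
    have B: ?thesis if "v = a" "u \<in> set p" using ea sym[OF uv(3)] that first lst by auto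
    have C: ?thesis if "u \<in> set p" "v \<in> set p"
      using wa[of u v p] ipath_walk_arcs[OF ipp that] uv(3) mono unfolding ca by blast
    have "u \<noteq> v" using uv(3) irrefl by blast
    then show ?thesis using A B C uv(1,2) ap by auto
  qed
  have xV: "x \<in> V"
  proof -
    have "cnt x c \<noteq> 0" using c(3) by simp
    then show ?thesis using E_V(1) unfolding cnt_0_iff by blast
  qed
  have "{v \<in> set c. E x v} = nbrs G x \<inter> set c" unfolding nbrs_def by auto
  then have "3 \<le> card (nbrs G x \<inter> set c)" using c(3) cnt_card[OF ihole_distinct[OF c(1)], of x] by simp
  then show ?thesis unfolding wheel_def hole_def using len cyc chord xV c(2) by auto
qed

lemma filter_eq_appendD:
  "filter P c = as @ bs \<Longrightarrow> \<exists>c1 c2. c = c1 @ c2 \<and> filter P c1 = as \<and> filter P c2 = bs"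
proof (induction as arbitrary: c)
  case Nil
  then show ?case by (intro exI[of _ "[]"] exI[of _ c]) simp
next
  case (Cons a as)
  then have "filter P c = a # as @ bs" by simp
  then obtain us vs where v: "c = us @ a # vs" "\<forall>u\<in>set us. \<not> P u" "P a" "as @ bs = filter P vs"
    unfolding filter_eq_Cons_iff by blast
  obtain c1 c2 where c: "vs = c1 @ c2" "filter P c1 = as" "filter P c2 = bs"
    using Cons.IH[OF v(4)[symmetric]] by blast
  have "c = (us @ a # c1) @ c2" "filter P (us @ a # c1) = a # as" using v(1-3) c by (simp_all add: filter_empty_conv)
  then show ?case using c(3) by blast
qed

lemma ihole_rotate_n: "ihole c \<Longrightarrow> ihole (rotate k c)"
  using ihole_rotate[of "take (k mod length c) c" "drop (k mod length c) c"] by (simp add: rotate_drop_take)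

text \<open>Rotation to the spoke end \<open>xs ! i\<close> exposes the sector as an initial
  segment. The case \<open>Suc i = length xs\<close> is the sector running over the end of the list,
  from the last spoke to the first.\<close>

lemma sector_split:
  assumes w: "is_wheel c x" and xs: "xs = filter (E x) c" and i: "i < length xs"
  shows "\<exists>k t r. rotate k c = (xs ! i # t @ [xs ! (Suc i mod length xs)]) @ r \<and> cnt x t = 0"
proof (cases "Suc i < length xs")
  case True
  have e: "filter (E x) c = take i xs @ xs ! i # xs ! Suc i # drop (Suc (Suc i)) xs"
    unfolding xs[symmetric] by (simp add: True Cons_nth_drop_Suc Suc_lessD)
  obtain c1 c2 where c12: "c = c1 @ c2" "filter (E x) c2 = xs ! i # xs ! Suc i # drop (Suc (Suc i)) xs"
    using filter_eq_appendD[OF e] by blast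
  then obtain us vs where u: "c2 = us @ xs ! i # vs" "xs ! Suc i # drop (Suc (Suc i)) xs = filter (E x) vs"
    unfolding filter_eq_Cons_iff by blast
  then obtain t r where t: "vs = t @ xs ! Suc i # r" "\<forall>z\<in>set t. \<not> E x z"
    using filter_eq_Cons_iff[of "E x" vs "xs ! Suc i" "drop (Suc (Suc i)) xs"] by auto
  have "rotate (length (c1 @ us)) ((c1 @ us) @ xs ! i # t @ xs ! Suc i # r) = (xs ! i # t @ xs ! Suc i # r) @ c1 @ us"
    by (rule rotate_append)
  then have "rotate (length (c1 @ us)) c = (xs ! i # t @ [xs ! Suc i]) @ r @ c1 @ us"
    using c12(1) u(1) t(1) by simp
  moreover have "cnt x t = 0" using t(2) cnt_0_iff by blast
  moreover have "Suc i mod length xs = Suc i" using True by simp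
  ultimately show ?thesis by metis
next
  case False
  then have n: "length xs = Suc i" using i by simp
  have "cnt x c = length xs" using xs by (simp add: cnt_def)
  then have "2 \<le> cnt x c" using wheel_4[OF w] by simp
  then obtain Qa ya Qm yb Qb where Q: "c = Qa @ ya # Qm @ yb # Qb" "E x ya" "E x yb" "cnt x Qa = 0" "cnt x Qb = 0"
    by (rule first_last_spoke)
  have xs': "xs = ya # filter (E x) Qm @ [yb]" using Q unfolding xs cnt_0_iff by (simp add: filter_empty_conv)
  have li: "xs ! i = yb" "xs ! (Suc i mod length xs) = ya"
  proof -
    have "xs ! i = last xs" using n by (metis diff_Suc_1 last_conv_nth length_0_conv nat.distinct(1))
    then show "xs ! i = yb" using xs' by simp
    show "xs ! (Suc i mod length xs) = ya" using n xs' by simp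
  qed
  have "rotate (length (Qa @ ya # Qm)) ((Qa @ ya # Qm) @ yb # Qb) = (yb # Qb) @ Qa @ ya # Qm"
    by (rule rotate_append)
  then have "rotate (length (Qa @ ya # Qm)) c = (yb # (Qb @ Qa) @ [ya]) @ Qm" using Q(1) by simp
  moreover have "cnt x (Qb @ Qa) = 0" using Q by simp
  ultimately show ?thesis unfolding li by blast
qed

text \<open>A walk from the interior of the sector that avoids the cutset stays in the interior or
  in a connected set off the rim and off \<open>N[x]\<close> touching it. Reaching the rest of the
  rim would make that set a witness of \<open>bad c x\<close>.\<close>

lemma sector_separates:
  assumes w: "is_wheel c x" "\<not> bad c x" and xV: "x \<in> V"
    and rot: "rotate k c = (a # t @ [b]) @ r" and t: "cnt x t = 0" and ab: "E x a" "E x b"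
  shows "cutset_separating G ((insert x (nbrs G x) - set c) \<union> {a, b}) (set (a # t @ [b])) (set c - set (a # t @ [b]))"
proof -
  let ?Y = "a # t @ [b]"
  let ?C = "(insert x (nbrs G x) - set c) \<union> {a, b}"
  have c: "ihole c" "x \<notin> set c" using w(1) by (auto simp: is_wheel_def)
  have h: "ihole (?Y @ r)" using ihole_rotate_n[OF c(1), of k] rot by simp
  have setc: "set (?Y @ r) = set c" using rot by (metis set_rotate)
  have "cnt x (?Y @ r) = cnt x c" by (rule cnt_set_eq[OF ihole_distinct[OF h] ihole_distinct[OF c(1)] setc])
  then have "cnt x r \<noteq> 0" using wheel_4[OF w(1)] t ab by simp
  then have rne: "r \<noteq> []" by auto
  have Y: "csec (set c) x ?Y" by (rule csecI[OF h rne setc ab t])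
  have ipY: "ipath ?Y" "set ?Y \<subseteq> set c" using Y by (auto simp: csec_def)
  have tne: "t \<noteq> []" using ipY(1) no_triangle[OF ab(1), of b] ab(2) by auto
  have d: "distinct (?Y @ r)" using ihole_distinct[OF h] .
  have nt: "\<forall>z\<in>set t. \<not> E x z" using t cnt_0_iff by blast
  have rc: "set c - set ?Y = set r" using setc d by auto
  have cV: "set c \<subseteq> V"
  proof -
    have "set ?Y \<subseteq> V" by (rule ipath_V[OF ipY(1)]) simp
    moreover have "set (r @ [a]) \<subseteq> V"
    proof (rule ipath_V)
      have "ihole ((t @ [b]) @ (r @ [a]))" using ihole_rotate[of "[a]" "t @ [b] @ r"] h by simp
      then show "ipath (r @ [a])" using ihole_ipath[of "t @ [b]" "r @ [a]"] by simp
      show "2 \<le> length (r @ [a])" using rne by (cases r) auto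
    qed
    ultimately show ?thesis using setc by auto
  qed
  have CV: "?C \<subseteq> V" using xV cV setc E_V(2) unfolding nbrs_def by auto
  have tC: "set ?Y - ?C = set t"
  proof -
    have "set ?Y - ?C = set ?Y - {a, b}" using ipY(2) by auto
    also have "\<dots> = set t" using d by auto
    finally show ?thesis .
  qed
  have rC: "(set c - set ?Y) - ?C = set r" using rc by auto
  \<comment> \<open>Stated for any set \<open>A\<close> of edges because it is used twice: for
    directed reachability in the separation, and for the symmetric closure behind
    \<open>connected\<close>.\<close>
  have unreach: "(s, z) \<notin> rtrancl_on (V - ?C) A"
    if s: "s \<in> set t" and z: "z \<in> set r" and A: "\<And>u v. (u, v) \<in> A \<Longrightarrow> E u v" for s z A
  proof
    assume "(s, z) \<in> rtrancl_on (V - ?C) A"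
    then have "z \<in> set t \<or> (\<exists>D. conn D \<and> z \<in> D \<and> D \<subseteq> V - set c \<and> x \<notin> D \<and> (\<forall>d\<in>D. \<not> E x d) \<and> (\<exists>z\<in>set t. touches D z))"
    proof (induction rule: rtrancl_on_induct)
      case base
      then show ?case using s by blast
    next
      case (step u v)
      have e: "E u v" using A step(2) by blast
      show ?case
      proof (cases "v \<in> set c")
        case vc: True
        have "v \<in> set ?Y"
          using step(5)
        proof
          assume "u \<in> set t"
          then show ?thesis by (rule hole_inner_nbr[OF c(1) ipY _ vc e])
        next
          assume "\<exists>D. conn D \<and> u \<in> D \<and> D \<subseteq> V - set c \<and> x \<notin> D \<and> (\<forall>d\<in>D. \<not> E x d) \<and> (\<exists>z\<in>set t. touches D z)"
          then obtain D where D: "conn D" "u \<in> D" "D \<subseteq> V - set c" "x \<notin> D" "\<forall>d\<in>D. \<not> E x d" "\<exists>z\<in>set t. touches D z" by blast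
          have tv: "touches D v" using D(2) e unfolding touches_def by blast
          show ?thesis
          proof (rule ccontr)
            assume "v \<notin> set ?Y"
            then have "\<exists>z\<in>set c - set ?Y. touches D z" using vc tv by blast
            then have "bad c x" unfolding bad_def using Y nt D by blast
            then show False using w(2) by blast
          qed
        qed
        moreover have "v \<noteq> a" "v \<noteq> b" using step(4) by auto
        ultimately show ?thesis by auto
      next
        case vc: False
        then have vx: "v \<noteq> x" "\<not> E x v" "v \<in> V" using step(4) unfolding nbrs_def by auto
        from step(5) show ?thesis
        proof
          assume ut: "u \<in> set t"
          have "touches {v} u" using sym[OF e] by (simp add: touches_def)
          then have "conn {v} \<and> v \<in> {v} \<and> {v} \<subseteq> V - set c \<and> x \<notin> {v} \<and> (\<forall>d\<in>{v}. \<not> E x d) \<and> (\<exists>z\<in>set t. touches {v} z)"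
            using ut vc vx by auto
          then show ?thesis by blast
        next
          assume "\<exists>D. conn D \<and> u \<in> D \<and> D \<subseteq> V - set c \<and> x \<notin> D \<and> (\<forall>d\<in>D. \<not> E x d) \<and> (\<exists>z\<in>set t. touches D z)"
          then obtain D where D: "conn D" "u \<in> D" "D \<subseteq> V - set c" "x \<notin> D" "\<forall>d\<in>D. \<not> E x d" "\<exists>z\<in>set t. touches D z" by blast
          have "touches D v" using D(2) e unfolding touches_def by blast
          then have "conn (insert v D)" by (rule conn_insert[OF D(1)])
          moreover have "\<exists>z\<in>set t. touches (insert v D) z" using D(6) unfolding touches_def by blast
          ultimately have "conn (insert v D) \<and> v \<in> insert v D \<and> insert v D \<subseteq> V - set c \<and> x \<notin> insert v D
            \<and> (\<forall>d\<in>insert v D. \<not> E x d) \<and> (\<exists>z\<in>set t. touches (insert v D) z)"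
            using D(3-5) vc vx by auto
          then show ?thesis by blast
        qed
      qed
    qed
    then show False
    proof
      assume "z \<in> set t" then show False using z d by auto
    next
      assume "\<exists>D. conn D \<and> z \<in> D \<and> D \<subseteq> V - set c \<and> x \<notin> D \<and> (\<forall>d\<in>D. \<not> E x d) \<and> (\<exists>z\<in>set t. touches D z)"
      then show False using z setc by auto
    qed
  qed
  have arcs: "E u v" if "(u, v) \<in> arcs_ends (delete_verts G ?C)" for u v
    using that unfolding delete_verts_def arcs_ends_conv induce_subgraph_def by auto
  have vd: "verts (delete_verts G ?C) = V - ?C" by (simp add: delete_verts_def)
  have nr: "\<not> s \<rightarrow>\<^sup>*\<^bsub>delete_verts G ?C\<^esub> z" if "s \<in> set t" "z \<in> set r" for s z
    unfolding reachable_def vd using unreach[OF that, of "arcs_ends (delete_verts G ?C)"] arcs by blast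
  obtain s0 z0 where s0: "s0 \<in> set t" and z0: "z0 \<in> set r" using tne rne by (meson hd_in_set)
  have "s0 \<in> set ?Y - ?C" "z0 \<in> (set c - set ?Y) - ?C" unfolding tC rC by fact+
  moreover have "s0 \<in> V" "z0 \<in> V" using s0 z0 setc cV by auto
  ultimately have s0V: "s0 \<in> V - ?C" and z0V: "z0 \<in> V - ?C" by simp_all
  have "\<not> Digraph_Component.connected (delete_verts G ?C)"
  proof
    assume "Digraph_Component.connected (delete_verts G ?C)"
    then have "s0 \<rightarrow>\<^sup>*\<^bsub>mk_symmetric (delete_verts G ?C)\<^esub> z0"
      using s0V z0V vd unfolding connected_def strongly_connected_def by simp
    moreover have "E u v" if uv: "(u, v) \<in> parcs (mk_symmetric (delete_verts G ?C))" for u v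
    proof -
      have "(u, v) \<in> arcs_ends (delete_verts G ?C) \<or> (v, u) \<in> arcs_ends (delete_verts G ?C)"
        using uv unfolding parcs_mk_symmetric arcs_ends_conv by auto
      then show ?thesis using arcs[of u v] sym[OF arcs[of v u]] by blast
    qed
    ultimately show False
      using unreach[OF s0 z0, of "parcs (mk_symmetric (delete_verts G ?C))"] vd unfolding reachable_def by simp
  qed
  then have "cutset G ?C" unfolding cutset_def using CV s0V by blast
  then show ?thesis unfolding cutset_separating_def tC rC using tne rne nr by auto
qed

lemma wheel_decompositionI:
  assumes w: "is_wheel c x" "\<not> bad c x"
  shows "wheel_decomposition G"
proof -
  define xs where "xs = filter (E x) c"
  have xV: "x \<in> V"
  proof -
    have "cnt x c \<noteq> 0" using wheel_4[OF w(1)] by simp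
    then show ?thesis using E_V(1) unfolding cnt_0_iff by blast
  qed
  have se: "spoke_ends G c x = xs" unfolding spoke_ends_def nbrs_def xs_def by simp
  have "\<exists>S. sector G c x (xs ! i) (xs ! (Suc i mod length xs)) S \<and>
           cutset_separating G ((insert x (nbrs G x) - set c) \<union> {xs ! i, xs ! (Suc i mod length xs)}) (set S) (set c - set S)"
    if i: "i < length xs" for i
  proof -
    let ?a = "xs ! i" and ?b = "xs ! (Suc i mod length xs)"
    obtain k t r where k: "rotate k c = (?a # t @ [?b]) @ r" "cnt x t = 0" using sector_split[OF w(1) xs_def i] by blast
    have "?a \<in> set xs" "?b \<in> set xs" using i by (auto intro!: nth_mem mod_less_divisor)
    then have ab: "E x ?a" "E x ?b" unfolding xs_def by auto
    have "take (length (?a # t @ [?b])) (rotate k c) = ?a # t @ [?b]" unfolding k(1) by simp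
    then have "sector G c x ?a ?b (?a # t @ [?b])"
      unfolding sector_def using k(2) unfolding cnt_0_iff nbrs_def
      by (intro conjI exI[of _ k] exI[of _ "length (?a # t @ [?b])"]) (auto simp del: length_Cons length_append)
    then show ?thesis using sector_separates[OF w xV k ab] by blast
  qed
  then show ?thesis unfolding wheel_decomposition_def Let_def using wheel_def_eq[OF w(1)] se by metis
qed

end

theorem theorem3p9:
  fixes G :: "'a pair_pre_digraph"
  assumes "pair_graph G"
    and "\<not> (\<exists>T :: 'a pair_pre_digraph. complete_digraph 3 (with_proj T) \<and> contains G T)"
    and "\<not> (\<exists>H. ISK4 H G)"
    and "\<not> (\<exists>B :: 'a pair_pre_digraph. complete_bipartite_digraph 3 3 (with_proj B) \<and> contains G B)"
  shows "series_parallel G \<or> wheel_decomposition G"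
proof (rule ccontr)
  assume neg: "\<not> ?thesis"
  interpret pg: pair_graph G by fact
  have tri: "(u, w) \<notin> parcs G" if "(u, v) \<in> parcs G" "(v, w) \<in> parcs G" for u v w
  proof
    assume uw: "(u, w) \<in> parcs G"
    let ?T = "\<lparr>pverts = {u, v, w}, parcs = {(x, y). x \<in> {u, v, w} \<and> y \<in> {u, v, w} \<and> (x, y) \<in> parcs G}\<rparr>"
    have ne: "u \<noteq> v" "v \<noteq> w" "u \<noteq> w" using pg.pair_no_loops[OF that(1)] pg.pair_no_loops[OF that(2)] pg.pair_no_loops[OF uw] by simp_all
    have nl: "(y, y) \<notin> parcs G" for y using pg.pair_no_loops[of "(y, y)"] by auto
    have s: "(v, u) \<in> parcs G" "(w, v) \<in> parcs G" "(w, u) \<in> parcs G" using that uw pg.arcs_symmetric by blast+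
    have "complete_digraph 3 (with_proj ?T)"
      unfolding complete_digraph_pair_def using ne s that uw nl[of u] nl[of v] nl[of w] by auto
    moreover have "contains G ?T" by (rule pg.contains_induced[OF _ refl]) (use that uw pg.in_arcsD1 pg.in_arcsD2 in blast)
    ultimately show False using assms(2) by blast
  qed
  interpret ISK4_triangle_free G
  proof (rule ISK4_triangle_free.intro)
    show "pair_graph G" by fact
    show "\<not> ISK4 H G" for H using assms(3) by blast
    show "(u, w) \<notin> parcs G" if "(u, v) \<in> parcs G" "(v, w) \<in> parcs G" for u v w by (rule tri[OF that])
  qed
  have K33: "\<exists>a\<in>{a1, a2, a3}. \<exists>b\<in>{b1, b2, b3}. \<not> E a b" if d: "distinct [a1, a2, a3, b1, b2, b3]" for a1 a2 a3 b1 b2 b3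
  proof (rule ccontr)
    assume "\<not> ?thesis"
    then have e: "E a b" if "a \<in> {a1, a2, a3}" "b \<in> {b1, b2, b3}" for a b using that by blast
    \<comment> \<open>Vertices on one side have a common neighbour on the other, so
      triangle-freeness makes every K_{3,3} induced.\<close>
    have na: "\<not> E a a'" if "a \<in> {a1, a2, a3}" "a' \<in> {a1, a2, a3}" for a a'
      using no_triangle[of a a' b1] e[OF that(1), of b1] e[OF that(2), of b1] by blast
    have nb: "\<not> E b b'" if "b \<in> {b1, b2, b3}" "b' \<in> {b1, b2, b3}" for b b'
      using no_triangle[of a1 b b'] e[of a1 b] e[of a1 b'] that by blast
    let ?X = "{a1, a2, a3} \<union> {b1, b2, b3}"
    let ?B = "\<lparr>pverts = ?X, parcs = {(x, y). x \<in> ?X \<and> y \<in> ?X \<and> (x, y) \<in> parcs G}\<rparr>"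
    have "parcs ?B = {a1, a2, a3} \<times> {b1, b2, b3} \<union> {b1, b2, b3} \<times> {a1, a2, a3}"
    proof (intro equalityI subrelI)
      fix x y assume "(x, y) \<in> parcs ?B"
      then have "x \<in> ?X" "y \<in> ?X" "E x y" by auto
      then show "(x, y) \<in> {a1, a2, a3} \<times> {b1, b2, b3} \<union> {b1, b2, b3} \<times> {a1, a2, a3}"
        using na[of x y] nb[of x y] by blast
    next
      fix x y assume "(x, y) \<in> {a1, a2, a3} \<times> {b1, b2, b3} \<union> {b1, b2, b3} \<times> {a1, a2, a3}"
      then have "x \<in> ?X" "y \<in> ?X" "E x y" using e[of x y] sym[OF e[of y x]] by blast+
      then show "(x, y) \<in> parcs ?B" by auto
    qed
    moreover have "card {a1, a2, a3} = 3" "card {b1, b2, b3} = 3" "{a1, a2, a3} \<inter> {b1, b2, b3} = {}" using d by auto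
    ultimately have "complete_bipartite_digraph 3 3 (with_proj ?B)"
      unfolding complete_bipartite_digraph_pair_def by (intro conjI exI[of _ "{a1, a2, a3}"] exI[of _ "{b1, b2, b3}"]) simp_all
    moreover have "contains G ?B"
    proof (rule pg.contains_induced[OF _ refl])
      show "?X \<subseteq> pverts G" using e E_V by blast
    qed
    ultimately show False using assms(4) by blast
  qed
  have "\<exists>c x. is_wheel c x"
  proof (rule ccontr)
    assume nw: "\<not> ?thesis"
    interpret no_wheel_no_K33 G
    proof unfold_locales
      show "\<not> is_wheel c x" for c x using nw by blast
      show "\<exists>a\<in>{a1, a2, a3}. \<exists>b\<in>{b1, b2, b3}. \<not> E a b" if "distinct [a1, a2, a3, b1, b2, b3]" for a1 a2 a3 b1 b2 b3
        by (rule K33[OF that])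
    qed
    obtain H where H: "subgraph (with_proj H) (with_proj G)" "K4_subdivision H"
      using neg unfolding series_parallel_def by blast
    have "cycle_attached E V"
      using K4_subdivision_cycle_attached[OF H(2)] by (rule cycle_attached_mono) (use H(1) in \<open>auto simp: subgraph_def\<close>)
    then obtain Z D a b c where Z: "set Z \<union> D \<subseteq> V" "3 \<le> length Z" "distinct Z" "successively E Z" "E (last Z) (hd Z)"
      and DZ: "D \<inter> set Z = {}" and cn: "\<forall>x\<in>D. \<forall>y\<in>D. (\<lambda>u v. u \<in> D \<and> v \<in> D \<and> E u v)\<^sup>*\<^sup>* x y"
      and abc: "distinct [a, b, c]" "{a, b, c} \<subseteq> set Z" "\<exists>d\<in>D. E d a" "\<exists>d\<in>D. E d b" "\<exists>d\<in>D. E d c"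
      unfolding cycle_attached_def by (elim exE conjE) (rule that; assumption)
    have "cyc Z" using Z by (simp add: cyc_def)
    moreover have "conn D" using cn abc(3) unfolding conn_def by blast
    moreover have "{a, b, c} \<subseteq> attachments Z D" using abc unfolding attachments_def touches_def by blast
    then have "3 \<le> card (attachments Z D)" using card_3_le[OF abc(1) _ finite_attachments] by blast
    ultimately obtain C D' where C: "ihole C" "conn D'" "D' \<subseteq> V" "D' \<inter> set C = {}" "3 \<le> card (attachments C D')"
      using shrink_cycle[of Z D] Z(1) DZ by auto
    then show False using few_attachments[OF C(1-4)] by simp
  qed
  then obtain c x where "is_wheel c x" "\<not> bad c x" using wheel_not_bad by blast
  then show False using wheel_decompositionI neg by blast
qed

end
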